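(* The model checking problem for $\mathsf{PrL}_0$ is in $\mathsf{AC}^1$.
   Context: Modal formulas: $\varphi ::= \bot \mid p \mid \varphi\to\varphi \mid \Box\varphi$ with the usual abbreviations. A model for $\mathsf{PrL}$ is a Kripke model $(U,R,\xi)$ with $U$ finite nonempty, $R$ transitive and irreflexive, $\xi$ a valuation. Satisfaction: $s\not\models\bot$; $s\models p$ iff $s\in\xi(p)$; $s\models\varphi\to\psi$ iff $s\not\models\varphi$ or $s\models\psi$; $s\models\Box\varphi$ iff $t\models\varphi$ for all $t$ with $(s,t)\in R$. $\mathsf{PrL}_0$ denotes variable-free modal formulas. The model checking problem: given a variable-free formula, a finite $\mathsf{PrL}$ model (relation given by adjacency matrix) and a state $s$, decide whether the formula holds at $s$. $\mathsf{AC}^1$ is the class of problems decidable by alternating logspace machines with a logarithmically bounded number of alternations. *)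

theory Defs
  imports Complex_Main "HOL-Library.Landau_Symbols"
begin

section \<open>Provability logic: formulas, models, satisfaction\<close>

datatype fm = Bot | Var nat | Imp fm fm | Box fm

record 'w kripke =
  worlds :: "'w set"
  rel :: "('w \<times> 'w) set"
  val :: "nat \<Rightarrow> 'w set"

definition PrL_model :: "'w kripke \<Rightarrow> bool" where
  "PrL_model M \<longleftrightarrow>
     finite (worlds M) \<and> worlds M \<noteq> {} \<and>
     rel M \<subseteq> worlds M \<times> worlds M \<and> (\<forall>p. val M p \<subseteq> worlds M) \<and>
     trans (rel M) \<and> irrefl (rel M)"

primrec sat :: "'w kripke \<Rightarrow> 'w \<Rightarrow> fm \<Rightarrow> bool" where
  "sat M s Bot \<longleftrightarrow> False"
| "sat M s (Var p) \<longleftrightarrow> s \<in> val M p"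
| "sat M s (Imp \<phi> \<psi>) \<longleftrightarrow> \<not> sat M s \<phi> \<or> sat M s \<psi>"
| "sat M s (Box \<phi>) \<longleftrightarrow> (\<forall>t. (s, t) \<in> rel M \<longrightarrow> sat M t \<phi>)"

primrec vars :: "fm \<Rightarrow> nat set" where
  "vars Bot = {}"
| "vars (Var p) = {p}"
| "vars (Imp \<phi> \<psi>) = vars \<phi> \<union> vars \<psi>"
| "vars (Box \<phi>) = vars \<phi>"

definition PrL0 :: "fm set" where
  "PrL0 = {\<phi>. vars \<phi> = {}}"

lemma sat_PrL0_cong:
  "\<phi> \<in> PrL0 \<Longrightarrow> rel M = rel M' \<Longrightarrow> sat M s \<phi> \<longleftrightarrow> sat M' s \<phi>"
  by (induction \<phi> arbitrary: s) (auto simp: PrL0_def)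


section \<open>The model checking problem as a formal language\<close>

text \<open>
  An instance consists of a variable-free formula, a model whose worlds are numbered
  \<open>0, \<dots>, n - 1\<close>, and a world \<open>s\<close>. It is written as the formula in Polish notation,
  then the \<open>n\<close> rows of the adjacency matrix, each preceded by a separator, then a
  separator and \<open>s\<close> in unary; since the matrix already takes more than \<open>n\<^sup>2\<close> symbols, the
  unary notation does not inflate the input. The valuation is not written down, because it
  is irrelevant to variable-free formulas (lemma \<open>sat_PrL0_cong\<close>).
\<close>

datatype sym = SBot | SImp | SBox | Zero | One | Sep

instance sym :: finite
proof
  have "(UNIV :: sym set) = {SBot, SImp, SBox, Zero, One, Sep}"
    using sym.exhaust by blast
  then show "finite (UNIV :: sym set)" by (metis finite.simps)
qed

primrec (nonexhaustive) enc_fm :: "fm \<Rightarrow> sym list" where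
  "enc_fm Bot = [SBot]"
| "enc_fm (Imp \<phi> \<psi>) = SImp # enc_fm \<phi> @ enc_fm \<psi>"
| "enc_fm (Box \<phi>) = SBox # enc_fm \<phi>"

definition enc_row :: "nat kripke \<Rightarrow> nat \<Rightarrow> sym list" where
  "enc_row M i =
     Sep # map (\<lambda>j. if (i, j) \<in> rel M then One else Zero) [0..<card (worlds M)]"

definition enc_inst :: "fm \<Rightarrow> nat kripke \<Rightarrow> nat \<Rightarrow> sym list" where
  "enc_inst \<phi> M s =
     enc_fm \<phi> @ concat (map (enc_row M) [0..<card (worlds M)]) @ Sep # replicate s One"

definition PrL0_inst :: "fm \<Rightarrow> nat kripke \<Rightarrow> nat \<Rightarrow> bool" where
  "PrL0_inst \<phi> M s \<longleftrightarrow>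
     \<phi> \<in> PrL0 \<and> PrL_model M \<and> worlds M = {..<card (worlds M)} \<and> s \<in> worlds M"

definition PrL0_model_checking :: "sym list set" where
  "PrL0_model_checking = {enc_inst \<phi> M s | \<phi> M s. PrL0_inst \<phi> M s \<and> sat M s \<phi>}"

lemma enc_fm_inject:
  assumes "\<phi> \<in> PrL0" "\<psi> \<in> PrL0" "enc_fm \<phi> @ xs = enc_fm \<psi> @ ys"
  shows "\<phi> = \<psi> \<and> xs = ys"
  using assms
proof (induction \<phi> arbitrary: \<psi> xs ys)
  case Bot
  then show ?case by (cases \<psi>) (auto simp: PrL0_def)
next
  case (Var p)
  then show ?case by (simp add: PrL0_def)
next
  case (Imp \<phi>1 \<phi>2)
  from Imp.prems obtain \<psi>1 \<psi>2 where \<psi>: "\<psi> = Imp \<psi>1 \<psi>2"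
    by (cases \<psi>) (auto simp: PrL0_def)
  have P: "\<phi>1 \<in> PrL0" "\<phi>2 \<in> PrL0" "\<psi>1 \<in> PrL0" "\<psi>2 \<in> PrL0"
    using Imp.prems \<psi> by (auto simp: PrL0_def)
  have "enc_fm \<phi>1 @ (enc_fm \<phi>2 @ xs) = enc_fm \<psi>1 @ (enc_fm \<psi>2 @ ys)"
    using Imp.prems(3) \<psi> by simp
  from Imp.IH(1)[OF P(1,3) this] have 1: "\<phi>1 = \<psi>1" and "enc_fm \<phi>2 @ xs = enc_fm \<psi>2 @ ys"
    by auto
  from Imp.IH(2)[OF P(2,4) this(2)] 1 \<psi> show ?case by simp
next
  case (Box \<phi>)
  from Box.prems obtain \<psi>' where \<psi>: "\<psi> = Box \<psi>'"
    by (cases \<psi>) (auto simp: PrL0_def)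
  show ?case using Box.IH[of \<psi>' xs ys] Box.prems \<psi> by (auto simp: PrL0_def)
qed

lemma enc_inst_inject:
  assumes I: "PrL0_inst \<phi> M s" "PrL0_inst \<phi>' M' s'"
    and eq: "enc_inst \<phi> M s = enc_inst \<phi>' M' s'"
  shows "\<phi> = \<phi>' \<and> worlds M = worlds M' \<and> rel M = rel M' \<and> s = s'"
proof -
  let ?n = "card (worlds M)" and ?m = "card (worlds M')"
  let ?A = "\<lambda>M. concat (map (enc_row M) [0..<card (worlds M)])"
  have phi: "\<phi> = \<phi>'" and rest: "?A M @ Sep # replicate s One = ?A M' @ Sep # replicate s' One"
    using enc_fm_inject[of \<phi> \<phi>'] I eq by (auto simp: enc_inst_def PrL0_inst_def)
  have row: "count_list (enc_row M i) Sep = 1" for M i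
    by (auto simp: enc_row_def count_list_0_iff)
  have cc: "count_list (concat (map (enc_row M) xs)) Sep = length xs" for M xs
    by (induction xs) (auto simp: row)
  have cr: "count_list (replicate k One) Sep = 0" for k
    by (auto simp: count_list_0_iff)
  have nm: "?n = ?m"
    using arg_cong[OF rest, of "\<lambda>l. count_list l Sep"] by (simp add: cc cr)
  have lA: "length (?A M) = length (?A M')"
    by (simp add: length_concat enc_row_def nm comp_def)
  with rest have A: "?A M = ?A M'" and "replicate s One = replicate s' One"
    by auto
  then have s: "s = s'" by (metis length_replicate)
  have "map (enc_row M) [0..<?n] = map (enc_row M') [0..<?m]"
    using A nm by (subst concat_injective[of "map (enc_row M) [0..<?n]"])
      (auto simp: enc_row_def set_zip)
  then have "(i, j) \<in> rel M \<longleftrightarrow> (i, j) \<in> rel M'" if "i < ?n" "j < ?n" for i j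
    using that nm by (fastforce simp: enc_row_def split: if_splits)
  moreover have "rel M \<subseteq> {..<?n} \<times> {..<?n}" "rel M' \<subseteq> {..<?n} \<times> {..<?n}"
    using I nm by (auto simp: PrL0_inst_def PrL_model_def)
  ultimately have "rel M = rel M'" by auto
  moreover have "worlds M = worlds M'" using I nm by (simp add: PrL0_inst_def)
  ultimately show ?thesis using phi s by simp
qed

lemma enc_inst_in_PrL0_model_checking_iff:
  assumes "PrL0_inst \<phi> M s"
  shows "enc_inst \<phi> M s \<in> PrL0_model_checking \<longleftrightarrow> sat M s \<phi>"
  using assms enc_inst_inject[OF assms] sat_PrL0_cong
  unfolding PrL0_model_checking_def PrL0_inst_def by (smt (verit) mem_Collect_eq)


section \<open>Alternating Turing machines\<close>

text \<open>
  A machine has a two-way read-only input tape with end markers and \<open>num_tapes\<close>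
  one-way infinite work tapes.
\<close>

datatype move = MLeft | MStay | MRight
datatype 'a cell = LeftEnd | Sym 'a | RightEnd
datatype kind = Existential | Universal | Accepting | Rejecting

record ('q, 'a, 'g) atm =
  states :: "'q set"
  start :: 'q
  kind :: "'q \<Rightarrow> kind"
  num_tapes :: nat
  symbols :: "'g set"
  blank :: 'g
  transitions ::
    "(('q \<times> 'a cell \<times> 'g list) \<times> ('q \<times> move \<times> ('g \<times> move) list)) set"

definition atm :: "('q, 'a, 'g) atm \<Rightarrow> bool" where
  "atm M \<longleftrightarrow>
     finite (states M) \<and> start M \<in> states M \<and> finite (symbols M) \<and> blank M \<in> symbols M \<and>
     (\<forall>((q, a, gs), (q', d, acts)) \<in> transitions M.
        q \<in> states M \<and> kind M q \<in> {Existential, Universal} \<and>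
        length gs = num_tapes M \<and> set gs \<subseteq> symbols M \<and>
        q' \<in> states M \<and>
        length acts = num_tapes M \<and> fst ` set acts \<subseteq> symbols M)"

text \<open>
  A work tape is given by its contents and its head position. A configuration consists of
  the state, the position of the input head (\<open>0\<close> and \<open>length x + 1\<close> are the positions of
  the end markers) and the work tapes.
\<close>

type_synonym 'g tape = "(nat \<Rightarrow> 'g) \<times> nat"
type_synonym ('q, 'g) config = "'q \<times> nat \<times> 'g tape list"

definition scan :: "'a list \<Rightarrow> nat \<Rightarrow> 'a cell" where
  "scan x i =
     (if i = 0 then LeftEnd else if i \<le> length x then Sym (x ! (i - 1)) else RightEnd)"

fun shift :: "move \<Rightarrow> nat \<Rightarrow> nat" where
  "shift MLeft i = i - 1"
| "shift MStay i = i"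
| "shift MRight i = i + 1"

fun read :: "'g tape \<Rightarrow> 'g" where
  "read (t, h) = t h"

fun act :: "'g tape \<Rightarrow> 'g \<times> move \<Rightarrow> 'g tape" where
  "act (t, h) (g, d) = (t(h := g), shift d h)"

definition init :: "('q, 'a, 'g) atm \<Rightarrow> ('q, 'g) config" where
  "init M = (start M, 0, replicate (num_tapes M) (\<lambda>_. blank M, 0))"

text \<open>Heads do not move beyond the end markers or the left end of a work tape.\<close>

inductive step :: "('q, 'a, 'g) atm \<Rightarrow> 'a list \<Rightarrow> ('q, 'g) config \<Rightarrow> ('q, 'g) config \<Rightarrow> bool"
  for M x where
  "((q, scan x i, map read ts), (q', d, acts)) \<in> transitions M \<Longrightarrow>
   step M x (q, i, ts) (q', min (shift d i) (length x + 1), map2 act ts acts)"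

abbreviation ckind :: "('q, 'a, 'g) atm \<Rightarrow> ('q, 'g) config \<Rightarrow> kind" where
  "ckind M c \<equiv> kind M (fst c)"

inductive accepts :: "('q, 'a, 'g) atm \<Rightarrow> 'a list \<Rightarrow> ('q, 'g) config \<Rightarrow> bool"
  for M x where
  "ckind M c = Accepting \<Longrightarrow> accepts M x c"
| "ckind M c = Existential \<Longrightarrow> step M x c c' \<Longrightarrow> accepts M x c' \<Longrightarrow> accepts M x c"
| "ckind M c = Universal \<Longrightarrow> (\<And>c'. step M x c c' \<Longrightarrow> accepts M x c') \<Longrightarrow> accepts M x c"

definition language :: "('q, 'a, 'g) atm \<Rightarrow> 'a list set" where
  "language M = {x. accepts M x (init M)}"

definition alternates :: "('q, 'a, 'g) atm \<Rightarrow> ('q, 'g) config \<Rightarrow> ('q, 'g) config \<Rightarrow> bool" where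
  "alternates M c c' \<longleftrightarrow> {ckind M c, ckind M c'} = {Existential, Universal}"

text \<open>
  \<open>reaches M x k c\<close>: some computation path from the initial configuration to \<open>c\<close>
  has exactly \<open>k\<close> alternations.
\<close>

inductive reaches :: "('q, 'a, 'g) atm \<Rightarrow> 'a list \<Rightarrow> nat \<Rightarrow> ('q, 'g) config \<Rightarrow> bool"
  for M x where
  "reaches M x 0 (init M)"
| "reaches M x k c \<Longrightarrow> step M x c c' \<Longrightarrow>
   reaches M x (if alternates M c c' then k + 1 else k) c'"

text \<open>
  The cells visited on a work tape form an initial segment, so that bounding the head
  positions in all reachable configurations bounds the number of cells used.
\<close>

definition space_bounded :: "('q, 'a, 'g) atm \<Rightarrow> (nat \<Rightarrow> nat) \<Rightarrow> bool" where
  "space_bounded M f \<longleftrightarrow>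
     (\<forall>x k q i ts t h. reaches M x k (q, i, ts) \<and> (t, h) \<in> set ts \<longrightarrow> h + 1 \<le> f (length x))"

definition alternation_bounded :: "('q, 'a, 'g) atm \<Rightarrow> (nat \<Rightarrow> nat) \<Rightarrow> bool" where
  "alternation_bounded M f \<longleftrightarrow> (\<forall>x k c. reaches M x k c \<longrightarrow> k \<le> f (length x))"

text \<open>Up to renaming, states and work symbols are natural numbers.\<close>

definition AC1 :: "'a::finite list set set" where
  "AC1 = {L. \<exists>(M :: (nat, 'a, nat) atm) f g.
     atm M \<and> language M = L \<and>
     space_bounded M f \<and> (\<lambda>n. real (f n)) \<in> O(\<lambda>n. ln (real n)) \<and>
     alternation_bounded M g \<and> (\<lambda>n. real (g n)) \<in> O(\<lambda>n. ln (real n))}"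

end

theory Submission
  imports Defs "HOL-Library.Countable" "HOL-Real_Asymp.Real_Asymp"
begin

text \<open>
  By transitivity, the successors of a world of rank \<open>k\<close> (the length of a longest chain from it)
  have exactly the ranks below \<open>k\<close>. A variable-free formula therefore sees nothing but the rank and
  can be evaluated in the linear order of the natural numbers, where a boxed formula is true on an
  initial segment and its truth set is described by logarithmically many bits. This makes Brent's
  formula balancing available to an alternating machine: the prover cuts the formula at a node and
  proposes its truth set, and the opponent picks the part with which to continue. Since
  a proposed fact is challenged wherever the cut is made, soundness does not depend on the choice of
  the cut, so the machine never has to search for a balanced one: it suffices that the
  prover can win in logarithmically many rounds. Checking the input and the guessed
  rank takes a bounded number of alternations.
\<close>

section \<open>One-tape machines over countable types\<close>

text \<open>The obstacle to balancing is the box. A claim below a box is made at a point that is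
  still to be chosen, so a cut there calls for a truth set and not for one truth value; but only
  boxed nodes are sure to be true on an initial segment, while the truth set of an implication may
  have many gaps. Hence a fact is a threshold together with an interval: a boxed node is described
  on all points at once, any other node on a single point, which is enough as long as no box
  separates it from the claim. Cutting at an arbitrary node then means cutting at the nearest box
  above it as well, and this is where the additional rounds come from. The resource bounds must hold
  on every computation path, also for malformed inputs and bad guesses. So they are enforced by the
  machine itself: each tape column carries one token, the game loop burns one token per pass, and
  the number of columns is the binary length of the last input position. Ranks are guessed and then
  confirmed by one walk of that length and by the failure of all walks one step longer, which is why
  rank is phrased in terms of chains.\<close>

instance sym :: countable by countable_datatype
instance cell :: (countable) countable by countable_datatype

lemma accepts_iff:
  "accepts M x c \<longleftrightarrow> ckind M c = Accepting \<or>
     ckind M c = Existential \<and> (\<exists>c'. step M x c c' \<and> accepts M x c') \<or>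
     ckind M c = Universal \<and> (\<forall>c'. step M x c c' \<longrightarrow> accepts M x c')"
  by (subst accepts.simps) blast

text \<open>
  States and work symbols are drawn from countable types that need not be finite; only the part
  closed under the transition function has to be.
\<close>

type_synonym ('q, 'a, 'g) delta = "'q \<Rightarrow> 'a cell \<Rightarrow> 'g \<Rightarrow> ('q \<times> move \<times> 'g \<times> move) set"

definition one_tape :: "('q, 'a, 'g) delta \<Rightarrow> ('q \<Rightarrow> kind) \<Rightarrow> 'q \<Rightarrow> 'g \<Rightarrow> ('q, 'a, 'g) atm" where
  "one_tape \<delta> knd q\<^sub>0 b =
     \<lparr>states = UNIV, start = q\<^sub>0, kind = knd, num_tapes = 1, symbols = UNIV, blank = b,
      transitions = {((q, a, [g]), (q', d, [(g', d')])) | q a g q' d g' d'. (q', d, g', d') \<in> \<delta> q a g}\<rparr>"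

lemma one_tape_sel [simp]:
  "start (one_tape \<delta> knd q\<^sub>0 b) = q\<^sub>0" "kind (one_tape \<delta> knd q\<^sub>0 b) = knd"
  "num_tapes (one_tape \<delta> knd q\<^sub>0 b) = 1" "blank (one_tape \<delta> knd q\<^sub>0 b) = b"
  by (simp_all add: one_tape_def)

lemma step_one_tape:
  "step (one_tape \<delta> knd q\<^sub>0 b) x (q, i, [(t, h)]) c' \<longleftrightarrow>
     (\<exists>(q', d, g', d') \<in> \<delta> q (scan x i) (t h).
        c' = (q', min (shift d i) (length x + 1), [(t(h := g'), shift d' h)]))"
proof
  assume "step (one_tape \<delta> knd q\<^sub>0 b) x (q, i, [(t, h)]) c'"
  then show "\<exists>(q', d, g', d') \<in> \<delta> q (scan x i) (t h).
      c' = (q', min (shift d i) (length x + 1), [(t(h := g'), shift d' h)])"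
    by cases (force simp: one_tape_def)
next
  assume "\<exists>(q', d, g', d') \<in> \<delta> q (scan x i) (t h).
      c' = (q', min (shift d i) (length x + 1), [(t(h := g'), shift d' h)])"
  then obtain q' d g' d' where *: "(q', d, g', d') \<in> \<delta> q (scan x i) (t h)"
    "c' = (q', min (shift d i) (length x + 1), [(t(h := g'), shift d' h)])" by blast
  have "((q, scan x i, map read [(t, h)]), (q', d, [(g', d')])) \<in> transitions (one_tape \<delta> knd q\<^sub>0 b)"
    using *(1) by (simp add: one_tape_def)
  from step.intros[OF this] show "step (one_tape \<delta> knd q\<^sub>0 b) x (q, i, [(t, h)]) c'"
    using *(2) by simp
qed

locale finite_one_tape =
  fixes \<delta> :: "('q :: countable, 'a :: finite, 'g :: countable) delta"
    and knd :: "'q \<Rightarrow> kind" and q\<^sub>0 :: 'q and b :: 'g and S :: "'q set" and G :: "'g set"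
  assumes fin: "finite S" "finite G" and start: "q\<^sub>0 \<in> S" "b \<in> G"
    and closed: "q \<in> S \<Longrightarrow> g \<in> G \<Longrightarrow> (q', d, g', d') \<in> \<delta> q a g \<Longrightarrow> q' \<in> S \<and> g' \<in> G"
    and knd: "q \<in> S \<Longrightarrow> \<delta> q a g \<noteq> {} \<Longrightarrow> knd q \<in> {Existential, Universal}"
begin

abbreviation "U \<equiv> one_tape \<delta> knd q\<^sub>0 b"

text \<open>Restricting the transitions to \<open>S\<close> and \<open>G\<close> is what makes
  \<open>atm\<close> provable, as it wants the states and symbols of all transitions in finite sets.
  Seen from a configuration inside \<open>S\<close> and \<open>G\<close> nothing is lost, because
  \<open>closed\<close> keeps the successors inside.\<close>

definition N :: "(nat, 'a, nat) atm" where
  "N = \<lparr>states = to_nat ` S, start = to_nat q\<^sub>0, kind = knd \<circ> from_nat, num_tapes = 1,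
        symbols = to_nat ` G, blank = to_nat b,
        transitions = {((to_nat q, a, [to_nat g]), (to_nat q', d, [(to_nat g', d')])) | q a g q' d g' d'.
           q \<in> S \<and> g \<in> G \<and> (q', d, g', d') \<in> \<delta> q a g}\<rparr>"

fun rename :: "'q \<times> nat \<times> (nat \<Rightarrow> 'g) \<times> nat \<Rightarrow> (nat, nat) config" where
  "rename (q, i, t, h) = (to_nat q, i, [(to_nat \<circ> t, h)])"

fun plain :: "'q \<times> nat \<times> (nat \<Rightarrow> 'g) \<times> nat \<Rightarrow> ('q, 'g) config" where
  "plain (q, i, t, h) = (q, i, [(t, h)])"

fun valid :: "'q \<times> nat \<times> (nat \<Rightarrow> 'g) \<times> nat \<Rightarrow> bool" where
  "valid (q, i, t, h) \<longleftrightarrow> q \<in> S \<and> range t \<subseteq> G"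

declare split_paired_Ex [simp del] split_paired_All [simp del]

lemma atm_N: "atm N"
proof -
  have "q \<in> states N \<and> kind N q \<in> {Existential, Universal} \<and>
        length gs = num_tapes N \<and> set gs \<subseteq> symbols N \<and>
        q' \<in> states N \<and> length acts = num_tapes N \<and> fst ` set acts \<subseteq> symbols N"
    if tr: "((q, a, gs), (q', d, acts)) \<in> transitions N" for q a gs q' d acts
  proof -
    from tr obtain p g p' g' d' where *: "q = to_nat p" "gs = [to_nat g]" "q' = to_nat p'"
      "acts = [(to_nat g', d')]" "p \<in> S" "g \<in> G" "(p', d, g', d') \<in> \<delta> p a g"
      by (auto simp: N_def)
    have "p' \<in> S" "g' \<in> G" using closed[OF *(5,6,7)] by auto
    moreover have "knd p \<in> {Existential, Universal}" using knd[OF *(5)] *(7) by blast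
    ultimately show ?thesis using * by (simp add: N_def)
  qed
  then have "\<forall>((q, a, gs), (q', d, acts)) \<in> transitions N.
        q \<in> states N \<and> kind N q \<in> {Existential, Universal} \<and>
        length gs = num_tapes N \<and> set gs \<subseteq> symbols N \<and>
        q' \<in> states N \<and> length acts = num_tapes N \<and> fst ` set acts \<subseteq> symbols N"
    by blast
  moreover have "finite (states N)" "start N \<in> states N" "finite (symbols N)" "blank N \<in> symbols N"
    using fin start by (auto simp: N_def)
  ultimately show ?thesis unfolding atm_def by blast
qed

lemma kind_N: "ckind N (rename c) = ckind U (plain c)"
  by (cases c) (simp add: N_def)

text \<open>A bisimulation on valid configurations: validity puts the transitions of
  \<open>U\<close> among those retained in \<open>N\<close>, and injectivity of
  \<open>to_nat\<close> leads back from \<open>N\<close> to \<open>U\<close>.\<close>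

lemma step_N:
  assumes "valid c"
  shows "step N x (rename c) d \<longleftrightarrow> (\<exists>c'. valid c' \<and> step U x (plain c) (plain c') \<and> d = rename c')"
proof -
  obtain q i t h where c: "c = (q, i, t, h)" by (cases c)
  from assms c have q: "q \<in> S" and t: "range t \<subseteq> G" by auto
  have eq: "to_nat \<circ> t(h := g) = (to_nat \<circ> t)(h := to_nat g)" for g by auto
  have "step N x (rename c) d \<longleftrightarrow> (\<exists>(q', e, g', e') \<in> \<delta> q (scan x i) (t h).
      d = (to_nat q', min (shift e i) (length x + 1), [(to_nat \<circ> t(h := g'), shift e' h)]))"
  proof
    assume "step N x (rename c) d"
    then show "\<exists>(q', e, g', e') \<in> \<delta> q (scan x i) (t h).
      d = (to_nat q', min (shift e i) (length x + 1), [(to_nat \<circ> t(h := g'), shift e' h)])"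
      unfolding c rename.simps
    proof cases
      case (1 q' e acts)
      then obtain p p' g g' e' where *: "to_nat q = to_nat p" "map read [(to_nat \<circ> t, h)] = [to_nat g]"
        "q' = to_nat p'" "acts = [(to_nat g', e')]" "(p', e, g', e') \<in> \<delta> p (scan x i) g"
        unfolding N_def by auto
      then have "(p', e, g', e') \<in> \<delta> q (scan x i) (t h)" by simp
      moreover have "d = (to_nat p', min (shift e i) (length x + 1), [(to_nat \<circ> t(h := g'), shift e' h)])"
        using 1(1) *(3,4) unfolding eq by simp
      ultimately show ?thesis by blast
    qed
  next
    assume "\<exists>(q', e, g', e') \<in> \<delta> q (scan x i) (t h).
      d = (to_nat q', min (shift e i) (length x + 1), [(to_nat \<circ> t(h := g'), shift e' h)])"
    then obtain q' e g' e' where *: "(q', e, g', e') \<in> \<delta> q (scan x i) (t h)"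
      "d = (to_nat q', min (shift e i) (length x + 1), [(to_nat \<circ> t(h := g'), shift e' h)])" by blast
    have "((to_nat q, scan x i, map read [(to_nat \<circ> t, h)]), (to_nat q', e, [(to_nat g', e')])) \<in> transitions N"
    proof -
      have "t h \<in> G" using t by auto
      with *(1) q show ?thesis unfolding N_def by simp
    qed
    from step.intros[OF this] show "step N x (rename c) d"
      unfolding *(2) eq c rename.simps by simp
  qed
  also have "\<dots> \<longleftrightarrow> (\<exists>c'. valid c' \<and> step U x (plain c) (plain c') \<and> d = rename c')"
  proof
    assume "\<exists>(q', e, g', e') \<in> \<delta> q (scan x i) (t h).
      d = (to_nat q', min (shift e i) (length x + 1), [(to_nat \<circ> t(h := g'), shift e' h)])"
    then obtain q' e g' e' where *: "(q', e, g', e') \<in> \<delta> q (scan x i) (t h)"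
      "d = (to_nat q', min (shift e i) (length x + 1), [(to_nat \<circ> t(h := g'), shift e' h)])" by blast
    let ?c = "(q', min (shift e i) (length x + 1), t(h := g'), shift e' h)"
    have v: "valid ?c" using closed[OF q _ *(1)] t by auto
    have st: "step U x (plain c) (plain ?c)"
      unfolding c plain.simps step_one_tape by (rule bexI[OF _ *(1)]) simp
    have "d = rename ?c" unfolding *(2) rename.simps ..
    with v st show "\<exists>c'. valid c' \<and> step U x (plain c) (plain c') \<and> d = rename c'"
      by (intro exI[of _ ?c] conjI)
  next
    assume "\<exists>c'. valid c' \<and> step U x (plain c) (plain c') \<and> d = rename c'"
    then obtain c' where c': "step U x (plain c) (plain c')" "d = rename c'" by blast
    then obtain q' e g' e' where *: "(q', e, g', e') \<in> \<delta> q (scan x i) (t h)"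
      "plain c' = (q', min (shift e i) (length x + 1), [(t(h := g'), shift e' h)])"
      unfolding c plain.simps step_one_tape by blast
    from *(2) have "rename c' = (to_nat q', min (shift e i) (length x + 1), [(to_nat \<circ> t(h := g'), shift e' h)])"
      by (cases c') auto
    with *(1) c'(2) show "\<exists>(q', e, g', e') \<in> \<delta> q (scan x i) (t h).
      d = (to_nat q', min (shift e i) (length x + 1), [(to_nat \<circ> t(h := g'), shift e' h)])" by blast
  qed
  finally show ?thesis .
qed

lemma step_plain:
  assumes "step U x (plain c) d" "valid c"
  obtains c' where "d = plain c'" "valid c'"
proof -
  obtain q i t h where c: "c = (q, i, t, h)" by (cases c)
  from assms(1) obtain q' e g' e' where *: "(q', e, g', e') \<in> \<delta> q (scan x i) (t h)"
    "d = (q', min (shift e i) (length x + 1), [(t(h := g'), shift e' h)])"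
    unfolding c plain.simps step_one_tape by blast
  let ?c = "(q', min (shift e i) (length x + 1), t(h := g'), shift e' h)"
  have "valid ?c" using closed[OF _ _ *(1)] assms(2) c by auto
  then show ?thesis using * that[of ?c] by auto
qed

text \<open>The existential case carries a step of \<open>U\<close> over to \<open>N\<close>, the
  universal case pulls a step of \<open>N\<close> back to \<open>U\<close>; so even this one
  implication uses the bisimulation in both directions.\<close>

lemma accepts_rename_if:
  assumes "accepts U x d" "d = plain c" "valid c"
  shows "accepts N x (rename c)"
  using assms
proof (induction arbitrary: c)
  case (1 d)
  then show ?case using kind_N[of c] accepts.intros(1)[of N "rename c" x] by simp
next
  case (2 d d')
  then have "step U x (plain c) d'" by simp
  then obtain c' where c': "d' = plain c'" "valid c'" using \<open>valid c\<close> by (rule step_plain)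
  have "step N x (rename c) (rename c')" using 2 c' step_N[of c x "rename c'"] by blast
  moreover have "ckind N (rename c) = Existential" using 2 kind_N[of c] by simp
  ultimately show ?case using 2(4)[OF c'] accepts.intros(2)[of N "rename c"] by blast
next
  case (3 d)
  have "accepts N x e" if "step N x (rename c) e" for e
    using that 3 step_N[of c x e] by blast
  moreover have "ckind N (rename c) = Universal" using 3 kind_N[of c] by simp
  ultimately show ?case by (rule accepts.intros(3)[rotated])
qed

lemma accepts_plain_if:
  assumes "accepts N x d" "d = rename c" "valid c"
  shows "accepts U x (plain c)"
  using assms
proof (induction arbitrary: c)
  case (1 d)
  then show ?case using kind_N[of c] accepts.intros(1)[of U "plain c" x] by simp
next
  case (2 d d')
  then obtain c' where c': "d' = rename c'" "valid c'" "step U x (plain c) (plain c')"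
    using step_N[of c x d'] by blast
  have "ckind U (plain c) = Existential" using 2 kind_N[of c] by simp
  then show ?case using c'(3) 2(4)[OF c'(1,2)] by (rule accepts.intros(2))
next
  case (3 d)
  have "accepts U x e" if st: "step U x (plain c) e" for e
  proof -
    obtain c' where c': "e = plain c'" "valid c'" by (rule step_plain[OF st \<open>valid c\<close>])
    then have "step N x d (rename c')" using 3 st step_N[of c x "rename c'"] by blast
    then show ?thesis using 3(3) c' by blast
  qed
  moreover have "ckind U (plain c) = Universal" using 3 kind_N[of c] by simp
  ultimately show ?case by (rule accepts.intros(3)[rotated])
qed

lemma init_eqs: "init N = rename (q\<^sub>0, 0, \<lambda>_. b, 0)" "init U = plain (q\<^sub>0, 0, \<lambda>_. b, 0)"
  "valid (q\<^sub>0, 0, \<lambda>_. b, 0)"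
  using start by (auto simp: init_def N_def comp_def)

lemma language_N: "language N = language U"
proof -
  have "accepts N x (init N) \<longleftrightarrow> accepts U x (init U)" for x
    unfolding init_eqs
    using accepts_plain_if[OF _ refl init_eqs(3)] accepts_rename_if[OF _ refl init_eqs(3)] by metis
  then show ?thesis unfolding language_def by simp
qed

text \<open>One direction is enough, since \<open>N\<close> inherits its space and alternation
  bounds from \<open>U\<close>.\<close>

lemma reaches_N:
  assumes "reaches N x k d"
  shows "\<exists>c. d = rename c \<and> valid c \<and> reaches U x k (plain c)"
  using assms
proof induction
  case 1
  have "reaches U x 0 (plain (q\<^sub>0, 0, \<lambda>_. b, 0))"
    using reaches.intros(1)[of U x] unfolding init_eqs .
  with init_eqs(1,3) show ?case by (intro exI[of _ "(q\<^sub>0, 0, \<lambda>_. b, 0)"] conjI)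
next
  case (2 k d d')
  then obtain c where c: "d = rename c" "valid c" "reaches U x k (plain c)" by blast
  have "step N x (rename c) d'" using 2(2) c(1) by simp
  then obtain c' where c': "valid c'" "step U x (plain c) (plain c')" "d' = rename c'"
    unfolding step_N[OF c(2)] by (elim exE conjE)
  have "alternates N d d' \<longleftrightarrow> alternates U (plain c) (plain c')"
    by (simp add: alternates_def c c' kind_N)
  then have "reaches U x (if alternates N d d' then k + 1 else k) (plain c')"
    using reaches.intros(2)[OF c(3) c'(2)] by simp
  with c' show ?case by blast
qed

theorem in_AC1:
  assumes space: "\<And>x k q i t h. reaches U x k (q, i, [(t, h)]) \<Longrightarrow> h + 1 \<le> f (length x)"
    and alt: "\<And>x k q i t h. reaches U x k (q, i, [(t, h)]) \<Longrightarrow> k \<le> g (length x)"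
    and "(\<lambda>n. real (f n)) \<in> O(\<lambda>n. ln (real n))" "(\<lambda>n. real (g n)) \<in> O(\<lambda>n. ln (real n))"
  shows "language U \<in> AC1"
proof -
  have "h + 1 \<le> f (length x)" if r: "reaches N x k (q, i, ts)" and h: "(t, h) \<in> set ts" for x k q i ts t h
  proof -
    obtain c where c: "(q, i, ts) = rename c \<and> valid c \<and> reaches U x k (plain c)"
      using reaches_N[OF r] ..
    obtain q' i' t' h' where c': "c = (q', i', t', h')" by (cases c)
    from c h have "h = h'" by (simp add: c')
    with c space[of x k q' i' t' h'] show ?thesis by (simp add: c')
  qed
  then have "space_bounded N f" unfolding space_bounded_def by blast
  moreover have "k \<le> g (length x)" if r: "reaches N x k d" for x k d
  proof -
    obtain c where c: "d = rename c \<and> valid c \<and> reaches U x k (plain c)"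
      using reaches_N[OF r] ..
    obtain q' i' t' h' where c': "c = (q', i', t', h')" by (cases c)
    from c alt[of x k q' i' t' h'] show ?thesis by (simp add: c')
  qed
  then have "alternation_bounded N g" unfolding alternation_bounded_def by blast
  ultimately have "atm N \<and> language N = language U \<and>
     space_bounded N f \<and> (\<lambda>n. real (f n)) \<in> O(\<lambda>n. ln (real n)) \<and>
     alternation_bounded N g \<and> (\<lambda>n. real (g n)) \<in> O(\<lambda>n. ln (real n))"
    using atm_N language_N assms(3,4) by (simp only: simp_thms)
  then show ?thesis
    unfolding AC1_def
    by - (rule CollectI, rule exI[of _ N], rule exI[of _ f], rule exI[of _ g], assumption)
qed

end

section \<open>A while language for alternating logarithmic space\<close>

text \<open>
  All registers live on one work tape, one register per track: the \<open>i\<close>-th bit of every register is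
  stored in cell \<open>i + 1\<close>, together with one bit of a fuel counter in unary. Every operation
  is a single pass from the least significant bit upwards, with one bit of carry.
\<close>

abbreviation numregs :: nat where "numregs \<equiv> 32"

datatype opn = Zero_op nat | Inc nat | Dec nat | Copy nat nat | Guess nat | NZ nat | Eq nat nat | Less nat nat | Pop

datatype test = TOp opn | TScan "sym cell list"

datatype com =
    Skip | Seq com com (infixr ";;" 60) | Do opn | Head_left | Head_right | Switch bool
  | Succeed | Fail | If test com com | While test com

instance opn :: countable by countable_datatype
instance test :: countable by countable_datatype
instance com :: countable by countable_datatype

text \<open>The Boolean in the first three control states marks existential mode.\<close>

datatype ctrl =
    Home bool "com list" | Pass bool bool "com list" | Ret bool "com list"
  | Start | Seek_end | Incr | Incr_ret

datatype tsym = Blank | LMark | Col bool "bool list"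

instance ctrl :: countable by countable_datatype
instance tsym :: countable by countable_datatype

fun carry_in :: "opn \<Rightarrow> bool" where
  "carry_in (Inc r) = True" | "carry_in (Dec r) = True" | "carry_in (Eq r s) = True" | "carry_in _ = False"

text \<open>The pass starts at the least significant bit, so in \<open>Less\<close> a later
  differing bit overrides the verdict of the lower ones. In \<open>Pop\<close> the carry means that
  a token has been taken already: only the first token met is removed, and the final carry tells
  whether there was one.\<close>

fun column :: "opn \<Rightarrow> bool \<Rightarrow> bool \<Rightarrow> bool list \<Rightarrow> (bool \<times> bool \<times> bool list) set" where
  "column (Zero_op r) q f bs = {(q, f, bs[r := False])}"
| "column (Inc r) q f bs = {(q \<and> bs ! r, f, bs[r := (bs ! r \<noteq> q)])}"
| "column (Dec r) q f bs = {(q \<and> \<not> bs ! r, f, bs[r := (bs ! r \<noteq> q)])}"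
| "column (Copy r s) q f bs = {(q, f, bs[r := bs ! s])}"
| "column (Guess r) q f bs = {(q, f, bs[r := True]), (q, f, bs[r := False])}"
| "column (NZ r) q f bs = {(q \<or> bs ! r, f, bs)}"
| "column (Eq r s) q f bs = {(q \<and> bs ! r = bs ! s, f, bs)}"
| "column (Less r s) q f bs = {(if bs ! r = bs ! s then q else bs ! s, f, bs)}"
| "column Pop q f bs = {(q \<or> f, f \<and> q, bs)}"

fun opn_of :: "com list \<Rightarrow> opn" where
  "opn_of (Do a # K) = a"
| "opn_of (If (TOp a) c d # K) = a"
| "opn_of (While (TOp a) c # K) = a"
| "opn_of _ = Pop"

text \<open>\<open>q\<close> is the outcome of a test: the final carry of a pass, or membership of
  the scanned input cell.\<close>

fun continue :: "bool \<Rightarrow> com list \<Rightarrow> com list" where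
  "continue q (Do a # K) = K"
| "continue q (If t c d # K) = (if q then c else d) # K"
| "continue q (While t c # K) = (if q then c # While t c # K else K)"
| "continue q L = L"

fun exec :: "bool \<Rightarrow> com list \<Rightarrow> sym cell \<Rightarrow> tsym \<Rightarrow> (ctrl \<times> move \<times> tsym \<times> move) set" where
  "exec m [] a g = {}"
| "exec m (Skip # K) a g = {(Home m K, MStay, g, MStay)}"
| "exec m ((c ;; d) # K) a g = {(Home m (c # d # K), MStay, g, MStay)}"
| "exec m (Head_left # K) a g = {(Home m K, MLeft, g, MStay)}"
| "exec m (Head_right # K) a g = {(Home m K, MRight, g, MStay)}"
| "exec m (Switch m' # K) a g = {(Home m' K, MStay, g, MStay)}"
| "exec m (Succeed # K) a g = {}"
| "exec m (Fail # K) a g = {}"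
| "exec m (If (TScan cs) c d # K) a g = {(Home m (continue (a \<in> set cs) (If (TScan cs) c d # K)), MStay, g, MStay)}"
| "exec m (While (TScan cs) c # K) a g = {(Home m (continue (a \<in> set cs) (While (TScan cs) c # K)), MStay, g, MStay)}"
| "exec m L a g = {(Pass m (carry_in (opn_of L)) L, MStay, g, MRight)}"

text \<open>Columns are created only by \<open>Incr\<close> on a blank cell, and each one comes with
  a token, so the initial fuel equals the number of columns. A pass turns around at the first blank
  and ends at \<open>LMark\<close>.\<close>

fun delta :: "(ctrl, sym, tsym) delta" where
  "delta (Home m L) a g = exec m L a g"
| "delta (Pass m q L) a (Col f bs) =
     (\<lambda>(q', f', bs'). (Pass m q' L, MStay, Col f' bs', MRight)) ` column (opn_of L) q f bs"
| "delta (Pass m q L) a Blank = {(Ret m (continue q L), MStay, Blank, MLeft)}"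
| "delta (Ret m L) a (Col f bs) = {(Ret m L, MStay, Col f bs, MLeft)}"
| "delta (Ret m L) a LMark = {(Home m L, MStay, LMark, MStay)}"
| "delta Incr a (Col f bs) =
     (if bs ! 0 then {(Incr, MStay, Col f (bs[0 := False]), MRight)}
      else {(Incr_ret, MStay, Col f (bs[0 := True]), MLeft)})"
| "delta Incr a Blank = {(Incr_ret, MStay, Col True (True # replicate (numregs - 1) False), MLeft)}"
| "delta Incr_ret a (Col f bs) = {(Incr_ret, MStay, Col f bs, MLeft)}"
| "delta Incr_ret a LMark = {(Seek_end, MStay, LMark, MStay)}"
| "delta _ a g = {}"

text \<open>
  The states \<open>Start\<close>, \<open>Seek_end\<close>, \<open>Incr\<close> and \<open>Incr_ret\<close> count the cells of the input tape in
  register \<open>0\<close>, which creates just enough columns for registers to hold all input positions.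
\<close>

fun full_delta :: "com \<Rightarrow> (ctrl, sym, tsym) delta" where
  "full_delta p Start a g = {(Seek_end, MStay, LMark, MStay)}"
| "full_delta p Seek_end a g =
     (if a = RightEnd then {(Home True [p], MStay, g, MStay)} else {(Incr, MRight, g, MRight)})"
| "full_delta p q a g = delta q a g"

fun ckd :: "ctrl \<Rightarrow> kind" where
  "ckd (Home m []) = Rejecting"
| "ckd (Home m (Succeed # K)) = Accepting"
| "ckd (Home m (Fail # K)) = Rejecting"
| "ckd (Home m L) = (if m then Existential else Universal)"
| "ckd (Pass m q L) = (if m then Existential else Universal)"
| "ckd (Ret m L) = (if m then Existential else Universal)"
| "ckd _ = Existential"

abbreviation machine :: "com \<Rightarrow> (ctrl, sym, tsym) atm" where
  "machine p \<equiv> one_tape (full_delta p) ckd Start Blank"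

subsection \<open>Finiteness\<close>

text \<open>The stacks that can arise while \<open>c\<close> runs on top of \<open>K\<close>. The
  body of a loop runs on top of the loop itself and not on ever longer stacks, which keeps the set
  finite.\<close>

primrec conts :: "com \<Rightarrow> com list \<Rightarrow> com list set" where
  "conts Skip K = {Skip # K}"
| "conts (c ;; d) K = {(c ;; d) # K} \<union> conts c (d # K) \<union> conts d K"
| "conts (Do a) K = {Do a # K}"
| "conts Head_left K = {Head_left # K}"
| "conts Head_right K = {Head_right # K}"
| "conts (Switch m) K = {Switch m # K}"
| "conts Succeed K = {Succeed # K}"
| "conts Fail K = {Fail # K}"
| "conts (If t c d) K = {If t c d # K} \<union> conts c K \<union> conts d K"
| "conts (While t c) K = {While t c # K} \<union> conts c (While t c # K)"

lemma finite_conts: "finite (conts c K)"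
  by (induction c arbitrary: K) auto

lemma conts_self: "c # K \<in> conts c K"
  by (cases c) auto

inductive follows :: "com list \<Rightarrow> com list \<Rightarrow> bool" where
  "follows (Skip # K) K"
| "follows ((c ;; d) # K) (c # d # K)"
| "follows (Do a # K) K"
| "follows (Head_left # K) K"
| "follows (Head_right # K) K"
| "follows (Switch m # K) K"
| "follows (If t c d # K) (c # K)"
| "follows (If t c d # K) (d # K)"
| "follows (While t c # K) (c # While t c # K)"
| "follows (While t c # K) K"

lemma follows_conts:
  assumes "L \<in> conts c K" "follows L L'"
  shows "L' \<in> conts c K \<or> L' = K"
  using assms
proof (induction c arbitrary: K L L')
  case (Seq c d)
  then consider "L = (c ;; d) # K" | "L \<in> conts c (d # K)" | "L \<in> conts d K" by auto
  then show ?case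
  proof cases
    case 1
    with Seq.prems(2) show ?thesis by (auto elim: follows.cases simp: conts_self)
  next
    case 2
    from Seq.IH(1)[OF 2 Seq.prems(2)] show ?thesis by (auto simp: conts_self)
  next
    case 3
    from Seq.IH(2)[OF 3 Seq.prems(2)] show ?thesis by auto
  qed
next
  case (If t c d)
  then consider "L = If t c d # K" | "L \<in> conts c K" | "L \<in> conts d K" by auto
  then show ?case
  proof cases
    case 1
    with If.prems(2) show ?thesis by (auto elim: follows.cases simp: conts_self)
  next
    case 2
    from If.IH(1)[OF 2 If.prems(2)] show ?thesis by auto
  next
    case 3
    from If.IH(2)[OF 3 If.prems(2)] show ?thesis by auto
  qed
next
  case (While t c)
  then consider "L = While t c # K" | "L \<in> conts c (While t c # K)" by auto
  then show ?case
  proof cases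
    case 1
    with While.prems(2) show ?thesis by (auto elim: follows.cases simp: conts_self)
  next
    case 2
    from While.IH[OF 2 While.prems(2)] show ?thesis by auto
  qed
qed (auto elim: follows.cases)

definition cont_set :: "com \<Rightarrow> com list set" where
  "cont_set p = insert [] (conts p [])"

lemma follows_cont_set: "L \<in> cont_set p \<Longrightarrow> follows L L' \<Longrightarrow> L' \<in> cont_set p"
  using follows_conts[of L p "[]" L'] unfolding cont_set_def by (auto elim: follows.cases)

lemma continue_follows: "continue q L = L \<or> follows L (continue q L)"
  by (cases "(q, L)" rule: continue.cases) (auto intro: follows.intros)

lemma continue_cont_set: "L \<in> cont_set p \<Longrightarrow> continue q L \<in> cont_set p"
  using continue_follows[of q L] follows_cont_set by metis

definition ctrl_set :: "com \<Rightarrow> ctrl set" where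
  "ctrl_set p = {Start, Seek_end, Incr, Incr_ret} \<union>
     (\<lambda>(m, L). Home m L) ` (UNIV \<times> cont_set p) \<union>
     (\<lambda>(m, L). Ret m L) ` (UNIV \<times> cont_set p) \<union>
     (\<lambda>(m, q, L). Pass m q L) ` (UNIV \<times> UNIV \<times> cont_set p)"

definition tsym_set :: "tsym set" where
  "tsym_set = {Blank, LMark} \<union> (\<lambda>(f, bs). Col f bs) ` (UNIV \<times> {bs. set bs \<subseteq> UNIV \<and> length bs = numregs})"

lemma in_ctrl_set [simp]:
  "Home m L \<in> ctrl_set p \<longleftrightarrow> L \<in> cont_set p"
  "Ret m L \<in> ctrl_set p \<longleftrightarrow> L \<in> cont_set p"
  "Pass m q L \<in> ctrl_set p \<longleftrightarrow> L \<in> cont_set p"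
  "Start \<in> ctrl_set p" "Seek_end \<in> ctrl_set p" "Incr \<in> ctrl_set p" "Incr_ret \<in> ctrl_set p"
  by (auto simp: ctrl_set_def image_iff)

lemma in_tsym_set [simp]:
  "Blank \<in> tsym_set" "LMark \<in> tsym_set" "Col f bs \<in> tsym_set \<longleftrightarrow> length bs = numregs"
  by (auto simp: tsym_set_def)

lemma column_length: "(q', f', bs') \<in> column a q f bs \<Longrightarrow> length bs' = length bs"
  by (cases a) auto

lemma exec_cont_set:
  assumes "(q', d, g', d') \<in> exec m L a g" "L \<in> cont_set p"
  shows "q' \<in> ctrl_set p \<and> g' = g"
proof -
  have *: "follows L L' \<Longrightarrow> L' \<in> cont_set p" for L' using assms(2) follows_cont_set by blast
  show ?thesis using assms
    by (cases "(m, L, a, g)" rule: exec.cases) (auto intro: * follows.intros split: if_splits)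
qed

lemma delta_closed:
  assumes "q \<in> ctrl_set p" "g \<in> tsym_set" "(q', d, g', d') \<in> full_delta p q a g"
  shows "q' \<in> ctrl_set p \<and> g' \<in> tsym_set"
proof (cases q)
  case (Home m L)
  with assms exec_cont_set[of q' d g' d' m L a g p] show ?thesis by auto
next
  case (Pass m b L)
  with assms show ?thesis by (cases g) (auto simp: continue_cont_set dest: column_length)
next
  case (Ret m L)
  with assms show ?thesis by (cases g) auto
next
  case Seek_end
  with assms show ?thesis by (auto simp: cont_set_def conts_self split: if_splits)
next
  case Incr
  with assms show ?thesis by (cases g) (auto split: if_splits)
next
  case Incr_ret
  with assms show ?thesis by (cases g) auto
qed (use assms in auto)

lemma exec_kind: "exec m L a g \<noteq> {} \<Longrightarrow> ckd (Home m L) = (if m then Existential else Universal)"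
  by (cases "(m, L, a, g)" rule: exec.cases) auto

lemma finite_one_tape_machine: "finite_one_tape (full_delta p) ckd Start Blank (ctrl_set p) tsym_set"
proof
  show "finite (ctrl_set p)" by (auto simp: ctrl_set_def cont_set_def finite_conts)
  show "finite tsym_set"
    using finite_lists_length_eq[of "UNIV :: bool set" numregs] by (auto simp: tsym_set_def)
  show "q' \<in> ctrl_set p \<and> g' \<in> tsym_set"
    if "q \<in> ctrl_set p" "g \<in> tsym_set" "(q', d, g', d') \<in> full_delta p q a g" for q g q' d g' d' a
    using delta_closed that by blast
  show "ckd q \<in> {Existential, Universal}" if "full_delta p q a g \<noteq> {}" for q a g
    using that exec_kind[of _ _ a g] by (cases q) auto
qed auto


subsection \<open>Acceptance\<close>

definition quant :: "bool \<Rightarrow> 'c set \<Rightarrow> ('c \<Rightarrow> bool) \<Rightarrow> bool" where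
  "quant m X P = (if m then \<exists>c\<in>X. P c else \<forall>c\<in>X. P c)"

lemma quant_simps [simp]:
  "quant m {c} P = P c"
  "quant m ((\<lambda>c. f c) ` X) P = quant m X (\<lambda>c. P (f c))"
  by (auto simp: quant_def)

text \<open>Consecutive choices in one mode merge into a single quantifier. A pass never changes its
  mode, so a guess of many bits counts as one choice of a number.\<close>

lemma quant_UN: "quant m (\<Union>c\<in>X. Y c) P = quant m X (\<lambda>c. quant m (Y c) P)"
  by (auto simp: quant_def)

definition tp :: "tsym list \<Rightarrow> nat \<Rightarrow> tsym" where
  "tp l = (\<lambda>i. if i < length l then l ! i else Blank)"

lemma tp_simps [simp]:
  "tp (ys @ g # zs) (length ys) = g"
  "tp ys (length ys) = Blank"
  "(tp (ys @ g # zs))(length ys := g') = tp (ys @ g' # zs)"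
  "(tp ys)(length ys := g') = tp (ys @ [g'])"
  "(tp ys)(length ys := Blank) = tp ys"
  by (auto simp: tp_def fun_eq_iff nth_append nth_Cons split: nat.splits)

lemma tp_LMark [simp]:
  "tp (LMark # l) 0 = LMark" "(tp (LMark # l))(0 := LMark) = tp (LMark # l)"
  by (auto simp: tp_def)

fun runs :: "opn \<Rightarrow> bool \<Rightarrow> tsym list \<Rightarrow> (bool \<times> tsym list) set" where
  "runs a q [] = {(q, [])}"
| "runs a q (Col f bs # cs) =
     (\<Union>(q', f', bs')\<in>column a q f bs. (\<lambda>(q'', zs). (q'', Col f' bs' # zs)) ` runs a q' cs)"
| "runs a q (_ # cs) = {}"

primrec is_col :: "tsym \<Rightarrow> bool" where
  "is_col Blank = False" | "is_col LMark = False" | "is_col (Col f bs) = True"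

lemma runs_length: "(q', zs) \<in> runs a q cs \<Longrightarrow> length zs = length cs \<and> list_all is_col zs"
  by (induction a q cs arbitrary: q' zs rule: runs.induct) auto

lemma tape_at:
  assumes "list_all is_col cs" "h < length cs"
  obtains f bs where "tp (LMark # cs) (Suc h) = Col f bs" "(tp (LMark # cs))(Suc h := Col f bs) = tp (LMark # cs)"
proof -
  have "is_col (cs ! h)" using assms by (simp add: list_all_length)
  then obtain f bs where "cs ! h = Col f bs" by (cases "cs ! h") auto
  with assms(2) show ?thesis by (intro that[of f bs]) (auto simp: tp_def fun_eq_iff)
qed

context
  fixes p :: com and x :: "sym list"
begin

abbreviation acc :: "ctrl \<Rightarrow> nat \<Rightarrow> (nat \<Rightarrow> tsym) \<Rightarrow> nat \<Rightarrow> bool" where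
  "acc q i t h \<equiv> accepts (machine p) x (q, i, [(t, h)])"

lemma acc_quant:
  assumes "ckd q = (if m then Existential else Universal)"
  shows "acc q i t h = quant m (full_delta p q (scan x i) (t h))
    (\<lambda>(q', d, g', d'). acc q' (min (shift d i) (length x + 1)) (t(h := g')) (shift d' h))"
proof -
  have "acc q i t h \<longleftrightarrow> (if m then \<exists>c'. step (machine p) x (q, i, [(t, h)]) c' \<and> accepts (machine p) x c'
      else \<forall>c'. step (machine p) x (q, i, [(t, h)]) c' \<longrightarrow> accepts (machine p) x c')"
    using assms by (subst accepts_iff) auto
  also have "\<dots> = quant m (full_delta p q (scan x i) (t h))
    (\<lambda>(q', d, g', d'). acc q' (min (shift d i) (length x + 1)) (t(h := g')) (shift d' h))"
    unfolding step_one_tape quant_def by (cases m) (simp_all add: case_prod_unfold, blast+)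
  finally show ?thesis .
qed

lemma acc_det:
  assumes "full_delta p q (scan x i) (t h) = {(q', d, g', d')}" "ckd q = Existential \<or> ckd q = Universal"
  shows "acc q i t h = acc q' (min (shift d i) (length x + 1)) (t(h := g')) (shift d' h)"
proof -
  have "ckd q = (if ckd q = Existential then Existential else Universal)" using assms(2) by auto
  from acc_quant[OF this] show ?thesis by (simp add: assms(1))
qed

text \<open>\<open>ys\<close> are the columns already rewritten by this pass, \<open>cs\<close>
  those still ahead.\<close>

lemma acc_pass:
  assumes "list_all is_col cs" "h \<le> length x + 1"
  shows "acc (Pass m q L) h (tp (LMark # ys @ cs)) (Suc (length ys)) =
    quant m (runs (opn_of L) q cs)
      (\<lambda>(q', zs). acc (Ret m (continue q' L)) h (tp (LMark # ys @ zs)) (length (ys @ zs)))"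
  using assms
proof (induction cs arbitrary: q ys)
  case Nil
  have e: "tp (LMark # ys) (Suc (length ys)) = Blank" "(tp (LMark # ys))(Suc (length ys) := Blank) = tp (LMark # ys)"
    using tp_simps(2,5)[of "LMark # ys"] by simp_all
  then show ?case using Nil by (subst acc_det) (auto simp: e)
next
  case (Cons c cs)
  then obtain f bs where c: "c = Col f bs" by (cases c) auto
  have e: "tp (LMark # ys @ Col f bs # cs) (Suc (length ys)) = Col f bs"
    "(tp (LMark # ys @ Col f bs # cs))(Suc (length ys) := g) = tp (LMark # (ys @ [g]) @ cs)" for g
    using tp_simps(1)[of "LMark # ys" _ cs] tp_simps(3)[of "LMark # ys" _ cs] by simp_all
  have "acc (Pass m q L) h (tp (LMark # ys @ c # cs)) (Suc (length ys)) =
    quant m (column (opn_of L) q f bs) (\<lambda>(q', f', bs').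
      acc (Pass m q' L) h (tp (LMark # (ys @ [Col f' bs']) @ cs)) (Suc (length (ys @ [Col f' bs']))))"
    using Cons.prems unfolding c
    by (subst acc_quant[where m = m]) (auto simp: e min_absorb1 case_prod_unfold)
  also have "\<dots> = quant m (column (opn_of L) q f bs) (\<lambda>(q', f', bs').
      quant m (runs (opn_of L) q' cs)
        (\<lambda>(q'', zs). acc (Ret m (continue q'' L)) h (tp (LMark # (ys @ [Col f' bs']) @ zs))
           (length ((ys @ [Col f' bs']) @ zs))))"
    using Cons by (subst Cons.IH) auto
  also have "\<dots> = quant m (runs (opn_of L) q (c # cs))
      (\<lambda>(q', zs). acc (Ret m (continue q' L)) h (tp (LMark # ys @ zs)) (length (ys @ zs)))"
    by (simp add: c quant_UN case_prod_unfold)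
  finally show ?case .
qed

lemma acc_ret:
  assumes "list_all is_col cs" "h \<le> length x + 1" "j \<le> length cs"
  shows "acc (Ret m L) h (tp (LMark # cs)) j = acc (Home m L) h (tp (LMark # cs)) 0"
  using assms(3)
proof (induction j)
  case 0
  then show ?case using assms by (subst acc_det) (auto simp: min_absorb1)
next
  case (Suc j)
  then obtain f bs where e: "tp (LMark # cs) (Suc j) = Col f bs" "(tp (LMark # cs))(Suc j := Col f bs) = tp (LMark # cs)"
    using tape_at[OF assms(1), of j] by (auto simp: Suc_le_eq)
  have "acc (Ret m L) h (tp (LMark # cs)) (Suc j) = acc (Ret m L) h (tp (LMark # cs)) j"
    using assms by (subst acc_det) (auto simp: e min_absorb1)
  with Suc show ?case by simp
qed

text \<open>The pass upwards contributes one quantifier over all its outcomes, and the way back is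
  deterministic. From here on an operation is an atomic step on the columns.\<close>

lemma acc_opn:
  assumes "list_all is_col cs" "h \<le> length x + 1"
    "\<And>a g. exec m L a g = {(Pass m (carry_in (opn_of L)) L, MStay, g, MRight)}"
  shows "acc (Home m L) h (tp (LMark # cs)) 0 =
    quant m (runs (opn_of L) (carry_in (opn_of L)) cs)
      (\<lambda>(q', zs). acc (Home m (continue q' L)) h (tp (LMark # zs)) 0)"
proof -
  have "ckd (Home m L) = (if m then Existential else Universal)"
    using exec_kind[of m L] assms(3) by simp
  then have "acc (Home m L) h (tp (LMark # cs)) 0 =
      acc (Pass m (carry_in (opn_of L)) L) h (tp (LMark # [] @ cs)) (Suc (length ([] :: tsym list)))"
    using assms(1,2) by (subst acc_det) (auto simp: assms(3) min_absorb1)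
  also have "\<dots> = quant m (runs (opn_of L) (carry_in (opn_of L)) cs)
      (\<lambda>(q', zs). acc (Ret m (continue q' L)) h (tp (LMark # [] @ zs)) (length ([] @ zs)))"
    by (rule acc_pass[OF assms(1,2)])
  also have "\<dots> = quant m (runs (opn_of L) (carry_in (opn_of L)) cs)
      (\<lambda>(q', zs). acc (Home m (continue q' L)) h (tp (LMark # zs)) 0)"
    unfolding quant_def
    using acc_ret[OF _ assms(2)] runs_length[of _ _ "opn_of L" "carry_in (opn_of L)" cs]
    by (auto split: prod.splits) blast+
  finally show ?thesis .
qed

end

subsection \<open>Registers\<close>

definition bits :: "(nat \<Rightarrow> nat) \<Rightarrow> bool list" where
  "bits \<rho> = map (\<lambda>r. odd (\<rho> r)) [0..<numregs]"

definition half :: "(nat \<Rightarrow> nat) \<Rightarrow> nat \<Rightarrow> nat" where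
  "half \<rho> = (\<lambda>r. \<rho> r div 2)"

lemma half_simps [simp]: "half \<rho> r = \<rho> r div 2" "half (\<rho>(r := v)) = (half \<rho>)(r := v div 2)"
  "(\<lambda>r. \<rho> r div 2) = half \<rho>"
  by (auto simp: half_def)

text \<open>Bits beyond the last column are dropped, so a register stands for its value modulo
  \<open>2 ^ length fs\<close>. Operations that write therefore ask for no upper bound on the
  registers; only tests do.\<close>

primrec cols :: "bool list \<Rightarrow> (nat \<Rightarrow> nat) \<Rightarrow> tsym list" where
  "cols [] \<rho> = []"
| "cols (f # fs) \<rho> = Col f (bits \<rho>) # cols fs (half \<rho>)"

lemma length_bits [simp]: "length (bits \<rho>) = numregs"
  by (simp add: bits_def)

lemma bits_nth [simp]: "r < numregs \<Longrightarrow> bits \<rho> ! r = odd (\<rho> r)"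
  by (simp add: bits_def)

lemma bits_upd: "r < numregs \<Longrightarrow> (bits \<rho>)[r := b] = bits (\<rho>(r := v))" if "odd v = b" for b
  using that by (intro nth_equalityI) (auto simp: nth_list_update)

lemma cols_simps [simp]: "length (cols fs \<rho>) = length fs" "list_all is_col (cols fs \<rho>)"
  by (induction fs arbitrary: \<rho>) auto

lemma runs_Zero: "r < numregs \<Longrightarrow> runs (Zero_op r) q (cols fs \<rho>) = {(q, cols fs (\<rho>(r := 0)))}"
  by (induction fs arbitrary: \<rho>) (auto simp: bits_upd[where v = 0])

text \<open>The carry has to be a variable for the induction, since the pass continues without an
  increment once the carry is absorbed. The final overflow is dropped, in agreement with the
  truncation in \<open>cols\<close>.\<close>

lemma runs_Inc:
  "r < numregs \<Longrightarrow> \<exists>q'. runs (Inc r) q (cols fs \<rho>) = {(q', cols fs (\<rho>(r := \<rho> r + of_bool q)))}"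
proof (induction fs arbitrary: \<rho> q)
  case (Cons f fs)
  have e: "(\<rho> r + of_bool q) div 2 = \<rho> r div 2 + of_bool (q \<and> odd (\<rho> r))"
    by (cases q; cases "even (\<rho> r)") (auto elim!: evenE oddE)
  have b: "(bits \<rho>)[r := (bits \<rho> ! r \<noteq> q)] = bits (\<rho>(r := \<rho> r + of_bool q))"
    using Cons.prems by (intro bits_upd) (cases q, auto)
  obtain q' where "runs (Inc r) (q \<and> odd (\<rho> r)) (cols fs (half \<rho>)) =
      {(q', cols fs ((half \<rho>)(r := half \<rho> r + of_bool (q \<and> odd (\<rho> r)))))}"
    using Cons.IH[OF Cons.prems] by blast
  then have "runs (Inc r) q (cols (f # fs) \<rho>) = {(q', cols (f # fs) (\<rho>(r := \<rho> r + of_bool q)))}"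
    using Cons.prems by (simp only: cols.simps runs.simps column.simps bits_nth b[symmetric] half_simps e)
      (simp add: b[simplified] del: fun_upd_apply)
  then show ?case ..
qed simp

lemma runs_Dec:
  "r < numregs \<Longrightarrow> of_bool q \<le> \<rho> r \<Longrightarrow>
    \<exists>q'. runs (Dec r) q (cols fs \<rho>) = {(q', cols fs (\<rho>(r := \<rho> r - of_bool q)))}"
proof (induction fs arbitrary: \<rho> q)
  case (Cons f fs)
  have e: "(\<rho> r - of_bool q) div 2 = \<rho> r div 2 - of_bool (q \<and> even (\<rho> r))"
    using Cons.prems by (cases q; cases "even (\<rho> r)") (auto elim!: evenE oddE)
  have b: "(bits \<rho>)[r := (bits \<rho> ! r \<noteq> q)] = bits (\<rho>(r := \<rho> r - of_bool q))"
    using Cons.prems by (intro bits_upd) (cases q, auto)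
  have "of_bool (q \<and> even (\<rho> r)) \<le> half \<rho> r" using Cons.prems by (auto simp: of_bool_def)
  then obtain q' where "runs (Dec r) (q \<and> even (\<rho> r)) (cols fs (half \<rho>)) =
      {(q', cols fs ((half \<rho>)(r := half \<rho> r - of_bool (q \<and> even (\<rho> r)))))}"
    using Cons.IH[OF Cons.prems(1)] by blast
  then have "runs (Dec r) q (cols (f # fs) \<rho>) = {(q', cols (f # fs) (\<rho>(r := \<rho> r - of_bool q)))}"
    using Cons.prems by (simp only: cols.simps runs.simps column.simps bits_nth b[symmetric] half_simps e)
      (simp add: b[simplified] del: fun_upd_apply)
  then show ?case ..
qed simp

lemma runs_Copy:
  "r < numregs \<Longrightarrow> s < numregs \<Longrightarrow> runs (Copy r s) q (cols fs \<rho>) = {(q, cols fs (\<rho>(r := \<rho> s)))}"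
  by (induction fs arbitrary: \<rho>) (auto simp: bits_upd[where v = "\<rho> s" for \<rho> :: "nat \<Rightarrow> nat"])

lemma runs_Guess:
  "r < numregs \<Longrightarrow> runs (Guess r) q (cols fs \<rho>) = (\<lambda>v. (q, cols fs (\<rho>(r := v)))) ` {..<2 ^ length fs}"
proof (induction fs arbitrary: \<rho>)
  case (Cons f fs)
  let ?\<rho> = "half \<rho>"
  have "runs (Guess r) q (cols (f # fs) \<rho>) =
      (\<Union>b. (\<lambda>v. (q, Col f ((bits \<rho>)[r := b]) # cols fs (?\<rho>(r := v)))) ` {..<2 ^ length fs})"
    using Cons by (simp add: UNIV_bool image_image Un_commute del: fun_upd_apply)
  also have "\<dots> = (\<lambda>v. (q, cols (f # fs) (\<rho>(r := v)))) ` {..<2 ^ length (f # fs)}" (is "?L = ?R")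
  proof (intro set_eqI iffI)
    fix z assume "z \<in> ?L"
    then obtain b v where v: "v < 2 ^ length fs" "z = (q, Col f ((bits \<rho>)[r := b]) # cols fs (?\<rho>(r := v)))"
      by auto
    have "(bits \<rho>)[r := b] = bits (\<rho>(r := 2 * v + of_bool b))"
      using Cons.prems by (intro bits_upd) auto
    then have "z = (q, cols (f # fs) (\<rho>(r := 2 * v + of_bool b)))" using v by simp
    moreover have "2 * v + of_bool b < 2 ^ length (f # fs)" using v(1) by (cases b) auto
    ultimately show "z \<in> ?R" by blast
  next
    fix z assume "z \<in> ?R"
    then obtain v where v: "v < 2 ^ length (f # fs)" "z = (q, cols (f # fs) (\<rho>(r := v)))" by auto
    have "(bits \<rho>)[r := odd v] = bits (\<rho>(r := v))" using Cons.prems by (intro bits_upd) auto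
    then have "z = (q, Col f ((bits \<rho>)[r := odd v]) # cols fs (?\<rho>(r := v div 2)))"
      using v by simp
    moreover have "v div 2 < 2 ^ length fs" using v(1) by auto
    ultimately show "z \<in> ?L" by blast
  qed
  finally show ?case .
qed auto

lemma runs_NZ:
  "r < numregs \<Longrightarrow> \<rho> r < 2 ^ length fs \<Longrightarrow> runs (NZ r) q (cols fs \<rho>) = {(q \<or> \<rho> r \<noteq> 0, cols fs \<rho>)}"
proof (induction fs arbitrary: \<rho> q)
  case (Cons f fs)
  have "half \<rho> r < 2 ^ length fs" using Cons.prems by auto
  with Cons.IH[of "half \<rho>" "q \<or> odd (\<rho> r)"] Cons.prems(1)
  have "runs (NZ r) (q \<or> odd (\<rho> r)) (cols fs (half \<rho>)) = {((q \<or> odd (\<rho> r)) \<or> half \<rho> r \<noteq> 0, cols fs (half \<rho>))}"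
    by (simp only:)
  moreover have "(odd a \<or> a div 2 \<noteq> 0) = (a \<noteq> 0)" for a :: nat by presburger
  then have "((q \<or> odd (\<rho> r)) \<or> half \<rho> r \<noteq> 0) = (q \<or> \<rho> r \<noteq> 0)"
    by (simp only: half_simps disj_assoc)
  ultimately show ?case using Cons.prems(1) by (simp only: cols.simps runs.simps column.simps bits_nth) simp
qed simp

lemma runs_Eq:
  "r < numregs \<Longrightarrow> s < numregs \<Longrightarrow> \<rho> r < 2 ^ length fs \<Longrightarrow> \<rho> s < 2 ^ length fs \<Longrightarrow>
    runs (Eq r s) q (cols fs \<rho>) = {(q \<and> \<rho> r = \<rho> s, cols fs \<rho>)}"
proof (induction fs arbitrary: \<rho> q)
  case (Cons f fs)
  have "\<rho> r div 2 < 2 ^ length fs" "\<rho> s div 2 < 2 ^ length fs" using Cons.prems by auto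
  moreover have "(odd (\<rho> r) = odd (\<rho> s) \<and> \<rho> r div 2 = \<rho> s div 2) = (\<rho> r = \<rho> s)" by presburger
  ultimately show ?case using Cons.IH[of "half \<rho>" "q \<and> odd (\<rho> r) = odd (\<rho> s)"] Cons.prems
    by (simp add: conj_assoc)
qed auto

text \<open>The disjunct with \<open>q\<close> is the verdict of the bits already passed, which
  counts only when all higher bits agree.\<close>

lemma runs_Less:
  "r < numregs \<Longrightarrow> s < numregs \<Longrightarrow> \<rho> r < 2 ^ length fs \<Longrightarrow> \<rho> s < 2 ^ length fs \<Longrightarrow>
    runs (Less r s) q (cols fs \<rho>) = {(\<rho> r < \<rho> s \<or> q \<and> \<rho> r = \<rho> s, cols fs \<rho>)}"
proof (induction fs arbitrary: \<rho> q)
  case (Cons f fs)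
  let ?q = "if odd (\<rho> r) = odd (\<rho> s) then q else odd (\<rho> s)"
  have "\<rho> r div 2 < 2 ^ length fs" "\<rho> s div 2 < 2 ^ length fs" using Cons.prems by auto
  moreover have "(\<rho> r div 2 < \<rho> s div 2 \<or> ?q \<and> \<rho> r div 2 = \<rho> s div 2) = (\<rho> r < \<rho> s \<or> q \<and> \<rho> r = \<rho> s)"
    by (cases q; simp; presburger)
  ultimately show ?case using Cons.IH[of "half \<rho>" ?q] Cons.prems
    by (cases "odd (\<rho> r) = odd (\<rho> s)") simp_all
qed auto

text \<open>\<open>Pop\<close> takes the lowest token, so the remaining ones always occupy the
  highest columns, and their number \<open>i\<close> describes the fuel completely.\<close>

definition fuel :: "nat \<Rightarrow> nat \<Rightarrow> bool list" where
  "fuel W i = replicate (W - i) False @ replicate i True"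

lemma length_fuel [simp]: "i \<le> W \<Longrightarrow> length (fuel W i) = W"
  by (simp add: fuel_def)

lemma runs_Pop_True: "runs Pop True (cols fs \<rho>) = {(True, cols fs \<rho>)}"
  by (induction fs arbitrary: \<rho>) auto

lemma runs_Pop_Suc:
  assumes "Suc i \<le> W"
  shows "runs Pop False (cols (fuel W (Suc i)) \<rho>) = {(True, cols (fuel W i) \<rho>)}"
proof -
  have "runs Pop False (cols (replicate k False @ True # fs) \<rho>) = {(True, cols (replicate k False @ False # fs) \<rho>)}"
    for k fs
    by (induction k arbitrary: \<rho>) (auto simp: runs_Pop_True)
  from this[of "W - Suc i" "replicate i True"] show ?thesis
    using assms by (simp add: fuel_def Suc_diff_Suc[symmetric] replicate_app_Cons_same)
qed

lemma runs_Pop_0: "runs Pop False (cols (fuel W 0) \<rho>) = {(False, cols (fuel W 0) \<rho>)}"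
proof -
  have "runs Pop False (cols (replicate k False) \<rho>) = {(False, cols (replicate k False) \<rho>)}" for k
    by (induction k arbitrary: \<rho>) auto
  then show ?thesis by (simp add: fuel_def)
qed

subsection \<open>Rules for programs\<close>

text \<open>The bound says that every position of the input head, the right end marker included,
  fits into a register of \<open>W\<close> bits.\<close>

locale program_run =
  fixes p :: com and x :: "sym list" and W :: nat
  assumes W: "length x + 1 < 2 ^ W"
begin

definition A :: "bool \<Rightarrow> com list \<Rightarrow> nat \<Rightarrow> nat \<Rightarrow> (nat \<Rightarrow> nat) \<Rightarrow> bool" where
  "A m L h i \<rho> = acc p x (Home m L) h (tp (LMark # cols (fuel W i) \<rho>)) 0"

lemma A_Skip: "h \<le> length x + 1 \<Longrightarrow> A m (Skip # K) h i \<rho> = A m K h i \<rho>"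
  unfolding A_def by (subst acc_det) (auto simp: min_absorb1)

lemma A_Seq: "h \<le> length x + 1 \<Longrightarrow> A m ((c ;; d) # K) h i \<rho> = A m (c # d # K) h i \<rho>"
  unfolding A_def by (subst acc_det) (auto simp: min_absorb1)

lemma A_Switch: "h \<le> length x + 1 \<Longrightarrow> A m (Switch m' # K) h i \<rho> = A m' K h i \<rho>"
  unfolding A_def by (subst acc_det) (auto simp: min_absorb1)

lemma A_Head_left: "h \<le> length x + 1 \<Longrightarrow> A m (Head_left # K) h i \<rho> = A m K (h - 1) i \<rho>"
  unfolding A_def by (subst acc_det) (auto simp: min_absorb1)

lemma A_Head_right: "A m (Head_right # K) h i \<rho> = A m K (min (h + 1) (length x + 1)) i \<rho>"
  unfolding A_def by (subst acc_det) auto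

lemma A_Succeed: "A m (Succeed # K) h i \<rho>"
  unfolding A_def by (subst accepts_iff) auto

lemma A_Fail: "\<not> A m (Fail # K) h i \<rho>"
  unfolding A_def by (subst accepts_iff) auto

lemma A_If_scan:
  "h \<le> length x + 1 \<Longrightarrow>
    A m (If (TScan cs) c d # K) h i \<rho> = A m ((if scan x h \<in> set cs then c else d) # K) h i \<rho>"
  unfolding A_def by (subst acc_det) (auto simp: min_absorb1)

lemma A_While_scan:
  "h \<le> length x + 1 \<Longrightarrow>
    A m (While (TScan cs) c # K) h i \<rho> = A m (if scan x h \<in> set cs then c # While (TScan cs) c # K else K) h i \<rho>"
  unfolding A_def by (subst acc_det) (auto simp: min_absorb1)

lemma A_opn:
  assumes "runs (opn_of L) (carry_in (opn_of L)) (cols (fuel W i) \<rho>) = {(q, cols (fuel W i') \<rho>')}"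
    "h \<le> length x + 1" "\<And>a g. exec m L a g = {(Pass m (carry_in (opn_of L)) L, MStay, g, MRight)}"
  shows "A m L h i \<rho> = A m (continue q L) h i' \<rho>'"
  unfolding A_def by (subst acc_opn) (use assms in auto)

definition holds :: "opn \<Rightarrow> (nat \<Rightarrow> nat) \<Rightarrow> bool" where
  "holds a \<rho> = (case a of NZ r \<Rightarrow> \<rho> r \<noteq> 0 | Eq r s \<Rightarrow> \<rho> r = \<rho> s | Less r s \<Rightarrow> \<rho> r < \<rho> s | _ \<Rightarrow> False)"

definition testable :: "opn \<Rightarrow> (nat \<Rightarrow> nat) \<Rightarrow> bool" where
  "testable a \<rho> = (case a of
     NZ r \<Rightarrow> r < numregs \<and> \<rho> r < 2 ^ W
   | Eq r s \<Rightarrow> r < numregs \<and> s < numregs \<and> \<rho> r < 2 ^ W \<and> \<rho> s < 2 ^ W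
   | Less r s \<Rightarrow> r < numregs \<and> s < numregs \<and> \<rho> r < 2 ^ W \<and> \<rho> s < 2 ^ W
   | _ \<Rightarrow> False)"

context
  fixes h i :: nat
  assumes hi: "h \<le> length x + 1" "i \<le> W"
begin

lemma A_Zero: "r < numregs \<Longrightarrow> A m (Do (Zero_op r) # K) h i \<rho> = A m K h i (\<rho>(r := 0))"
  using A_opn[of "Do (Zero_op r) # K" i \<rho> False i "\<rho>(r := 0)" h m] hi
  by (simp add: runs_Zero del: fun_upd_apply)

lemma A_Inc: "r < numregs \<Longrightarrow> A m (Do (Inc r) # K) h i \<rho> = A m K h i (\<rho>(r := \<rho> r + 1))"
proof -
  assume "r < numregs"
  from runs_Inc[OF this, of True "fuel W i" \<rho>]
  obtain q where "runs (Inc r) True (cols (fuel W i) \<rho>) = {(q, cols (fuel W i) (\<rho>(r := \<rho> r + 1)))}"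
    by (simp del: fun_upd_apply) blast
  then show ?thesis
    using A_opn[of "Do (Inc r) # K" i \<rho> q i "\<rho>(r := \<rho> r + 1)" h m] hi by (simp del: fun_upd_apply)
qed

lemma A_Dec: "r < numregs \<Longrightarrow> 0 < \<rho> r \<Longrightarrow> A m (Do (Dec r) # K) h i \<rho> = A m K h i (\<rho>(r := \<rho> r - 1))"
proof -
  assume "r < numregs" "0 < \<rho> r"
  with runs_Dec[of r True \<rho> "fuel W i"]
  obtain q where "runs (Dec r) True (cols (fuel W i) \<rho>) = {(q, cols (fuel W i) (\<rho>(r := \<rho> r - 1)))}"
    by (simp add: Suc_le_eq del: fun_upd_apply) blast
  then show ?thesis
    using A_opn[of "Do (Dec r) # K" i \<rho> q i "\<rho>(r := \<rho> r - 1)" h m] hi by (simp del: fun_upd_apply)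
qed

lemma A_Copy: "r < numregs \<Longrightarrow> s < numregs \<Longrightarrow> A m (Do (Copy r s) # K) h i \<rho> = A m K h i (\<rho>(r := \<rho> s))"
  using A_opn[of "Do (Copy r s) # K" i \<rho> False i "\<rho>(r := \<rho> s)" h m] hi
  by (simp add: runs_Copy del: fun_upd_apply)

lemma A_Guess:
  "r < numregs \<Longrightarrow> A m (Do (Guess r) # K) h i \<rho> = quant m {..<2 ^ W} (\<lambda>v. A m K h i (\<rho>(r := v)))"
  using acc_opn[of "cols (fuel W i) \<rho>" h x m "Do (Guess r) # K" p] hi unfolding A_def
  by (simp add: runs_Guess del: fun_upd_apply)

lemma runs_test:
  "testable a \<rho> \<Longrightarrow> runs a (carry_in a) (cols (fuel W i) \<rho>) = {(holds a \<rho>, cols (fuel W i) \<rho>)}"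
  using hi by (cases a) (auto simp: testable_def holds_def runs_NZ runs_Eq runs_Less)

lemma A_If: "testable a \<rho> \<Longrightarrow> A m (If (TOp a) c d # K) h i \<rho> = A m ((if holds a \<rho> then c else d) # K) h i \<rho>"
  using A_opn[of "If (TOp a) c d # K" i \<rho> "holds a \<rho>" i \<rho> h m] hi by (simp add: runs_test)

lemma A_While:
  "testable a \<rho> \<Longrightarrow>
    A m (While (TOp a) c # K) h i \<rho> = A m (if holds a \<rho> then c # While (TOp a) c # K else K) h i \<rho>"
  using A_opn[of "While (TOp a) c # K" i \<rho> "holds a \<rho>" i \<rho> h m] hi by (simp add: runs_test)

end

lemma A_While_Pop_Suc:
  "h \<le> length x + 1 \<Longrightarrow> Suc i \<le> W \<Longrightarrow>
    A m (While (TOp Pop) c # K) h (Suc i) \<rho> = A m (c # While (TOp Pop) c # K) h i \<rho>"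
  using A_opn[of "While (TOp Pop) c # K" "Suc i" \<rho> True i \<rho> h m] by (simp add: runs_Pop_Suc)

lemma A_While_Pop_0:
  "h \<le> length x + 1 \<Longrightarrow> A m (While (TOp Pop) c # K) h 0 \<rho> = A m K h 0 \<rho>"
  using A_opn[of "While (TOp Pop) c # K" 0 \<rho> False 0 \<rho> h m] by (simp add: runs_Pop_0)

end

subsection \<open>Measuring the input\<close>

text \<open>The number of binary digits of \<open>c\<close>, in the recursion of a counter: a digit
  is added when the increment overflows.\<close>

primrec width :: "nat \<Rightarrow> nat" where
  "width 0 = 0"
| "width (Suc c) = (if Suc c < 2 ^ width c then width c else Suc (width c))"

lemma less_width: "c < 2 ^ width c"
  by (induction c) auto

lemma width_le: "0 < width c \<Longrightarrow> 2 ^ (width c - 1) \<le> c"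
  by (induction c) (auto split: if_splits)

lemma width_mono: "c \<le> c' \<Longrightarrow> width c \<le> width c'"
  by (induction c' rule: dec_induct) auto

definition counter :: "nat \<Rightarrow> tsym list" where
  "counter c = cols (replicate (width c) True) ((\<lambda>_. 0)(0 := c))"

fun incr :: "tsym list \<Rightarrow> tsym list" where
  "incr (Col f bs # cs) = (if bs ! 0 then Col f (bs[0 := False]) # incr cs else Col f (bs[0 := True]) # cs)"
| "incr cs = [Col True (True # replicate (numregs - 1) False)]"

lemma is_col_incr: "list_all is_col cs \<Longrightarrow> list_all is_col (incr cs)"
  by (induction cs rule: incr.induct) auto

lemma incr_cols:
  "c < 2 ^ k \<Longrightarrow> incr (cols (replicate k True) ((\<lambda>_. 0)(0 := c))) =
    cols (replicate (if Suc c < 2 ^ k then k else Suc k) True) ((\<lambda>_. 0)(0 := Suc c))"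
proof (induction k arbitrary: c)
  case 0
  then show ?case by (simp add: bits_def upt_rec numeral_eq_Suc)
next
  case (Suc k)
  have h: "half (\<lambda>_. 0) = (\<lambda>_. 0)" by (simp add: half_def)
  have upd: "(bits ((\<lambda>_. 0)(0 := c)))[0 := odd (Suc c)] = bits ((\<lambda>_. 0)(0 := Suc c))"
    using bits_upd[of "Suc c" "odd (Suc c)" 0 "(\<lambda>_. 0)(0 := c)"] by simp
  show ?case
  proof (cases "even c")
    case True
    then have "Suc c div 2 = c div 2" "Suc c < 2 ^ Suc k" using Suc.prems by (auto elim!: evenE)
    with True upd show ?thesis by (simp add: h fun_upd_same del: fun_upd_apply)
  next
    case False
    then have e: "Suc c div 2 = Suc (c div 2)" by (auto elim!: oddE)
    have "(Suc c < 2 ^ Suc k) = (Suc (c div 2) < 2 ^ k)" using False by (auto elim!: oddE)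
    with False e upd Suc.IH[of "c div 2"] Suc.prems show ?thesis
      by (auto simp: h fun_upd_same simp del: fun_upd_apply)
  qed
qed

lemma incr_counter: "incr (counter c) = counter (Suc c)"
  unfolding counter_def using incr_cols[OF less_width] by simp

declare width.simps(2) [simp del]

lemma counter_simps [simp]: "length (counter c) = width c" "list_all is_col (counter c)"
  by (simp_all add: counter_def)

context
  fixes p :: com and x :: "sym list"
begin

lemma acc_Incr_ret:
  assumes "list_all is_col cs" "i \<le> length x + 1" "h \<le> length cs"
  shows "acc p x Incr_ret i (tp (LMark # cs)) h = acc p x Seek_end i (tp (LMark # cs)) 0"
  using assms(3)
proof (induction h)
  case 0
  then show ?case using assms by (subst acc_det) (auto simp: min_absorb1)
next
  case (Suc h)
  then obtain f bs where e: "tp (LMark # cs) (Suc h) = Col f bs" "(tp (LMark # cs))(Suc h := Col f bs) = tp (LMark # cs)"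
    using tape_at[OF assms(1), of h] by (auto simp: Suc_le_eq)
  have "acc p x Incr_ret i (tp (LMark # cs)) (Suc h) = acc p x Incr_ret i (tp (LMark # cs)) h"
    using assms by (subst acc_det) (auto simp: e min_absorb1)
  with Suc show ?case by simp
qed

lemma acc_Incr:
  assumes "list_all is_col cs" "list_all is_col ys" "i \<le> length x + 1"
  shows "acc p x Incr i (tp (LMark # ys @ cs)) (Suc (length ys)) = acc p x Seek_end i (tp (LMark # ys @ incr cs)) 0"
  using assms(1,2)
proof (induction cs arbitrary: ys)
  case Nil
  have e: "tp (LMark # ys) (Suc (length ys)) = Blank"
    "(tp (LMark # ys))(Suc (length ys) := g) = tp (LMark # ys @ [g])" for g
    using tp_simps(2,4)[of "LMark # ys"] by simp_all
  have "acc p x Incr i (tp (LMark # ys)) (Suc (length ys)) =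
      acc p x Incr_ret i (tp (LMark # ys @ incr [])) (length ys)"
    using assms(3) by (subst acc_det) (auto simp: e min_absorb1)
  then show ?case using Nil assms(3) acc_Incr_ret[of "ys @ incr []" i "length ys"] by simp
next
  case (Cons c cs)
  then obtain f bs where c: "c = Col f bs" by (cases c) auto
  have e: "tp (LMark # ys @ Col f bs # cs) (Suc (length ys)) = Col f bs"
    "(tp (LMark # ys @ Col f bs # cs))(Suc (length ys) := g) = tp (LMark # ys @ g # cs)" for g
    using tp_simps(1)[of "LMark # ys" _ cs] tp_simps(3)[of "LMark # ys" _ cs] by simp_all
  show ?case
  proof (cases "bs ! 0")
    case True
    let ?ys = "ys @ [Col f (bs[0 := False])]"
    have "acc p x Incr i (tp (LMark # ys @ c # cs)) (Suc (length ys)) =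
        acc p x Incr i (tp (LMark # ?ys @ cs)) (Suc (length ?ys))"
      using assms(3) True by (subst acc_det) (auto simp: c e min_absorb1)
    also have "\<dots> = acc p x Seek_end i (tp (LMark # ?ys @ incr cs)) 0"
      using Cons by (intro Cons.IH) auto
    finally show ?thesis using True by (simp add: c)
  next
    case False
    have "acc p x Incr i (tp (LMark # ys @ c # cs)) (Suc (length ys)) =
        acc p x Incr_ret i (tp (LMark # ys @ incr (c # cs))) (length ys)"
      using assms(3) False by (subst acc_det) (auto simp: c e min_absorb1)
    also have "\<dots> = acc p x Seek_end i (tp (LMark # ys @ incr (c # cs))) 0"
      using Cons is_col_incr[of "c # cs"] assms(3) by (intro acc_Incr_ret) auto
    finally show ?thesis .
  qed
qed

lemma scan_RightEnd_iff: "scan x i = RightEnd \<longleftrightarrow> length x < i"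
  by (auto simp: scan_def)

text \<open>The invariant of the measuring loop: input head and counter advance together.\<close>

lemma acc_Seek_end:
  "c \<le> length x + 1 \<Longrightarrow>
    acc p x Start 0 (tp []) 0 = acc p x Seek_end c (tp (LMark # counter c)) 0"
proof (induction c)
  case 0
  have "(tp [])(0 := LMark) = tp (LMark # counter 0)" by (auto simp: tp_def counter_def fun_eq_iff)
  then show ?case by (subst acc_det) auto
next
  case (Suc c)
  have e: "scan x c \<noteq> RightEnd" using Suc.prems by (simp add: scan_RightEnd_iff)
  have "acc p x Seek_end c (tp (LMark # counter c)) 0 =
      acc p x Incr (Suc c) (tp (LMark # [] @ counter c)) (Suc (length ([] :: tsym list)))"
    using Suc.prems by (subst acc_det) (auto simp: e min_absorb1)
  also have "\<dots> = acc p x Seek_end (Suc c) (tp (LMark # [] @ incr (counter c))) 0"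
    using Suc.prems by (intro acc_Incr) auto
  finally show ?case using Suc by (simp add: incr_counter)
qed

theorem in_language_machine:
  "x \<in> language (machine p) \<longleftrightarrow>
    program_run.A p x (width (length x + 1)) True [p] (length x + 1) (width (length x + 1)) ((\<lambda>_. 0)(0 := length x + 1))"
proof -
  interpret program_run p x "width (length x + 1)"
    by unfold_locales (rule less_width)
  have "tp [] = (\<lambda>_. Blank)" by (simp add: tp_def)
  then have "x \<in> language (machine p) \<longleftrightarrow> acc p x Start 0 (tp []) 0"
    by (simp add: language_def init_def)
  also have "\<dots> = acc p x Seek_end (length x + 1) (tp (LMark # counter (length x + 1))) 0"
    by (rule acc_Seek_end) simp
  also have "\<dots> = acc p x (Home True [p]) (length x + 1) (tp (LMark # counter (length x + 1))) 0"
  proof -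
    have "scan x (length x + 1) = RightEnd" by (simp add: scan_def)
    then show ?thesis by (subst acc_det) auto
  qed
  finally show ?thesis unfolding A_def counter_def fuel_def by (simp only: diff_self_eq_0 replicate_0 append_Nil)
qed

end


subsection \<open>Alternations\<close>

text \<open>A loop counts as free of switches. This is justified under \<open>tame\<close>, which
  keeps switches out of all loops and admits no loop on tokens.\<close>

primrec switches :: "com \<Rightarrow> nat" where
  "switches Skip = 0" | "switches (c ;; d) = switches c + switches d" | "switches (Do a) = 0"
| "switches Head_left = 0" | "switches Head_right = 0" | "switches (Switch m) = 1"
| "switches Succeed = 0" | "switches Fail = 0" | "switches (If t c d) = max (switches c) (switches d)"
| "switches (While t c) = 0"

primrec tame :: "com \<Rightarrow> bool" where
  "tame Skip = True" | "tame (c ;; d) = (tame c \<and> tame d)" | "tame (Do a) = True"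
| "tame Head_left = True" | "tame Head_right = True" | "tame (Switch m) = True"
| "tame Succeed = True" | "tame Fail = True" | "tame (If t c d) = (tame c \<and> tame d)"
| "tame (While t c) = (t \<noteq> TOp Pop \<and> switches c = 0 \<and> tame c)"

text \<open>Only loops that consume fuel may switch modes, and they may not be nested.\<close>

primrec wf_com :: "com \<Rightarrow> bool" where
  "wf_com Skip = True" | "wf_com (c ;; d) = (wf_com c \<and> wf_com d)" | "wf_com (Do a) = True"
| "wf_com Head_left = True" | "wf_com Head_right = True" | "wf_com (Switch m) = True"
| "wf_com Succeed = True" | "wf_com Fail = True" | "wf_com (If t c d) = (wf_com c \<and> wf_com d)"
| "wf_com (While t c) = (tame c \<and> (t = TOp Pop \<or> switches c = 0))"

primrec cost :: "nat \<Rightarrow> com \<Rightarrow> nat" where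
  "cost n Skip = 0" | "cost n (c ;; d) = cost n c + cost n d" | "cost n (Do a) = 0"
| "cost n Head_left = 0" | "cost n Head_right = 0" | "cost n (Switch m) = 1"
| "cost n Succeed = 0" | "cost n Fail = 0" | "cost n (If t c d) = max (cost n c) (cost n d)"
| "cost n (While t c) = (if t = TOp Pop then n * switches c else 0)"

definition costs :: "nat \<Rightarrow> com list \<Rightarrow> nat" where
  "costs n L = sum_list (map (cost n) L)"

lemma costs_simps [simp]: "costs n [] = 0" "costs n (c # K) = cost n c + costs n K"
  by (simp_all add: costs_def)

lemma cost_mono: "n \<le> n' \<Longrightarrow> cost n c \<le> cost n' c"
  by (induction c) (auto simp: max_def intro: add_mono)

lemma costs_mono: "n \<le> n' \<Longrightarrow> costs n L \<le> costs n' L"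
  by (induction L) (auto intro: add_mono cost_mono)

lemma tame_cost: "tame c \<Longrightarrow> wf_com c \<and> cost n c = switches c"
  by (induction c) auto

text \<open>The bound is linear because a loop on tokens multiplies the fuel by
  \<open>switches\<close> of its body, which is a constant; nested token loops would give a product
  of fuels.\<close>

lemma cost_linear: "\<exists>k. \<forall>n. cost n c \<le> k * (n + 1)"
proof (induction c)
  case (Seq c d)
  then obtain k k' where k: "\<And>n. cost n c \<le> k * (n + 1)" "\<And>n. cost n d \<le> k' * (n + 1)" by blast
  have "cost n (c ;; d) \<le> (k + k') * (n + 1)" for n
    using add_mono[OF k(1)[of n] k(2)[of n]] by (simp add: algebra_simps)
  then show ?case by blast
next
  case (If t c d)
  then obtain k k' where k: "\<And>n. cost n c \<le> k * (n + 1)" "\<And>n. cost n d \<le> k' * (n + 1)" by blast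
  have "cost n (If t c d) \<le> (k + k') * (n + 1)" for n
    using k(1)[of n] k(2)[of n] by (simp add: algebra_simps)
  then show ?case by blast
next
  case (While t c)
  have "cost n (While t c) \<le> switches c * (n + 1)" for n by simp
  then show ?case by blast
next
  case (Switch m)
  show ?case by (intro exI[of _ 1]) auto
qed auto

text \<open>The potential in the middle of a pass. As soon as the pass of a token loop has found its
  token, the coming execution of the body is charged, in exchange for the token just
  removed.\<close>

fun pot :: "bool \<Rightarrow> nat \<Rightarrow> com list \<Rightarrow> nat" where
  "pot q n (While t c # K) = (if q \<and> t = TOp Pop then costs n (c # While t c # K) else costs n (While t c # K))"
| "pot q n L = costs n L"

primrec fuel_bit :: "tsym \<Rightarrow> bool" where
  "fuel_bit (Col f bs) = f" | "fuel_bit Blank = False" | "fuel_bit LMark = False"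

definition fuel_count :: "tsym list \<Rightarrow> nat" where
  "fuel_count cs = length (filter fuel_bit cs)"

lemma fuel_count_append [simp]:
  "fuel_count (ys @ zs) = fuel_count ys + fuel_count zs"
  "fuel_count (Col f bs # cs) = of_bool f + fuel_count cs"
  "fuel_count [] = 0"
  by (auto simp: fuel_count_def)

lemma fuel_count_le: "fuel_count cs \<le> length cs"
  by (simp add: fuel_count_def)

lemma pot_carry_in: "exec m L a g = {(Pass m (carry_in (opn_of L)) L, MStay, g, MRight)} \<Longrightarrow>
    pot (carry_in (opn_of L)) n L = costs n L"
  by (cases "(m, L, a, g)" rule: exec.cases) auto

text \<open>The cost of a tame body does not depend on the fuel. So the removal of one token lowers
  the cost of the loop by exactly one execution of its body, which is what the raised carry
  adds.\<close>

lemma pot_column: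
  assumes "(q', f', bs') \<in> column (opn_of L) q f bs" "list_all wf_com L"
  shows "pot q' (n + of_bool f') L \<le> pot q (n + of_bool f) L"
proof (cases "opn_of L = Pop")
  case False
  then have "f' = f" using assms(1) by (cases "opn_of L") auto
  then show ?thesis using False by (cases "(q, n + of_bool f, L)" rule: pot.cases) auto
next
  case True
  then have q': "q' = (q \<or> f)" "f' = (f \<and> q)" using assms(1) by auto
  show ?thesis
  proof (cases "\<exists>c K. L = While (TOp Pop) c # K")
    case True
    then obtain c K where L: "L = While (TOp Pop) c # K" by blast
    have c: "cost k c = switches c" for k using assms(2) tame_cost L by auto
    show ?thesis
    proof (cases q)
      case True
      then show ?thesis using q' by (simp add: L)
    next
      case False
      then show ?thesis using q' costs_mono[of n "n + of_bool f" K] by (cases f) (auto simp: L c)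
    qed
  next
    case False
    then have "pot b k L = costs k L" for b k
      by (cases "(b, k, L)" rule: pot.cases) auto
    then show ?thesis using q' by (simp add: costs_mono)
  qed
qed

lemma costs_continue:
  assumes "list_all wf_com L"
  shows "costs n (continue q L) \<le> pot q n L"
  using assms tame_cost by (cases "(q, L)" rule: continue.cases) (auto simp: max_def)

lemma wf_continue: "list_all wf_com L \<Longrightarrow> list_all wf_com (continue q L)"
  using tame_cost by (cases "(q, L)" rule: continue.cases) auto

section \<open>An invariant for space and alternations\<close>

definition alters :: "ctrl \<Rightarrow> ctrl \<Rightarrow> bool" where
  "alters q q' \<longleftrightarrow> {ckd q, ckd q'} = {Existential, Universal}"

text \<open>Between home states only \<open>Switch\<close> changes the mode, and its own cost of 1
  pays for the alternation.\<close>

lemma exec_cost: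
  assumes "(q', d, g', d') \<in> exec m L a g" "list_all wf_com L"
  shows "g' = g \<and>
    ((\<exists>m' L'. q' = Home m' L' \<and> d' = MStay \<and> list_all wf_com L' \<and>
        of_bool (alters (Home m L) q') + costs n L' \<le> costs n L) \<or>
     q' = Pass m (carry_in (opn_of L)) L \<and> d' = MRight \<and> pot (carry_in (opn_of L)) n L = costs n L)"
proof -
  have na: "\<not> alters (Home m L) (Home m L')" for L'
  proof -
    have "ckd (Home m K) \<in> {Accepting, Rejecting, if m then Existential else Universal}" for K
      by (cases "(m, K, LeftEnd :: sym cell, Blank)" rule: exec.cases) auto
    from this[of L] this[of L'] show ?thesis by (cases m) (auto simp: alters_def doubleton_eq_iff)
  qed
  note wf_continue[OF assms(2)] costs_continue[OF assms(2), of n]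
  then show ?thesis using assms na pot_carry_in[of m L a g n]
    by (cases "(m, L, a, g)" rule: exec.cases) (auto intro: order_trans simp: max_def)
qed


text \<open>The alternations made so far plus the potential of what remains never exceed the cost of
  the whole program. While the input is being measured, all states are existential and
  \<open>k\<close> is still 0.\<close>

inductive config_inv :: "com \<Rightarrow> sym list \<Rightarrow> nat \<Rightarrow> ctrl \<Rightarrow> nat \<Rightarrow> (nat \<Rightarrow> tsym) \<Rightarrow> nat \<Rightarrow> bool" for p x where
  start: "config_inv p x 0 Start 0 (tp []) 0"
| seek: "c \<le> length x + 1 \<Longrightarrow> config_inv p x 0 Seek_end c (tp (LMark # counter c)) 0"
| incr: "c \<le> length x \<Longrightarrow> list_all is_col (ys @ zs) \<Longrightarrow> ys @ incr zs = counter (Suc c) \<Longrightarrow>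
    config_inv p x 0 Incr (Suc c) (tp (LMark # ys @ zs)) (Suc (length ys))"
| incr_ret: "c \<le> length x \<Longrightarrow> h \<le> width (Suc c) \<Longrightarrow>
    config_inv p x 0 Incr_ret (Suc c) (tp (LMark # counter (Suc c))) h"
| home: "list_all is_col cs \<Longrightarrow> length cs = width (length x + 1) \<Longrightarrow> list_all wf_com L \<Longrightarrow>
    k + costs (fuel_count cs) L \<le> cost (width (length x + 1)) p \<Longrightarrow>
    config_inv p x k (Home m L) i (tp (LMark # cs)) 0"
| pass: "list_all is_col (ys @ zs) \<Longrightarrow> length (ys @ zs) = width (length x + 1) \<Longrightarrow> list_all wf_com L \<Longrightarrow>
    k + pot q (fuel_count (ys @ zs)) L \<le> cost (width (length x + 1)) p \<Longrightarrow>
    config_inv p x k (Pass m q L) i (tp (LMark # ys @ zs)) (Suc (length ys))"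
| ret: "list_all is_col cs \<Longrightarrow> length cs = width (length x + 1) \<Longrightarrow> list_all wf_com L \<Longrightarrow>
    k + costs (fuel_count cs) L \<le> cost (width (length x + 1)) p \<Longrightarrow> h \<le> length cs \<Longrightarrow>
    config_inv p x k (Ret m L) i (tp (LMark # cs)) h"

lemma inv_bounds:
  assumes "config_inv p x k q i t h"
  shows "h \<le> width (length x + 1) + 1 \<and> k \<le> cost (width (length x + 1)) p"
  using assms
proof cases
  case (incr c ys zs)
  have "length ys \<le> width (Suc c)" using incr(8) by (metis counter_simps(1) length_append le_add1)
  also have "\<dots> \<le> width (length x + 1)" using incr(6) by (intro width_mono) auto
  finally show ?thesis using incr by simp
next
  case (incr_ret c)
  then have "width (Suc c) \<le> width (length x + 1)" by (intro width_mono) auto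
  with incr_ret show ?thesis by simp
qed auto

lemma tape_end:
  "tp (LMark # ys) (Suc (length ys)) = Blank"
  "(tp (LMark # ys))(Suc (length ys) := g) = tp (LMark # ys @ [g])"
  "(tp (LMark # ys))(Suc (length ys) := Blank) = tp (LMark # ys)"
  using tp_simps(2,4,5)[of "LMark # ys"] by simp_all

lemma tape_mid:
  "tp (LMark # ys @ c # cs) (Suc (length ys)) = c"
  "(tp (LMark # ys @ c # cs))(Suc (length ys) := g) = tp (LMark # ys @ g # cs)"
  using tp_simps(1)[of "LMark # ys" c cs] tp_simps(3)[of "LMark # ys" c cs] by simp_all

lemma not_alters:
  "\<not> alters (Home m L) (Pass m q L')" "\<not> alters (Pass m q L) (Pass m q' L')" "\<not> alters (Pass m q L) (Ret m L')"
  "\<not> alters (Ret m L) (Ret m L')" "\<not> alters (Ret m L) (Home m L')"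
  "ckd q0 = Existential \<Longrightarrow> ckd q1 = Existential \<Longrightarrow> \<not> alters q0 q1"
  "ckd q0 = Existential \<Longrightarrow> \<not> alters q0 (Home True L)"
proof -
  have *: "ckd (Home m K) \<in> {Accepting, Rejecting, if m then Existential else Universal}" for m K
    by (cases "(m, K, LeftEnd :: sym cell, Blank)" rule: exec.cases) auto
  from *[of m L] *[of m L'] *[of True L]
  show "\<not> alters (Home m L) (Pass m q L')" "\<not> alters (Pass m q L) (Pass m q' L')" "\<not> alters (Pass m q L) (Ret m L')"
    "\<not> alters (Ret m L) (Ret m L')" "\<not> alters (Ret m L) (Home m L')"
    "ckd q0 = Existential \<Longrightarrow> ckd q1 = Existential \<Longrightarrow> \<not> alters q0 q1"
    "ckd q0 = Existential \<Longrightarrow> \<not> alters q0 (Home True L)"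
    by (auto simp: alters_def doubleton_eq_iff split: if_splits)
qed

lemma inv_step:
  assumes "wf_com p" "config_inv p x k q i t h" "(q', d, g', d') \<in> full_delta p q (scan x i) (t h)"
  shows "config_inv p x (if alters q q' then k + 1 else k) q' (min (shift d i) (length x + 1)) (t(h := g')) (shift d' h)"
  using assms(2)
proof cases
  case start
  have "(tp [])(0 := LMark) = tp (LMark # counter 0)" by (auto simp: tp_def counter_def fun_eq_iff)
  with config_inv.seek[of 0 x p] show ?thesis using assms(3) by (simp add: start not_alters)
next
  case (seek)
  show ?thesis
  proof (cases "scan x i = RightEnd")
    case True
    with seek have i: "i = length x + 1" by (auto simp: scan_RightEnd_iff)
    have "config_inv p x 0 (Home True [p]) i (tp (LMark # counter i)) 0"
      using assms(1) fuel_count_le[of "counter i"]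
      by (intro config_inv.home) (auto simp: i intro: cost_mono)
    then show ?thesis using assms(3) True by (simp add: seek not_alters i)
  next
    case False
    then have i: "i \<le> length x" by (auto simp: scan_RightEnd_iff)
    have "config_inv p x 0 Incr (Suc i) (tp (LMark # [] @ counter i)) (Suc (length ([] :: tsym list)))"
      using i by (intro config_inv.incr) (auto simp: incr_counter)
    then show ?thesis using assms(3) False i by (simp add: seek not_alters min_absorb1)
  qed
next
  case (incr c ys zs)
  show ?thesis
  proof (cases zs)
    case Nil
    have "config_inv p x 0 Incr_ret (Suc c) (tp (LMark # counter (Suc c))) (length ys)"
      using incr(6) incr(8)[symmetric] by (intro config_inv.incr_ret) (auto simp flip: counter_simps(1))
    then show ?thesis using assms(3) incr(6) incr(8)[symmetric]
      by (simp add: incr(1-5) Nil tape_end not_alters min_absorb1)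
  next
    case (Cons z cs)
    then obtain f bs where z: "z = Col f bs" using incr(7) by (cases z) auto
    show ?thesis
    proof (cases "bs ! 0")
      case True
      have "config_inv p x 0 Incr (Suc c) (tp (LMark # (ys @ [Col f (bs[0 := False])]) @ cs)) (Suc (length (ys @ [Col f (bs[0 := False])])))"
        using incr True by (intro config_inv.incr) (auto simp: Cons z)
      then show ?thesis using assms(3) incr(6) True
        by (simp add: incr(1-5) Cons z tape_mid not_alters min_absorb1)
    next
      case False
      have "config_inv p x 0 Incr_ret (Suc c) (tp (LMark # counter (Suc c))) (length ys)"
        using incr(6) incr(8)[symmetric] by (intro config_inv.incr_ret) (auto simp flip: counter_simps(1))
      then show ?thesis using assms(3) incr(6) incr(8)[symmetric] False
        by (simp add: incr(1-5) Cons z tape_mid not_alters min_absorb1)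
    qed
  qed
next
  case (incr_ret c)
  show ?thesis
  proof (cases h)
    case 0
    then show ?thesis using assms(3) incr_ret config_inv.seek[of "Suc c" x p]
      by (simp add: not_alters min_absorb1)
  next
    case (Suc j)
    with incr_ret obtain f bs where "tp (LMark # counter (Suc c)) h = Col f bs"
      "(tp (LMark # counter (Suc c)))(h := Col f bs) = tp (LMark # counter (Suc c))"
      using tape_at[of "counter (Suc c)" j] by (auto simp del: width.simps)
    then show ?thesis using assms(3) incr_ret(1-4) Suc config_inv.incr_ret[of c x j p] incr_ret(5,6)
      by (simp add: not_alters min_absorb1 del: width.simps)
  qed
next
  case (home cs L m)
  have "(q', d, g', d') \<in> exec m L (scan x i) LMark" using assms(3) by (simp add: home)
  from exec_cost[OF this home(6), of "fuel_count cs"]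
  consider m' L' where "g' = LMark" "q' = Home m' L'" "d' = MStay" "list_all wf_com L'"
      "of_bool (alters q q') + costs (fuel_count cs) L' \<le> costs (fuel_count cs) L"
    | "g' = LMark" "q' = Pass m (carry_in (opn_of L)) L" "d' = MRight"
      "pot (carry_in (opn_of L)) (fuel_count cs) L = costs (fuel_count cs) L"
    using home(1) by blast
  then show ?thesis
  proof cases
    case 1
    have "config_inv p x (if alters q q' then k + 1 else k) (Home m' L') (min (shift d i) (length x + 1)) (tp (LMark # cs)) 0"
      using home(4-) 1 by (intro config_inv.home) (auto split: if_splits)
    then show ?thesis using 1 by (simp add: home(1-3))
  next
    case 2
    have "config_inv p x k (Pass m (carry_in (opn_of L)) L) (min (shift d i) (length x + 1)) (tp (LMark # [] @ cs)) (Suc (length ([] :: tsym list)))"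
      using home(4-) 2 by (intro config_inv.pass) auto
    then show ?thesis using 2 by (simp add: home(1-3) not_alters)
  qed
next
  case (pass ys zs L q0 m)
  show ?thesis
  proof (cases zs)
    case Nil
    have "config_inv p x k (Ret m (continue q0 L)) (min i (length x + 1)) (tp (LMark # ys)) (length ys)"
      using pass(4-) wf_continue[OF pass(6)] costs_continue[OF pass(6), of "fuel_count ys" q0]
      by (intro config_inv.ret) (auto simp: Nil)
    then show ?thesis using assms(3) by (simp add: pass(1-3) Nil tape_end(1,3) not_alters)
  next
    case (Cons z cs)
    then obtain f bs where z: "z = Col f bs" using pass(4) by (cases z) auto
    from assms(3) obtain q1 f1 bs1 where q1: "(q1, f1, bs1) \<in> column (opn_of L) q0 f bs"
      "q' = Pass m q1 L" "g' = Col f1 bs1" "d = MStay" "d' = MRight"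
      by (auto simp: pass(1-3) Cons z tape_mid)
    \<comment> \<open>The tokens outside the current column serve as parameter \<open>n\<close> of
      \<open>pot_column\<close>, which adds the current column itself.\<close>
    have "config_inv p x k (Pass m q1 L) (min i (length x + 1)) (tp (LMark # (ys @ [Col f1 bs1]) @ cs)) (Suc (length (ys @ [Col f1 bs1])))"
      using pass(4-) pot_column[OF q1(1) pass(6), of "fuel_count (ys @ cs)"]
      by (intro config_inv.pass) (auto simp: Cons z ac_simps)
    then show ?thesis by (simp add: pass(1-3) q1 Cons z tape_mid not_alters)
  qed
next
  case (ret cs L m)
  show ?thesis
  proof (cases h)
    case 0
    have "config_inv p x k (Home m L) (min i (length x + 1)) (tp (LMark # cs)) 0"
      using ret(3-) by (intro config_inv.home) auto
    then show ?thesis using assms(3) by (simp add: ret(1,2) 0 not_alters)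
  next
    case (Suc j)
    with ret obtain f bs where *: "tp (LMark # cs) h = Col f bs"
      "(tp (LMark # cs))(h := Col f bs) = tp (LMark # cs)"
      using tape_at[of cs j] by auto
    have "config_inv p x k (Ret m L) (min i (length x + 1)) (tp (LMark # cs)) j"
      using ret(3-) Suc by (intro config_inv.ret) auto
    then show ?thesis using assms(3) * Suc by (simp add: ret(1,2) not_alters)
  qed
qed

lemma inv_reaches:
  assumes "wf_com p" "reaches (machine p) x k c"
  shows "\<exists>q i t h. c = (q, i, [(t, h)]) \<and> config_inv p x k q i t h"
  using assms(2)
proof induction
  case 1
  have "tp [] = (\<lambda>_. Blank)" by (simp add: tp_def)
  with config_inv.start[of p x] show ?case by (simp add: init_def)
next
  case (2 k c c')
  then obtain q i t h where c: "c = (q, i, [(t, h)])" "config_inv p x k q i t h" by blast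
  from 2(2) obtain q' d g' d' where *: "(q', d, g', d') \<in> full_delta p q (scan x i) (t h)"
    "c' = (q', min (shift d i) (length x + 1), [(t(h := g'), shift d' h)])"
    unfolding c(1) step_one_tape by blast
  have "alternates (machine p) c c' = alters q q'"
    by (simp add: alternates_def alters_def c *(2))
  with inv_step[OF assms(1) c(2) *(1)] show ?case by (simp add: *(2))
qed

lemma width_le_ln: "real (width (n + 1)) \<le> ln (real n + 1) / ln 2 + 1"
proof (cases "width (n + 1)")
  case (Suc w)
  then have "2 ^ w \<le> n + 1" using width_le[of "n + 1"] by simp
  then have "(2 :: real) ^ w \<le> real n + 1" by (metis of_nat_1 of_nat_add of_nat_le_iff of_nat_numeral of_nat_power)
  then have "ln ((2 :: real) ^ w) \<le> ln (real n + 1)" by simp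
  then have "real w * ln 2 \<le> ln (real n + 1)" by (simp add: ln_realpow)
  then show ?thesis using Suc by (simp add: field_simps)
qed simp

theorem machine_in_AC1:
  assumes "wf_com p"
  shows "language (machine p) \<in> AC1"
proof (rule finite_one_tape.in_AC1[OF finite_one_tape_machine])
  \<comment> \<open>Besides the columns, the head visits the left mark and the first blank cell;
    hence the summand 2.\<close>
  show "h + 1 \<le> width (length x + 1) + 2" if "reaches (machine p) x k (q, i, [(t, h)])" for x k q i t h
    using inv_reaches[OF assms that] inv_bounds by fastforce
  show "k \<le> cost (width (length x + 1)) p" if "reaches (machine p) x k (q, i, [(t, h)])" for x k q i t h
    using inv_reaches[OF assms that] inv_bounds by fastforce
  show "(\<lambda>n. real (width (n + 1) + 2)) \<in> O(\<lambda>n. ln (real n))"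
  proof (rule landau_o.big_trans)
    show "(\<lambda>n. real (width (n + 1) + 2)) \<in> O(\<lambda>n. ln (real n + 1) / ln 2 + 3)"
      using width_le_ln by (intro landau_o.big_mono always_eventually allI) (auto simp: add.commute intro: order_trans)
    show "(\<lambda>n. ln (real n + 1) / ln 2 + 3) \<in> O(\<lambda>n. ln (real n))" by real_asymp
  qed
  obtain k where k: "\<And>n. cost n p \<le> k * (n + 1)" using cost_linear by blast
  show "(\<lambda>n. real (cost (width (n + 1)) p)) \<in> O(\<lambda>n. ln (real n))"
  proof (rule landau_o.big_trans)
    have "real (cost (width (n + 1)) p) \<le> real k * (ln (real n + 1) / ln 2 + 2)" for n
    proof -
      have "real (cost (width (n + 1)) p) \<le> real (k * (width (n + 1) + 1))"
        using k by (simp only: of_nat_le_iff)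
      also have "\<dots> = real k * (real (width (n + 1)) + 1)" by (simp add: algebra_simps)
      also have "\<dots> \<le> real k * (ln (real n + 1) / ln 2 + 2)"
        using width_le_ln[of n] by (intro mult_left_mono) auto
      finally show ?thesis .
    qed
    then show "(\<lambda>n. real (cost (width (n + 1)) p)) \<in> O(\<lambda>n. real k * (ln (real n + 1) / ln 2 + 2))"
      by (intro landau_o.big_mono always_eventually allI) (auto intro: order_trans)
    have "(\<lambda>n. ln (real n + 1) / ln 2 + 2) \<in> O(\<lambda>n. ln (real n))" by real_asymp
    then show "(\<lambda>n. real k * (ln (real n + 1) / ln 2 + 2)) \<in> O(\<lambda>n. ln (real n))"
      by (cases "k = 0") (simp_all only: landau_o.big.cmult_in_iff of_nat_eq_0_iff, simp_all)
  qed
qed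

section \<open>Variable-free formulas depend only on ranks\<close>

text \<open>Satisfaction at the point \<open>k\<close> of the natural numbers, where each number
  sees all smaller ones; this point has rank \<open>k\<close>.\<close>

primrec lsat :: "nat \<Rightarrow> fm \<Rightarrow> bool" where
  "lsat k Bot \<longleftrightarrow> False"
| "lsat k (Var p) \<longleftrightarrow> False"
| "lsat k (Imp \<phi> \<psi>) \<longleftrightarrow> \<not> lsat k \<phi> \<or> lsat k \<psi>"
| "lsat k (Box \<phi>) \<longleftrightarrow> (\<forall>j<k. lsat j \<phi>)"

primrec fsize :: "fm \<Rightarrow> nat" where
  "fsize Bot = 1" | "fsize (Var p) = 1" | "fsize (Imp \<phi> \<psi>) = Suc (fsize \<phi> + fsize \<psi>)"
| "fsize (Box \<phi>) = Suc (fsize \<phi>)"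

lemma fsize_pos: "0 < fsize \<phi>"
  by (cases \<phi>) auto

section \<open>Ranks in finite transitive acyclic relations\<close>

definition chain :: "('w \<times> 'w) set \<Rightarrow> nat \<Rightarrow> 'w \<Rightarrow> bool" where
  "chain R k s \<longleftrightarrow> (\<exists>t. (s, t) \<in> R ^^ k)"

text \<open>Stated by one walk to be exhibited and one to be refuted, instead of by recursion over
  successors, because this is the form that the machine checks.\<close>

definition rank_of :: "('w \<times> 'w) set \<Rightarrow> 'w \<Rightarrow> nat \<Rightarrow> bool" where
  "rank_of R s k \<longleftrightarrow> chain R k s \<and> \<not> chain R (Suc k) s"

lemma chain_Suc: "chain R (Suc k) s \<longleftrightarrow> (\<exists>t. (s, t) \<in> R \<and> chain R k t)"
  unfolding chain_def by (meson relpow_Suc_E2 relpow_Suc_I2)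

lemma chain_0 [simp]: "chain R 0 s"
  by (simp add: chain_def)

lemma chain_le: "chain R k s \<Longrightarrow> j \<le> k \<Longrightarrow> chain R j s"
proof (induction k arbitrary: s j)
  case (Suc k)
  then show ?case by (cases j) (auto simp: chain_Suc)
qed auto

lemma rank_unique: "rank_of R s k \<Longrightarrow> rank_of R s k' \<Longrightarrow> k = k'"
  unfolding rank_of_def using chain_le by (metis Suc_leI linorder_neqE_nat)

text \<open>By transitivity, the node on the chain that lies \<open>j\<close> steps before its end
  is a direct successor of \<open>s\<close>.\<close>

lemma rank_step:
  assumes "trans R" "chain R k s" "j < k"
  shows "\<exists>t. (s, t) \<in> R \<and> chain R j t"
  using assms(2,3)
proof (induction k arbitrary: s j)
  case (Suc k)
  then obtain t where t: "(s, t) \<in> R" "chain R k t" by (auto simp: chain_Suc)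
  show ?case
  proof (cases "j = k")
    case False
    with Suc.prems have "j < k" by simp
    then obtain u where "(t, u) \<in> R" "chain R j u" using Suc.IH[OF t(2)] by blast
    with t \<open>trans R\<close> show ?thesis by (meson transD)
  qed (use t in auto)
qed auto

lemma rank_exists:
  assumes "finite R" "acyclic R"
  shows "\<exists>k. rank_of R s k"
proof -
  have "wf (R\<inverse>)" using assms by (rule finite_acyclic_wf_converse)
  then show ?thesis
  proof (induction s rule: wf_induct_rule)
    case (less s)
    then have "\<forall>t\<in>R `` {s}. \<exists>k. rank_of R t k" by auto
    then obtain f where f: "\<And>t. (s, t) \<in> R \<Longrightarrow> rank_of R t (f t)" by (metis Image_singleton_iff)
    have fin: "finite (f ` (R `` {s}))" using assms(1) by (intro finite_imageI finite_Image)
    show ?case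
    proof (cases "R `` {s} = {}")
      case True
      then have "rank_of R s 0" by (auto simp: rank_of_def chain_Suc)
      then show ?thesis ..
    next
      case False
      let ?m = "Max (f ` (R `` {s}))"
      have "?m \<in> f ` (R `` {s})" using fin False by (intro Max_in) auto
      then obtain t where "(s, t) \<in> R" "f t = ?m" by auto
      then have "chain R (Suc ?m) s" using f[of t] by (auto simp: chain_Suc rank_of_def)
      moreover have "\<not> chain R (Suc (Suc ?m)) s"
      proof
        assume "chain R (Suc (Suc ?m)) s"
        then obtain t where t: "(s, t) \<in> R" "chain R (Suc ?m) t" by (auto simp: chain_Suc)
        have "f t \<le> ?m" using t fin by (intro Max_ge) auto
        then have "chain R (Suc (f t)) t" using t(2) chain_le by (metis Suc_le_mono)
        with f[OF t(1)] show False by (simp add: rank_of_def)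
      qed
      ultimately show ?thesis unfolding rank_of_def by blast
    qed
  qed
qed

lemma rank_successor_less: "rank_of R s k \<Longrightarrow> (s, t) \<in> R \<Longrightarrow> chain R j t \<Longrightarrow> j < k"
  unfolding rank_of_def using chain_le chain_Suc by (metis Suc_leI not_less)

lemma rank_ge: "rank_of R s k \<Longrightarrow> chain R j s \<Longrightarrow> j \<le> k"
  unfolding rank_of_def using chain_le by (metis Suc_leI not_less)

text \<open>A successor that starts a chain of length \<open>j\<close> may have a rank above
  \<open>j\<close>. This rank is below \<open>k\<close>, so induction finds rank \<open>j\<close>
  among the successors of that successor, and transitivity leads back to \<open>s\<close>.\<close>

lemma rank_successor_exists:
  assumes "trans R" "finite R" "acyclic R"
  shows "rank_of R s k \<Longrightarrow> j < k \<Longrightarrow> \<exists>t. (s, t) \<in> R \<and> rank_of R t j"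
proof (induction k arbitrary: s rule: less_induct)
  case (less k)
  have "chain R k s" using less.prems(1) by (simp add: rank_of_def)
  from rank_step[OF assms(1) this less.prems(2)] obtain t where t: "(s, t) \<in> R" "chain R j t" by blast
  obtain l where l: "rank_of R t l" using rank_exists[OF assms(2,3)] by blast
  show ?case
  proof (cases "l = j")
    case True
    with t l show ?thesis by blast
  next
    case False
    have "j < l" using rank_ge[OF l t(2)] False by simp
    moreover have "chain R l t" using l by (simp add: rank_of_def)
    then have "l < k" using rank_successor_less[OF less.prems(1) t(1)] by blast
    ultimately obtain u where u: "(t, u) \<in> R" "rank_of R u j" using less.IH[OF _ l] by blast
    have "(s, u) \<in> R" using assms(1) t(1) u(1) by (rule transD)
    with u(2) show ?thesis by blast
  qed
qed

lemma ranks_of_successors: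
  assumes "trans R" "finite R" "acyclic R" "rank_of R s k"
  shows "j < k \<longleftrightarrow> (\<exists>t. (s, t) \<in> R \<and> rank_of R t j)"
proof
  show "\<exists>t. (s, t) \<in> R \<and> rank_of R t j" if "j < k"
    using rank_successor_exists[OF assms(1-3) assms(4) that] .
  show "j < k" if "\<exists>t. (s, t) \<in> R \<and> rank_of R t j"
  proof -
    from that obtain t where "(s, t) \<in> R" "chain R j t" by (auto simp: rank_of_def)
    then show ?thesis by (rule rank_successor_less[OF assms(4)])
  qed
qed

lemma acyclic_trans_irrefl: "trans R \<Longrightarrow> irrefl R \<Longrightarrow> acyclic R"
  by (simp add: acyclic_irrefl)

lemma PrL_model_rel:
  assumes "PrL_model M"
  shows "trans (rel M)" "finite (rel M)" "acyclic (rel M)"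
proof -
  from assms have *: "finite (worlds M)" "rel M \<subseteq> worlds M \<times> worlds M" "trans (rel M)" "irrefl (rel M)"
    by (simp_all add: PrL_model_def)
  show "trans (rel M)" by fact
  show "finite (rel M)" using *(1,2) by (meson finite_SigmaI finite_subset)
  show "acyclic (rel M)" using *(3,4) by (rule acyclic_trans_irrefl)
qed

theorem sat_iff_lsat:
  assumes M: "PrL_model M" and "rank_of (rel M) s k" "vars \<phi> = {}"
  shows "sat M s \<phi> \<longleftrightarrow> lsat k \<phi>"
  using assms(2,3)
proof (induction \<phi> arbitrary: s k)
  case (Box \<phi>)
  note R = PrL_model_rel[OF M]
  show ?case
  proof
    assume L: "sat M s (Box \<phi>)"
    show "lsat k (Box \<phi>)"
      unfolding lsat.simps
    proof (intro allI impI)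
      fix j assume "j < k"
      then obtain t where t: "(s, t) \<in> rel M" "rank_of (rel M) t j"
        using ranks_of_successors[OF R Box.prems(1)] by blast
      with L Box.IH[OF t(2)] Box.prems(2) show "lsat j \<phi>" by simp
    qed
  next
    assume L: "lsat k (Box \<phi>)"
    show "sat M s (Box \<phi>)"
    proof (simp, intro allI impI)
      fix t assume t: "(s, t) \<in> rel M"
      obtain j where j: "rank_of (rel M) t j" using rank_exists[OF R(2,3)] by blast
      with t have "j < k" using ranks_of_successors[OF R Box.prems(1)] by blast
      then show "sat M t \<phi>" using L Box.IH[OF j] Box.prems(2) by simp
    qed
  qed
qed auto

text \<open>For each rank below \<open>k\<close> there is a successor of that rank; these are
  distinct and different from \<open>s\<close>. It follows that guesses of the rank may be confined
  to numbers below the number of worlds.\<close>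

lemma rank_less_card:
  assumes "PrL_model M" "rank_of (rel M) s k" "s \<in> worlds M"
  shows "k < card (worlds M)"
proof -
  note R = PrL_model_rel[OF assms(1)]
  let ?S = "rel M `` {s}"
  have "\<forall>j<k. \<exists>t. (s, t) \<in> rel M \<and> rank_of (rel M) t j"
    using ranks_of_successors[OF R assms(2)] by blast
  then obtain f where f: "\<And>j. j < k \<Longrightarrow> (s, f j) \<in> rel M \<and> rank_of (rel M) (f j) j" by metis
  have "inj_on f {..<k}" 
  proof (rule inj_onI)
    fix i j assume *: "i \<in> {..<k}" "j \<in> {..<k}" "f i = f j"
    then have "rank_of (rel M) (f i) i" "rank_of (rel M) (f i) j" using f[of i] f[of j] by auto
    then show "i = j" by (rule rank_unique)
  qed
  moreover have "f ` {..<k} \<subseteq> worlds M - {s}"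
  proof (intro image_subsetI)
    fix j assume "j \<in> {..<k}"
    then have "(s, f j) \<in> rel M" using f by auto
    then show "f j \<in> worlds M - {s}" using assms(1) unfolding PrL_model_def irrefl_def by auto
  qed
  moreover have "finite (worlds M)" using assms(1) by (simp add: PrL_model_def)
  ultimately have "k \<le> card (worlds M - {s})"
    by (metis card_image card_lessThan card_mono finite_Diff)
  also have "\<dots> < card (worlds M)" using assms(3) \<open>finite (worlds M)\<close>
    by (intro psubset_card_mono) auto
  finally show ?thesis .
qed

section \<open>The evaluation game\<close>

text \<open>
  Nodes are positions of the formula string, so that equal subformulas at different places stay apart.
  A position of the game claims that node \<open>r\<close> has truth value \<open>b\<close> at point \<open>j\<close> and
  carries one fact: node \<open>h\<close> is true at \<open>i\<close> iff \<open>i < v\<close>, for all \<open>i\<close> with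
  \<open>lo \<le> i \<le> hi\<close>. In a round, the prover plays the usual evaluation game, or closes the game
  with the fact, or cuts at a node \<open>c\<close> by proposing a fact about it, whereupon the opponent
  either challenges the new fact or makes the prover continue with it in place of the old one.
\<close>

locale formula_tree =
  fixes form :: "nat \<Rightarrow> fm" and V :: "nat set" and rt :: "nat \<Rightarrow> nat" and B top :: nat
  assumes Imp_child: "p \<in> V \<Longrightarrow> form p = Imp \<phi> \<psi> \<Longrightarrow>
      Suc p \<in> V \<and> form (Suc p) = \<phi> \<and> rt p \<in> V \<and> form (rt p) = \<psi>"
    and Box_child: "p \<in> V \<Longrightarrow> form p = Box \<phi> \<Longrightarrow> Suc p \<in> V \<and> form (Suc p) = \<phi>"
    and no_Var: "p \<in> V \<Longrightarrow> form p \<noteq> Var k"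
    and V_bound: "V \<subseteq> {0<..<B}" and top: "Suc top < B"
begin

fun unfolds :: "(nat \<Rightarrow> nat \<Rightarrow> bool \<Rightarrow> bool) \<Rightarrow> nat \<Rightarrow> nat \<Rightarrow> bool \<Rightarrow> bool" where
  "unfolds P r j b \<longleftrightarrow> (case form r of
     Imp _ _ \<Rightarrow> if b then P (Suc r) j False \<or> P (rt r) j True else P (Suc r) j True \<and> P (rt r) j False
   | Box _ \<Rightarrow> if b then \<forall>i<j. P (Suc r) i True else \<exists>i<j. P (Suc r) i False
   | _ \<Rightarrow> \<not> b)"

primrec win :: "nat \<Rightarrow> nat \<Rightarrow> nat \<Rightarrow> bool \<Rightarrow> nat \<Rightarrow> nat \<Rightarrow> nat \<Rightarrow> nat \<Rightarrow> bool" where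
  "win 0 r j b h lo hi v = False"
| "win (Suc t) r j b h lo hi v \<longleftrightarrow>
     r = h \<and> lo \<le> j \<and> j \<le> hi \<and> b = (j < v) \<or>
     unfolds (\<lambda>r j b. win t r j b h lo hi v) r j b \<or>
     (\<exists>c\<in>V. \<exists>lo'<B. \<exists>hi'<B. \<exists>v'<B.
        win t r j b c lo' hi' v' \<and>
        (\<forall>i<B. lo' \<le> i \<and> i \<le> hi' \<longrightarrow> win t c i (i < v') h lo hi v))"

lemma unfolds_sound:
  assumes "unfolds P r j b" "r \<in> V" "\<And>r j b. r \<in> V \<Longrightarrow> P r j b \<Longrightarrow> lsat j (form r) = b"
  shows "lsat j (form r) = b"
proof (cases "form r")
  case (Imp \<phi> \<psi>)
  with assms Imp_child[OF assms(2) Imp] show ?thesis by (auto split: if_splits)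
next
  case (Box \<phi>)
  with assms Box_child[OF assms(2) Box] show ?thesis by (auto split: if_splits)
qed (use assms no_Var in auto)

definition true_fact :: "nat \<Rightarrow> nat \<Rightarrow> nat \<Rightarrow> nat \<Rightarrow> bool" where
  "true_fact h lo hi v \<longleftrightarrow> (\<forall>i. lo \<le> i \<and> i \<le> hi \<longrightarrow> lsat i (form h) = (i < v))"

text \<open>In the case of a cut, the answers to all challenges are sound by induction, so the
  proposed fact is true if the old one is; the play that goes on with it then rests on a true fact.
  A fact about something outside \<open>V\<close> asserts nothing, which provides an initial
  fact.\<close>

lemma win_sound:
  assumes "win t r j b h lo hi v" "r \<in> V" "h \<in> V \<Longrightarrow> true_fact h lo hi v"
  shows "lsat j (form r) = b"
  using assms
proof (induction t arbitrary: r j b h lo hi v)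
  case (Suc t)
  consider "r = h" "lo \<le> j" "j \<le> hi" "b = (j < v)"
    | "unfolds (\<lambda>r j b. win t r j b h lo hi v) r j b"
    | c lo' hi' v' where "c \<in> V" "hi' < B" "win t r j b c lo' hi' v'"
      "\<And>i. i < B \<Longrightarrow> lo' \<le> i \<and> i \<le> hi' \<Longrightarrow> win t c i (i < v') h lo hi v"
    using Suc.prems(1) unfolding win.simps by meson
  then show ?case
  proof cases
    case 1
    with Suc.prems show ?thesis by (auto simp: true_fact_def)
  next
    case 2
    then show ?thesis using Suc.prems(2)
      by (rule unfolds_sound) (use Suc.IH Suc.prems(3) in blast)
  next
    case c: 3
    have "true_fact c lo' hi' v'"
      unfolding true_fact_def
    proof (intro allI impI)
      fix i assume "lo' \<le> i \<and> i \<le> hi'"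
      \<comment> \<open>Challenges range over the points below \<open>B\<close>; by
        \<open>hi' < B\<close> they reach every point of the proposed fact.\<close>
      with c have "win t c i (i < v') h lo hi v" by auto
      with Suc.IH c(1) Suc.prems(3) show "lsat i (form c) = (i < v')" by blast
    qed
    with Suc.IH[OF c(3)] Suc.prems(2) show ?thesis by blast
  qed
qed simp


section \<open>Completeness: winning in logarithmically many rounds\<close>

definition childI :: "(nat \<times> nat) set" where
  "childI = {(p, q). p \<in> V \<and> (\<exists>\<phi> \<psi>. form p = Imp \<phi> \<psi>) \<and> (q = Suc p \<or> q = rt p)}"

text \<open>The two kinds of edges are kept apart because an implication passes its point on
  unchanged, whereas a box replaces it by an arbitrary smaller one.\<close>

definition childB :: "(nat \<times> nat) set" where
  "childB = {(p, q). p \<in> V \<and> (\<exists>\<phi>. form p = Box \<phi>) \<and> q = Suc p}"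

definition child :: "(nat \<times> nat) set" where
  "child = childI \<union> childB"

abbreviation sz :: "nat \<Rightarrow> nat" where
  "sz p \<equiv> fsize (form p)"

abbreviation wins :: "nat \<Rightarrow> nat \<Rightarrow> nat \<Rightarrow> nat \<Rightarrow> nat \<Rightarrow> nat \<Rightarrow> nat \<Rightarrow> bool" where
  "wins t r j h lo hi v \<equiv> win t r j (lsat j (form r)) h lo hi v"

lemma child_V: "(p, q) \<in> child \<Longrightarrow> p \<in> V \<and> q \<in> V \<and> sz q < sz p"
  using Imp_child[of p] Box_child[of p] fsize_pos by (fastforce simp: child_def childI_def childB_def)

lemma childs_V: "(p, q) \<in> child\<^sup>* \<Longrightarrow> p \<in> V \<Longrightarrow> q \<in> V \<and> sz q \<le> sz p"
  by (induction rule: rtrancl_induct) (auto dest: child_V)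

lemma childI_child: "(p, q) \<in> childI \<Longrightarrow> (p, q) \<in> child" "(p, q) \<in> childI\<^sup>* \<Longrightarrow> (p, q) \<in> child\<^sup>*"
  using rtrancl_mono[of childI child] by (auto simp: child_def)

lemma childB_child: "(p, q) \<in> childB \<Longrightarrow> (p, q) \<in> child"
  by (simp add: child_def)

lemma siblings: "(p, q) \<in> child \<Longrightarrow> (p, q') \<in> child \<Longrightarrow> q' = q \<or> sz q + sz q' < sz p"
  using Imp_child[of p] Box_child[of p] by (fastforce simp: child_def childI_def childB_def)

text \<open>The box nearest to \<open>c\<close> is wanted: below it the point no longer changes, so
  that \<open>c\<close> can be cut there with a fact on one point.\<close>

lemma lowest_box:
  assumes "(r, c) \<in> child\<^sup>*"
  shows "(r, c) \<in> childI\<^sup>* \<or> (\<exists>p q. (r, p) \<in> child\<^sup>* \<and> (p, q) \<in> childB \<and> (q, c) \<in> childI\<^sup>*)"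
  using assms
proof (induction rule: rtrancl_induct)
  case (step c d)
  then show ?case
  proof (cases "(c, d) \<in> childB")
    case True
    with step(1) show ?thesis by blast
  next
    case False
    with step(2) have "(c, d) \<in> childI" by (simp add: child_def)
    with step(3) show ?thesis by (meson rtrancl.rtrancl_into_rtrancl)
  qed
qed auto

lemma last_on_path:
  assumes "(r, h) \<in> R\<^sup>*" "P r" "\<not> P h"
  shows "\<exists>c d. (r, c) \<in> R\<^sup>* \<and> P c \<and> (c, d) \<in> R \<and> \<not> P d \<and> (d, h) \<in> R\<^sup>*"
  using assms
proof (induction rule: converse_rtrancl_induct)
  case (step r q)
  show ?case
  proof (cases "P q")
    case True
    with step obtain c d where "(q, c) \<in> R\<^sup>*" "P c" "(c, d) \<in> R" "\<not> P d" "(d, h) \<in> R\<^sup>*" by blast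
    with step(1) show ?thesis by (meson converse_rtrancl_into_rtrancl)
  next
    case False
    with step show ?thesis by blast
  qed
qed auto

lemma heavy_node:
  assumes "r \<in> V" "m \<le> sz r"
  shows "\<exists>c. (r, c) \<in> child\<^sup>* \<and> m \<le> sz c \<and> (\<forall>d. (c, d) \<in> child \<longrightarrow> sz d < m)"
  using assms
proof (induction "sz r" arbitrary: r rule: less_induct)
  case less
  show ?case
  proof (cases "\<exists>d. (r, d) \<in> child \<and> m \<le> sz d")
    case True
    then obtain d where d: "(r, d) \<in> child" "m \<le> sz d" by blast
    with less.hyps[of d] child_V[of r d] obtain c where
      "(d, c) \<in> child\<^sup>*" "m \<le> sz c" "\<forall>d. (c, d) \<in> child \<longrightarrow> sz d < m" by blast
    with d show ?thesis by (meson converse_rtrancl_into_rtrancl)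
  next
    case False
    with less.prems show ?thesis by (metis not_le rtrancl.rtrancl_refl)
  qed
qed

lemma unfolds_mono: "unfolds P r j b \<Longrightarrow> (\<And>r j b. P r j b \<Longrightarrow> Q r j b) \<Longrightarrow> unfolds Q r j b"
  by (auto split: fm.splits if_splits)

lemma win_Suc: "win t r j b h lo hi v \<Longrightarrow> win (Suc t) r j b h lo hi v"
proof (induction t arbitrary: r j b h lo hi v)
  case (Suc t)
  consider "r = h" "lo \<le> j" "j \<le> hi" "b = (j < v)"
    | "unfolds (\<lambda>r j b. win t r j b h lo hi v) r j b"
    | c lo' hi' v' where "c \<in> V" "lo' < B" "hi' < B" "v' < B" "win t r j b c lo' hi' v'"
      "\<And>i. i < B \<Longrightarrow> lo' \<le> i \<and> i \<le> hi' \<Longrightarrow> win t c i (i < v') h lo hi v"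
    using Suc.prems(1) unfolding win.simps(2)[of t] by meson
  then show ?case
  proof cases
    case 1
    then show ?thesis by simp
  next
    case 2
    then have "unfolds (\<lambda>r j b. win (Suc t) r j b h lo hi v) r j b"
      by (rule unfolds_mono) (rule Suc.IH)
    then show ?thesis unfolding win.simps(2)[of "Suc t"] by blast
  next
    case 3
    then show ?thesis unfolding win.simps(2)[of "Suc t"] using Suc.IH by meson
  qed
qed simp

declare win.simps(2) [simp del]

lemma win_mono:
  assumes "win t r j b h lo hi v" "t \<le> t'"
  shows "win t' r j b h lo hi v"
  using assms(2,1) by (induction rule: dec_induct) (auto intro: win_Suc)

lemma wins_unfold:
  assumes "r \<in> V" "\<And>q. (r, q) \<in> childI \<Longrightarrow> wins t q j h lo hi v"
    "\<And>q i. (r, q) \<in> childB \<Longrightarrow> i < j \<Longrightarrow> wins t q i h lo hi v"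
  shows "wins (Suc t) r j h lo hi v"
proof -
  have "unfolds (\<lambda>r j b. win t r j b h lo hi v) r j (lsat j (form r))"
  proof (cases "form r")
    case (Imp \<phi> \<psi>)
    then have "wins t (Suc r) j h lo hi v" "wins t (rt r) j h lo hi v"
      using assms(1) by (auto intro!: assms(2) simp: childI_def)
    with Imp Imp_child[OF assms(1) Imp] show ?thesis by auto
  next
    case (Box \<phi>)
    then have "wins t (Suc r) i h lo hi v" if "i < j" for i
      using assms(1) that by (auto intro!: assms(3) simp: childB_def)
    with Box Box_child[OF assms(1) Box] show ?thesis by fastforce
  qed (use assms(1) no_Var in auto)
  then show ?thesis unfolding win.simps by blast
qed

lemma wins_cut:
  assumes "c \<in> V" "lo' < B" "hi' < B" "v' < B" "true_fact c lo' hi' v'" "wins t r j c lo' hi' v'"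
    "\<And>i. lo' \<le> i \<Longrightarrow> i \<le> hi' \<Longrightarrow> wins t c i h lo hi v"
  shows "wins (Suc t) r j h lo hi v"
proof -
  have "win t c i (i < v') h lo hi v" if "lo' \<le> i \<and> i \<le> hi'" for i
  proof -
    have "lsat i (form c) = (i < v')" using assms(5) that unfolding true_fact_def by blast
    with assms(7)[of i] that show ?thesis by simp
  qed
  with assms(1-4,6) show ?thesis unfolding win.simps by blast
qed

text \<open>A box that fails at some point fails at all later ones, so its least failing point is a
  threshold. If it fails nowhere up to \<open>top\<close>, the threshold is \<open>Suc top\<close>;
  this is the purpose of \<open>Suc top < B\<close>.\<close>

lemma box_fact:
  assumes "form c = Box \<phi>"
  shows "\<exists>v<B. true_fact c 0 top v"
proof (cases "\<exists>k\<le>top. \<not> lsat k (Box \<phi>)")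
  case True
  define k where "k = (LEAST k. \<not> lsat k (Box \<phi>))"
  have k: "\<not> lsat k (Box \<phi>)" "k \<le> top"
    using True LeastI[of "\<lambda>k. \<not> lsat k (Box \<phi>)"] Least_le[of "\<lambda>k. \<not> lsat k (Box \<phi>)"]
    unfolding k_def by (blast, meson order_trans)
  have "lsat i (Box \<phi>) = (i < k)" for i
  proof
    show "i < k" if "lsat i (Box \<phi>)"
    proof (rule ccontr)
      assume "\<not> i < k"
      with that have "lsat k (Box \<phi>)" by auto
      with k(1) show False by contradiction
    qed
    show "lsat i (Box \<phi>)" if "i < k" using not_less_Least[OF that[unfolded k_def]] by blast
  qed
  with assms k(2) top show ?thesis by (intro exI[of _ k]) (simp add: true_fact_def)
next
  case False
  with assms top show ?thesis by (intro exI[of _ "Suc top"]) (simp add: true_fact_def less_Suc_eq_le)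
qed

text \<open>A fact on a single point is of use only if no box lies between the claim and the fact.\<close>

definition adequate :: "nat \<Rightarrow> nat \<Rightarrow> nat \<Rightarrow> nat \<Rightarrow> nat \<Rightarrow> nat \<Rightarrow> bool" where
  "adequate r j h lo hi v \<longleftrightarrow> true_fact h lo hi v \<and>
     ((r, h) \<in> child\<^sup>* \<and> lo = 0 \<and> hi = top \<or> (r, h) \<in> childI\<^sup>* \<and> lo = j \<and> hi = j)"

text \<open>Between \<open>r\<close> and \<open>c\<close> the point stays \<open>j\<close>, so the
  truth value of \<open>c\<close> at \<open>j\<close> is all that the play above \<open>c\<close>
  can ask for.\<close>

lemma wins_cut_point:
  assumes "(r, c) \<in> childI\<^sup>*" "r \<in> V" "j \<le> top"
    and "\<And>v'. adequate r j c j j v' \<Longrightarrow> wins t r j c j j v'"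
    and "wins t c j h lo hi v"
  shows "wins (Suc t) r j h lo hi v"
proof -
  \<comment> \<open>Either choice turns \<open>j < ?v\<close> into the truth value of
    \<open>c\<close> at \<open>j\<close>.\<close>
  let ?v = "if lsat j (form c) then Suc j else 0"
  have t: "true_fact c j j ?v" by (auto simp: true_fact_def le_antisym)
  show ?thesis
  proof (rule wins_cut)
    show "c \<in> V" using assms(1,2) childs_V childI_child by blast
    show "true_fact c j j ?v" by (rule t)
    show "wins t r j c j j ?v" using assms(1,4) t by (auto simp: adequate_def)
    show "wins t c i h lo hi v" if "j \<le> i" "i \<le> j" for i using assms(5) that by simp
  qed (use assms(3) top in auto)
qed

text \<open>With a box in between, three rounds are spent: a cut at the nearest box \<open>p\<close>
  above \<open>c\<close> with its threshold on all points, the unfolding of \<open>p\<close>, and a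
  cut at \<open>c\<close> on the single point reached. The hypothesis \<open>up\<close> is for the
  plays that rest on the facts about \<open>p\<close> and \<open>c\<close>, \<open>low\<close> for
  the play below \<open>c\<close>.\<close>

lemma wins_cut_path:
  assumes rc: "(r, c) \<in> child\<^sup>*" "r \<in> V" "j \<le> top"
    and up: "\<And>r' c' j' lo' hi' v'. (r, r') \<in> child\<^sup>* \<Longrightarrow> (r', c') \<in> child\<^sup>* \<Longrightarrow> (c', c) \<in> child\<^sup>* \<Longrightarrow>
      j' \<le> top \<Longrightarrow> adequate r' j' c' lo' hi' v' \<Longrightarrow> wins t r' j' c' lo' hi' v'"
    and low: "\<And>i. i \<le> top \<Longrightarrow> wins t c i h lo hi v"
  shows "wins (t + 3) r j h lo hi v"
proof (cases "(r, c) \<in> childI\<^sup>*")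
  case True
  have "wins (Suc t) r j h lo hi v"
    using True rc(2,3) by (rule wins_cut_point) (use up rc low in auto)
  then show ?thesis by (rule win_mono) simp
next
  case False
  then obtain p q where pq: "(r, p) \<in> child\<^sup>*" "(p, q) \<in> childB" "(q, c) \<in> childI\<^sup>*"
    using lowest_box[OF rc(1)] by blast
  have pc: "(p, q) \<in> child" "(q, c) \<in> child\<^sup>*" using pq childI_child childB_child by auto
  have V: "p \<in> V" "q \<in> V" using child_V[OF pc(1)] by auto
  have rq: "(r, q) \<in> child\<^sup>*" using pq(1) pc(1) by (rule rtrancl_into_rtrancl)
  have q: "wins (Suc t) q i h lo hi v" if "i \<le> top" for i
    using pq(3) V(2) that by (rule wins_cut_point) (use up rq pc low that in auto)
  have p: "wins (t + 2) p i h lo hi v" if "i \<le> top" for i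
    unfolding add_2_eq_Suc' using V(1)
  proof (rule wins_unfold)
    show "wins (Suc t) q' i h lo hi v" if "(p, q') \<in> childI" for q'
      using that pq(2) by (auto simp: childI_def childB_def)
    show "wins (Suc t) q' i' h lo hi v" if "(p, q') \<in> childB" "i' < i" for q' i'
    proof -
      have "q' = q" using that(1) pq(2) by (auto simp: childB_def)
      with q[of i'] that(2) \<open>i \<le> top\<close> show ?thesis by simp
    qed
  qed
  obtain v' where v': "v' < B" "true_fact p 0 top v'"
    using pq(2) box_fact unfolding childB_def by blast
  have "wins (Suc (t + 2)) r j h lo hi v"
  proof (rule wins_cut)
    have "adequate r j p 0 top v'" using v' pq(1) by (simp add: adequate_def)
    with up[of r p] pq(1) pc rc(3) have "wins t r j p 0 top v'"
      by (meson converse_rtrancl_into_rtrancl rtrancl.rtrancl_refl)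
    then show "wins (t + 2) r j p 0 top v'" by (rule win_mono) simp
  qed (use V v' p top in auto)
  then show ?thesis by (simp only: add_Suc_right[symmetric] numeral_3_eq_3 numeral_2_eq_2)
qed

text \<open>
  A claim about a subtree of size \<open>s\<close> is cut at the last node, along heavy children, whose
  subtree still has size \<open>s / 2\<close>; if a fact is available, only the nodes between claim and fact count, and
  the cut is made on the path to the fact. Both parts are halved by this, except that the side branch at the
  cut may keep its size but loses the fact. This costs at most four rounds, because
  the box above the cut has to be cut first, and every second time the size is halved.
\<close>

lemma wins_log:
  "(\<forall>r\<in>V. \<forall>j\<le>top. sz r < 2 ^ l \<longrightarrow> wins (8 * l) r j h lo hi v) \<and>
   (\<forall>r\<in>V. \<forall>j\<le>top. \<forall>h lo hi v. sz r < 2 ^ l + sz h \<longrightarrow> adequate r j h lo hi v \<longrightarrow> wins (8 * l + 4) r j h lo hi v)"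
  (is "?N l h lo hi v \<and> ?H l")
proof (induction l arbitrary: h lo hi v)
  case 0
  have "?H 0"
  proof (intro ballI allI impI)
    fix r j h lo hi v assume r: "r \<in> V" "j \<le> top" "sz r < 2 ^ 0 + sz h" "adequate r j h lo hi v"
    then have rh: "(r, h) \<in> child\<^sup>*" using childI_child by (auto simp: adequate_def)
    \<comment> \<open>There is no room for an edge: \<open>sz r\<close> is at most
      \<open>sz h\<close>, and sizes decrease strictly along edges.\<close>
    have "r = h"
      using rh
    proof (cases rule: converse_rtranclE)
      case (step q)
      with child_V[of r q] childs_V[of q h] r(3) show ?thesis by auto
    qed
    with r have "wins 1 r j h lo hi v" by (auto simp: adequate_def true_fact_def win.simps)
    then show "wins (8 * 0 + 4) r j h lo hi v" by (rule win_mono) simp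
  qed
  then show ?case using fsize_pos by auto
next
  case (Suc l)
  have N: "\<And>r j h lo hi v. r \<in> V \<Longrightarrow> j \<le> top \<Longrightarrow> sz r < 2 ^ l \<Longrightarrow> wins (8 * l) r j h lo hi v"
    and H: "\<And>r j h lo hi v. r \<in> V \<Longrightarrow> j \<le> top \<Longrightarrow> sz r < 2 ^ l + sz h \<Longrightarrow> adequate r j h lo hi v \<Longrightarrow>
      wins (8 * l + 4) r j h lo hi v"
    using Suc.IH by blast+
  \<comment> \<open>Claim and fact both lie on the path from \<open>r\<close> to \<open>c\<close>.
    The claim is no larger than \<open>r\<close> and the fact no smaller than \<open>c\<close>, so
    \<open>H\<close> applies to every such pair.\<close>
  have up: "wins t r' j' c' lo' hi' v'"
    if "r \<in> V" "sz r < 2 ^ l + sz c" "8 * l + 4 \<le> t" "(r, r') \<in> child\<^sup>*" "(r', c') \<in> child\<^sup>*" "(c', c) \<in> child\<^sup>*"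
      "j' \<le> top" "adequate r' j' c' lo' hi' v'" for r c t r' c' j' lo' hi' v'
  proof -
    have "r' \<in> V" "sz r' \<le> sz r" using childs_V[OF that(4,1)] by auto
    moreover have "c' \<in> V" using childs_V[OF that(5)] calculation by auto
    then have "sz c \<le> sz c'" using childs_V[OF that(6)] by auto
    ultimately have "wins (8 * l + 4) r' j' c' lo' hi' v'" using that(2,7,8) by (intro H) auto
    then show ?thesis using that(3) by (rule win_mono)
  qed
  have N': "wins (8 * Suc l) r j h lo hi v" if r: "r \<in> V" "j \<le> top" "sz r < 2 ^ Suc l" for r j h lo hi v
  proof (cases "sz r < 2 ^ l")
    case True
    from N[OF r(1,2) True] show ?thesis by (rule win_mono) simp
  next
    case False
    then obtain c where c: "(r, c) \<in> child\<^sup>*" "2 ^ l \<le> sz c" "\<And>d. (c, d) \<in> child \<Longrightarrow> sz d < 2 ^ l"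
      using heavy_node[OF r(1), of "2 ^ l"] by auto
    have cV: "c \<in> V" using childs_V[OF c(1) r(1)] by simp
    have d: "wins (8 * l) d i h lo hi v" if "(c, d) \<in> child" "i \<le> top" for d i
      using N child_V[OF that(1)] c(3)[OF that(1)] that(2) by blast
    have low: "wins (8 * l + 4) c i h lo hi v" if "i \<le> top" for i
    proof -
      have "wins (Suc (8 * l)) c i h lo hi v"
        using cV by (rule wins_unfold) (use d that childI_child childB_child in auto)
      then show ?thesis by (rule win_mono) simp
    qed
    \<comment> \<open>Both sides of the cut take \<open>8 * l + 4\<close> rounds and the cut at most
      three. The total \<open>8 * l + 7\<close> is below \<open>8 * Suc l\<close>, which determines
      the slope of the bound, with one round to spare.\<close>
    have "wins (8 * l + 4 + 3) r j h lo hi v"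
      using c(1) r(1,2)
    proof (rule wins_cut_path)
      have "sz r < 2 ^ l + sz c" using r(3) c(2) by simp
      then show "wins (8 * l + 4) r' j' c' lo' hi' v'"
        if "(r, r') \<in> child\<^sup>*" "(r', c') \<in> child\<^sup>*" "(c', c) \<in> child\<^sup>*" "j' \<le> top" "adequate r' j' c' lo' hi' v'"
        for r' c' j' lo' hi' v'
        using up[OF r(1) _ order_refl that] by blast
    qed (rule low)
    then show ?thesis by (rule win_mono) simp
  qed
  have "wins (8 * Suc l + 4) r j h lo hi v"
    if r: "r \<in> V" "j \<le> top" "sz r < 2 ^ Suc l + sz h" "adequate r j h lo hi v" for r j h lo hi v
  proof (cases "sz r < 2 ^ l + sz h")
    case True
    from H[OF r(1,2) True r(4)] show ?thesis by (rule win_mono) simp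
  next
    case False
    \<comment> \<open>\<open>?P q\<close> says that the part between \<open>q\<close> and the fact
      still has size at least \<open>2 ^ l\<close>. At the last such node \<open>c\<close> the part
      from \<open>r\<close> down to \<open>c\<close> is below \<open>2 ^ l\<close>, and so is the
      part from the next node \<open>d\<close> down to \<open>h\<close>.\<close>
    let ?P = "\<lambda>q. 2 ^ l + sz h \<le> sz q"
    have P: "?P r" "\<not> ?P h" using False by auto
    have low: "wins (Suc (8 * Suc l)) c i h lo hi v"
      if c: "(r, c) \<in> child\<^sup>*" "?P c" "(c, d) \<in> child" "\<not> ?P d" "i \<le> top"
        and ad: "\<And>i'. i' \<le> top \<Longrightarrow> (c, d) \<in> childB \<or> i' = i \<Longrightarrow> adequate d i' h lo hi v" for c d i
    proof -
      have cV: "c \<in> V" "sz c \<le> sz r" using childs_V[OF c(1) r(1)] by auto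
      have dV: "d \<in> V" using child_V[OF c(3)] by simp
      have sub: "wins (8 * Suc l) q i' h lo hi v"
        if q: "(c, q) \<in> child" "i' \<le> top" "(c, q) \<in> childB \<or> i' = i" for q i'
      proof (cases "q = d")
        case True
        with ad q have "adequate d i' h lo hi v" by blast
        then have "wins (8 * l + 4) d i' h lo hi v" using dV q(2) c(4) by (intro H) auto
        then show ?thesis unfolding True by (rule win_mono) simp
      next
        case False
        \<comment> \<open>A side branch next to \<open>d\<close>. It can only be bounded by
          \<open>2 ^ Suc l\<close>, hence the appeal to \<open>N'\<close> at the level of the goal
          itself, which is why \<open>N'\<close> is proved before.\<close>
        with siblings[OF c(3) q(1)] have "sz q + sz d < sz c" by simp
        moreover have "sz h \<le> sz d"
        proof -
          have "adequate d i h lo hi v" using ad c(5) by blast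
          then have "(d, h) \<in> child\<^sup>*" using childI_child by (auto simp: adequate_def)
          then show ?thesis using childs_V dV by blast
        qed
        ultimately have "sz q < 2 ^ Suc l" using cV(2) r(3) by simp
        then show ?thesis using N' child_V[OF q(1)] q(2) by blast
      qed
      show ?thesis
        using cV(1)
      proof (rule wins_unfold)
        show "wins (8 * Suc l) q i h lo hi v" if "(c, q) \<in> childI" for q
          using sub[OF childI_child(1)[OF that] c(5)] by simp
        show "wins (8 * Suc l) q i' h lo hi v" if "(c, q) \<in> childB" "i' < i" for q i'
          using sub[OF childB_child[OF that(1)], of i'] that c(5) by simp
      qed
    qed
    show ?thesis
    proof (cases "(r, h) \<in> child\<^sup>* \<and> lo = 0 \<and> hi = top")
      case True
      then obtain c d where c: "(r, c) \<in> child\<^sup>*" "?P c" "(c, d) \<in> child" "\<not> ?P d" "(d, h) \<in> child\<^sup>*"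
        using last_on_path[of r h child ?P] P by blast
      have ad: "adequate d i h lo hi v" for i
        using r(4) True c(5) by (simp add: adequate_def)
      \<comment> \<open>One unfolding of \<open>c\<close> and three rounds for the cut make up the
        summand 4 exactly.\<close>
      have "wins (Suc (8 * Suc l) + 3) r j h lo hi v"
        using c(1) r(1,2)
      proof (rule wins_cut_path)
        have "sz r < 2 ^ l + sz c" using r(3) c(2) by simp
        then show "wins (Suc (8 * Suc l)) r' j' c' lo' hi' v'"
          if "(r, r') \<in> child\<^sup>*" "(r', c') \<in> child\<^sup>*" "(c', c) \<in> child\<^sup>*" "j' \<le> top" "adequate r' j' c' lo' hi' v'"
          for r' c' j' lo' hi' v'
          using up[OF r(1) _ _ that] by simp
        show "wins (Suc (8 * Suc l)) c i h lo hi v" if "i \<le> top" for i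
          using low[OF c(1-4) that ad] .
      qed
      then show ?thesis by (rule win_mono) simp
    next
      case False
      \<comment> \<open>A fact on a single point is reached through implications only, so the cut
        meets no box and costs one round.\<close>
      with r(4) have pt: "(r, h) \<in> childI\<^sup>*" "lo = j" "hi = j" "true_fact h j j v"
        by (auto simp: adequate_def)
      then obtain c d where c: "(r, c) \<in> childI\<^sup>*" "?P c" "(c, d) \<in> childI" "\<not> ?P d" "(d, h) \<in> childI\<^sup>*"
        using last_on_path[of r h childI ?P] P by blast
      have nB: "(c, d) \<notin> childB" using c(3) by (auto simp: childI_def childB_def)
      have "wins (Suc (8 * Suc l)) c j h lo hi v"
        using childI_child(2)[OF c(1)] c(2) childI_child(1)[OF c(3)] c(4) r(2)
        by (rule low) (use nB pt c(5) in \<open>auto simp: adequate_def\<close>)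
      then have "wins (Suc (Suc (8 * Suc l))) r j h lo hi v"
      proof (rule wins_cut_point[OF c(1) r(1,2), rotated])
        have "sz r < 2 ^ l + sz c" using r(3) c(2) by simp
        then show "wins (Suc (8 * Suc l)) r j c j j v'" if "adequate r j c j j v'" for v'
          using up[OF r(1) _ _ rtrancl.rtrancl_refl childI_child(2)[OF c(1)] rtrancl.rtrancl_refl r(2) that] by simp
      qed
      then show ?thesis by (rule win_mono) simp
    qed
  qed
  with N' show ?case by blast
qed

theorem win_iff_lsat:
  assumes "r \<in> V" "j \<le> top" "sz r < 2 ^ l" "h \<notin> V"
  shows "win (8 * l) r j b h lo hi v \<longleftrightarrow> lsat j (form r) = b"
  using assms wins_log[of l h lo hi v] win_sound[of "8 * l" r j b h lo hi v] by blast

end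

section \<open>The model checker\<close>

text \<open>Register \<open>0\<close> is scratch space for moving the input head.\<close>

abbreviation (input) nonleft :: "sym cell list" where
  "nonleft \<equiv> [RightEnd, Sym SBot, Sym SImp, Sym SBox, Sym Zero, Sym One, Sym Sep]"

definition rewind :: com where
  "rewind = While (TScan nonleft) Head_left"

definition seek :: "nat \<Rightarrow> com" where
  "seek r = rewind ;; Do (Copy 0 r) ;; While (TOp (NZ 0)) (Do (Dec 0) ;; Head_right)"

text \<open>Both branches begin by rewinding. Between commands the head thus always stands on the
  left end marker, and its position drops out of the rules.\<close>

definition If_at :: "nat \<Rightarrow> sym cell list \<Rightarrow> com \<Rightarrow> com \<Rightarrow> com" where
  "If_at r cs c d = seek r ;; If (TScan cs) (rewind ;; c) (rewind ;; d)"

definition Repeat :: "nat \<Rightarrow> com \<Rightarrow> com" where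
  "Repeat r c = While (TOp (NZ r)) (Do (Dec r) ;; c)"

definition expect :: "nat \<Rightarrow> sym cell list \<Rightarrow> com" where
  "expect r cs = If_at r cs (Do (Inc r)) Fail"

lemma nonleft_iff: "c \<in> set nonleft \<longleftrightarrow> c \<noteq> LeftEnd"
proof (cases c)
  case (Sym a)
  then show ?thesis by (cases a) auto
qed auto

lemma scan_0_iff: "scan x i = LeftEnd \<longleftrightarrow> i = 0"
  by (auto simp: scan_def)

section \<open>Rules for the derived commands\<close>

context program_run
begin

lemma A_rewind: "h \<le> length x + 1 \<Longrightarrow> A m (rewind # K) h i \<rho> = A m K 0 i \<rho>"
proof (induction h)
  case 0
  then show ?case unfolding rewind_def
    by (subst A_While_scan) (simp_all only: nonleft_iff scan_0_iff, simp_all)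
next
  case (Suc h)
  then have "A m (rewind # K) (Suc h) i \<rho> = A m (Head_left # rewind # K) (Suc h) i \<rho>"
    unfolding rewind_def by (subst A_While_scan) (simp_all only: nonleft_iff scan_0_iff, simp_all)
  with Suc show ?case by (simp add: A_Head_left)
qed

lemma A_move_right:
  "h \<le> length x + 1 \<Longrightarrow> i \<le> W \<Longrightarrow> v < 2 ^ W \<Longrightarrow>
    A m (While (TOp (NZ 0)) (Do (Dec 0) ;; Head_right) # K) h i (\<rho>(0 := v)) =
    A m K (min (h + v) (length x + 1)) i (\<rho>(0 := 0))"
proof (induction v arbitrary: h)
  case 0
  then show ?case by (subst A_While) (auto simp: testable_def holds_def min_absorb1)
next
  case (Suc v)
  have "A m (While (TOp (NZ 0)) (Do (Dec 0) ;; Head_right) # K) h i (\<rho>(0 := Suc v)) =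
      A m (While (TOp (NZ 0)) (Do (Dec 0) ;; Head_right) # K) (min (h + 1) (length x + 1)) i (\<rho>(0 := v))"
    using Suc.prems by (subst A_While) (auto simp: testable_def holds_def A_Seq A_Dec A_Head_right)
  also have "\<dots> = A m K (min (min (h + 1) (length x + 1) + v) (length x + 1)) i (\<rho>(0 := 0))"
    using Suc.prems by (intro Suc.IH) auto
  also have "min (min (h + 1) (length x + 1) + v) (length x + 1) = min (h + Suc v) (length x + 1)"
    by auto
  finally show ?case .
qed

text \<open>\<open>min i W\<close> and \<open>\<rho>(0 := 0)\<close> build the bound on the fuel and
  the empty scratch register into the notion, so that the rules can be used for simplification
  without side conditions on either.\<close>

definition run :: "bool \<Rightarrow> com list \<Rightarrow> nat \<Rightarrow> (nat \<Rightarrow> nat) \<Rightarrow> bool" where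
  "run m L i \<rho> = A m L 0 (min i W) (\<rho>(0 := 0))"

lemma run_basic [simp]:
  "run m (Skip # K) i \<rho> = run m K i \<rho>"
  "run m ((c ;; d) # K) i \<rho> = run m (c # d # K) i \<rho>"
  "run m (Switch m' # K) i \<rho> = run m' K i \<rho>"
  "run m (Succeed # K) i \<rho>"
  "\<not> run m (Fail # K) i \<rho>"
  by (simp_all add: run_def A_Skip A_Seq A_Switch A_Succeed A_Fail)

lemma run_opn [simp]:
  assumes "0 < r" "r < numregs"
  shows "run m (Do (Zero_op r) # K) i \<rho> = run m K i (\<rho>(r := 0))"
    and "run m (Do (Inc r) # K) i \<rho> = run m K i (\<rho>(r := \<rho> r + 1))"
    and "0 < \<rho> r \<Longrightarrow> run m (Do (Dec r) # K) i \<rho> = run m K i (\<rho>(r := \<rho> r - 1))"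
    and "0 < s \<Longrightarrow> s < numregs \<Longrightarrow> run m (Do (Copy r s) # K) i \<rho> = run m K i (\<rho>(r := \<rho> s))"
    and "run m (Do (Guess r) # K) i \<rho> = quant m {..<2 ^ W} (\<lambda>v. run m K i (\<rho>(r := v)))"
proof -
  have t: "\<rho>(0 := 0, r := v) = \<rho>(r := v, 0 := 0)" for v
    using assms by (intro fun_upd_twist) simp
  show "run m (Do (Zero_op r) # K) i \<rho> = run m K i (\<rho>(r := 0))"
    "run m (Do (Inc r) # K) i \<rho> = run m K i (\<rho>(r := \<rho> r + 1))"
    "run m (Do (Guess r) # K) i \<rho> = quant m {..<2 ^ W} (\<lambda>v. run m K i (\<rho>(r := v)))"
    using assms by (simp_all add: run_def A_Zero A_Inc A_Guess flip: t)
  show "run m (Do (Dec r) # K) i \<rho> = run m K i (\<rho>(r := \<rho> r - 1))" if "0 < \<rho> r"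
    using assms that by (simp add: run_def A_Dec flip: t)
  show "run m (Do (Copy r s) # K) i \<rho> = run m K i (\<rho>(r := \<rho> s))" if "0 < s" "s < numregs"
    using assms that by (simp add: run_def A_Copy flip: t)
qed

lemma run_If [simp]:
  assumes "0 < r" "r < numregs" "\<rho> r < 2 ^ W"
  shows "run m (If (TOp (NZ r)) c d # K) i \<rho> = run m ((if \<rho> r \<noteq> 0 then c else d) # K) i \<rho>"
    and "0 < s \<Longrightarrow> s < numregs \<Longrightarrow> \<rho> s < 2 ^ W \<Longrightarrow>
      run m (If (TOp (Eq r s)) c d # K) i \<rho> = run m ((if \<rho> r = \<rho> s then c else d) # K) i \<rho>"
    and "0 < s \<Longrightarrow> s < numregs \<Longrightarrow> \<rho> s < 2 ^ W \<Longrightarrow>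
      run m (If (TOp (Less r s)) c d # K) i \<rho> = run m ((if \<rho> r < \<rho> s then c else d) # K) i \<rho>"
  using assms by (simp_all add: run_def A_If testable_def holds_def)

lemma run_While_NZ:
  assumes "0 < r" "r < numregs" "\<rho> r < 2 ^ W"
  shows "run m (While (TOp (NZ r)) c # K) i \<rho> =
    run m (if \<rho> r \<noteq> 0 then c # While (TOp (NZ r)) c # K else K) i \<rho>"
  using assms by (simp add: run_def A_While testable_def holds_def)

lemma run_While_Pop:
  "Suc i \<le> W \<Longrightarrow> run m (While (TOp Pop) c # K) (Suc i) \<rho> = run m (c # While (TOp Pop) c # K) i \<rho>"
  "run m (While (TOp Pop) c # K) 0 \<rho> = run m K 0 \<rho>"
  by (simp_all add: run_def A_While_Pop_Suc A_While_Pop_0 min_absorb1)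

text \<open>A position beyond the input is harmless: the head stops on the right end marker, and
  \<open>scan\<close> yields \<open>RightEnd\<close> there as well.\<close>

lemma run_If_at [simp]:
  assumes "0 < r" "r < numregs" "\<rho> r < 2 ^ W"
  shows "run m (If_at r cs c d # K) i \<rho> = run m ((if scan x (\<rho> r) \<in> set cs then c else d) # K) i \<rho>"
proof -
  have s: "scan x (min v (length x + 1)) = scan x v" for v by (auto simp: scan_def)
  show ?thesis
    using assms A_move_right[of 0 "min i W" "\<rho> r" m _ "\<rho>"] s[of "\<rho> r"]
    by (simp add: run_def If_at_def seek_def A_Seq A_rewind A_Copy A_If_scan)
qed

lemma run_Repeat:
  assumes "0 < r" "r < numregs" "\<rho> r < 2 ^ W"
  shows "run m (Repeat r c # K) i \<rho> =
    (if \<rho> r = 0 then run m K i \<rho> else run m (c # Repeat r c # K) i (\<rho>(r := \<rho> r - 1)))"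
  unfolding Repeat_def using assms by (subst run_While_NZ) auto

text \<open>Position 0 is the left end marker, so the symbol at position \<open>q\<close> is the
  list element \<open>q - 1\<close>.\<close>

definition suf :: "nat \<Rightarrow> sym list" where
  "suf q = drop (q - 1) x"

lemma scan_suf: "0 < q \<Longrightarrow> scan x q = (case suf q of [] \<Rightarrow> RightEnd | a # ys \<Rightarrow> Sym a)"
  by (auto simp: scan_def suf_def hd_drop_conv_nth split: list.splits)
    (metis Suc_pred diff_le_mono diff_Suc_1 drop_eq_Nil2 hd_drop_conv_nth leD list.sel(1) less_Suc_eq_le not_le_imp_less)+

lemma suf_Suc: "0 < q \<Longrightarrow> suf q = a # ys \<Longrightarrow> suf (Suc q) = ys \<and> q \<le> length x"
  by (cases q) (auto simp: suf_def drop_Suc tl_drop[symmetric] not_le dest: arg_cong[of _ _ length])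


lemma run_Repeat_Inc:
  assumes "0 < r" "r < numregs" "0 < c" "c < numregs" "r \<noteq> c" "\<rho> c < 2 ^ W"
  shows "run m (Repeat c (Do (Inc r)) # K) i \<rho> = run m K i (\<rho>(r := \<rho> r + \<rho> c, c := 0))"
  using assms(6)
proof (induction "\<rho> c" arbitrary: \<rho>)
  case 0
  then show ?case using assms by (simp add: run_Repeat fun_upd_idem)
next
  case (Suc n)
  let ?\<rho> = "\<rho>(c := n, r := \<rho> r + 1)"
  have "run m (Repeat c (Do (Inc r)) # K) i \<rho> = run m (Repeat c (Do (Inc r)) # K) i ?\<rho>"
    using assms Suc.prems Suc.hyps(2)[symmetric] by (subst run_Repeat) auto
  also have "\<dots> = run m K i (?\<rho>(r := ?\<rho> r + ?\<rho> c, c := 0))"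
    using assms Suc.prems Suc.hyps(2) by (intro Suc.hyps(1)) auto
  also have "?\<rho>(r := ?\<rho> r + ?\<rho> c, c := 0) = \<rho>(r := \<rho> r + \<rho> c, c := 0)"
    using assms(5) Suc.hyps(2)[symmetric] by (auto simp: fun_eq_iff)
  finally show ?case .
qed

lemma run_expect:
  assumes "0 < r" "r < numregs" "0 < \<rho> r" "\<rho> r \<le> length x + 1"
  shows "run m (expect r (map Sym S) # K) i \<rho> \<longleftrightarrow>
    (\<exists>a ys. suf (\<rho> r) = a # ys \<and> a \<in> set S \<and> run m K i (\<rho>(r := \<rho> r + 1)))"
proof -
  have "\<rho> r < 2 ^ W" using assms W by simp
  then have "run m (expect r (map Sym S) # K) i \<rho> \<longleftrightarrow>
      scan x (\<rho> r) \<in> set (map Sym S) \<and> run m K i (\<rho>(r := \<rho> r + 1))"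
    using assms unfolding expect_def by simp
  then show ?thesis using scan_suf[OF assms(3)] by (cases "suf (\<rho> r)") (simp_all add: image_iff)
qed

lemma run_Repeat_expect:
  assumes "0 < r" "r < numregs" "0 < c" "c < numregs" "r \<noteq> c" "\<rho> c < 2 ^ W"
    "0 < \<rho> r" "\<rho> r \<le> length x + 1"
  shows "run m (Repeat c (expect r (map Sym S)) # K) i \<rho> \<longleftrightarrow>
    (\<exists>ys zs. suf (\<rho> r) = ys @ zs \<and> length ys = \<rho> c \<and> set ys \<subseteq> set S \<and>
      run m K i (\<rho>(r := \<rho> r + \<rho> c, c := 0)))"
  using assms(6-8)
proof (induction "\<rho> c" arbitrary: \<rho>)
  case 0
  then show ?case using assms by (simp add: run_Repeat fun_upd_idem)
next
  case (Suc n)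
  let ?\<rho> = "\<rho>(c := n, r := \<rho> r + 1)"
  have "run m (Repeat c (expect r (map Sym S)) # K) i \<rho> =
      (\<exists>a ys. suf (\<rho> r) = a # ys \<and> a \<in> set S \<and> run m (Repeat c (expect r (map Sym S)) # K) i ?\<rho>)"
    using assms(1-5) Suc.prems Suc.hyps(2)[symmetric] by (subst run_Repeat) (auto simp: run_expect)
  also have "\<dots> = (\<exists>a ys. suf (\<rho> r) = a # ys \<and> a \<in> set S \<and>
      (\<exists>ys' zs. ys = ys' @ zs \<and> length ys' = n \<and> set ys' \<subseteq> set S \<and>
        run m K i (\<rho>(r := \<rho> r + \<rho> c, c := 0))))"
  proof (intro ex_cong1 conj_cong refl)
    fix a ys assume s: "suf (\<rho> r) = a # ys"
    have n: "suf (Suc (\<rho> r)) = ys" "\<rho> r \<le> length x" using suf_Suc[OF Suc.prems(2) s] by auto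
    have e: "?\<rho>(r := ?\<rho> r + ?\<rho> c, c := 0) = \<rho>(r := \<rho> r + \<rho> c, c := 0)"
      using assms(5) Suc.hyps(2)[symmetric] by (auto simp: fun_eq_iff)
    have "run m (Repeat c (expect r (map Sym S)) # K) i ?\<rho> =
        (\<exists>ys zs. suf (?\<rho> r) = ys @ zs \<and> length ys = ?\<rho> c \<and> set ys \<subseteq> set S \<and>
          run m K i (?\<rho>(r := ?\<rho> r + ?\<rho> c, c := 0)))"
      using assms(1-5) Suc.prems Suc.hyps(2) n by (intro Suc.hyps(1)) auto
    then show "run m (Repeat c (expect r (map Sym S)) # K) i ?\<rho> =
        (\<exists>ys' zs. ys = ys' @ zs \<and> length ys' = n \<and> set ys' \<subseteq> set S \<and>
          run m K i (\<rho>(r := \<rho> r + \<rho> c, c := 0)))"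
      unfolding e using n assms(5) by simp
  qed
  also have "\<dots> = (\<exists>ys zs. suf (\<rho> r) = ys @ zs \<and> length ys = \<rho> c \<and> set ys \<subseteq> set S \<and>
      run m K i (\<rho>(r := \<rho> r + \<rho> c, c := 0)))" (is "?L = ?R")
  proof
    assume ?L
    then obtain a ys zs where "suf (\<rho> r) = (a # ys) @ zs" "length (a # ys) = \<rho> c" "set (a # ys) \<subseteq> set S"
      "run m K i (\<rho>(r := \<rho> r + \<rho> c, c := 0))" using Suc.hyps(2) by auto
    then show ?R by blast
  next
    assume ?R
    then obtain ys zs where *: "suf (\<rho> r) = ys @ zs" "length ys = \<rho> c" "set ys \<subseteq> set S"
      "run m K i (\<rho>(r := \<rho> r + \<rho> c, c := 0))" by blast
    with Suc.hyps(2) obtain a ys' where "ys = a # ys'" by (cases ys) auto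
    with * Suc.hyps(2) show ?L by auto
  qed
  finally show ?case .
qed

end

subsection \<open>Formula strings\<close>

text \<open>The invariant of the parser: \<open>n\<close> formulas are still due and take up the
  next \<open>k\<close> symbols. For Polish notation this one counter replaces a stack.\<close>

definition prefix_len :: "nat \<Rightarrow> sym list \<Rightarrow> nat \<Rightarrow> bool" where
  "prefix_len n ys k \<longleftrightarrow> (\<exists>\<phi>s zs. length \<phi>s = n \<and> set \<phi>s \<subseteq> PrL0 \<and>
     ys = concat (map enc_fm \<phi>s) @ zs \<and> k = length (concat (map enc_fm \<phi>s)))"

lemma PrL0_simps [simp]:
  "Bot \<in> PrL0" "Var p \<notin> PrL0" "Imp \<phi> \<psi> \<in> PrL0 \<longleftrightarrow> \<phi> \<in> PrL0 \<and> \<psi> \<in> PrL0" "Box \<phi> \<in> PrL0 \<longleftrightarrow> \<phi> \<in> PrL0"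
  by (auto simp: PrL0_def)

lemma prefix_len_0 [simp]: "prefix_len 0 ys k \<longleftrightarrow> k = 0"
  by (auto simp: prefix_len_def)

lemma prefix_len_Suc:
  "prefix_len (Suc n) ys k \<longleftrightarrow> (\<exists>\<phi> \<phi>s zs. length \<phi>s = n \<and> \<phi> \<in> PrL0 \<and> set \<phi>s \<subseteq> PrL0 \<and>
     ys = enc_fm \<phi> @ concat (map enc_fm \<phi>s) @ zs \<and> k = length (enc_fm \<phi>) + length (concat (map enc_fm \<phi>s)))"
  (is "_ = ?R")
proof
  assume "prefix_len (Suc n) ys k"
  then obtain \<phi>s zs where *: "length \<phi>s = Suc n" "set \<phi>s \<subseteq> PrL0" "ys = concat (map enc_fm \<phi>s) @ zs"
    "k = length (concat (map enc_fm \<phi>s))" by (auto simp: prefix_len_def)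
  then obtain \<phi> \<phi>s' where "\<phi>s = \<phi> # \<phi>s'" by (cases \<phi>s) auto
  with * show ?R by (intro exI[of _ \<phi>] exI[of _ \<phi>s'] exI[of _ zs]) auto
next
  assume ?R
  then obtain \<phi> \<phi>s zs where "length \<phi>s = n" "\<phi> \<in> PrL0" "set \<phi>s \<subseteq> PrL0"
    "ys = enc_fm \<phi> @ concat (map enc_fm \<phi>s) @ zs" "k = length (enc_fm \<phi>) + length (concat (map enc_fm \<phi>s))"
    by blast
  then show "prefix_len (Suc n) ys k"
    unfolding prefix_len_def by (intro exI[of _ "\<phi> # \<phi>s"] exI[of _ zs]) auto
qed

lemma prefix_len_1: "prefix_len (Suc 0) ys k \<longleftrightarrow> (\<exists>\<phi>\<in>PrL0. \<exists>zs. ys = enc_fm \<phi> @ zs \<and> k = length (enc_fm \<phi>))"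
  unfolding prefix_len_Suc length_0_conv by (simp add: Bex_def)

text \<open>A symbol completes one formula that is due, keeps it due, or replaces it by two; these
  are the updates of the counter.\<close>

lemma prefix_len_Suc_simps:
  "\<not> prefix_len (Suc n) [] k"
  "prefix_len (Suc n) (SBot # ys) k \<longleftrightarrow> (\<exists>k'. k = Suc k' \<and> prefix_len n ys k')"
  "prefix_len (Suc n) (SBox # ys) k \<longleftrightarrow> (\<exists>k'. k = Suc k' \<and> prefix_len (Suc n) ys k')"
  "prefix_len (Suc n) (SImp # ys) k \<longleftrightarrow> (\<exists>k'. k = Suc k' \<and> prefix_len (Suc (Suc n)) ys k')"
  "a \<notin> {SBot, SBox, SImp} \<Longrightarrow> \<not> prefix_len (Suc n) (a # ys) k"
proof -
  have ne: "enc_fm \<phi> \<noteq> []" "hd (enc_fm \<phi>) \<in> {SBot, SBox, SImp}" if "\<phi> \<in> PrL0" for \<phi>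
    using that by (cases \<phi>; simp)+
  show "\<not> prefix_len (Suc n) [] k" using ne(1) by (auto simp: prefix_len_Suc)
  show "\<not> prefix_len (Suc n) (a # ys) k" if "a \<notin> {SBot, SBox, SImp}"
    using ne that unfolding prefix_len_Suc by (metis append_is_Nil_conv hd_append2 list.sel(1))
  show "prefix_len (Suc n) (SBot # ys) k \<longleftrightarrow> (\<exists>k'. k = Suc k' \<and> prefix_len n ys k')"
  proof
    assume "prefix_len (Suc n) (SBot # ys) k"
    then obtain \<phi> \<phi>s zs where *: "length \<phi>s = n" "\<phi> \<in> PrL0" "set \<phi>s \<subseteq> PrL0"
      "SBot # ys = enc_fm \<phi> @ concat (map enc_fm \<phi>s) @ zs"
      "k = length (enc_fm \<phi>) + length (concat (map enc_fm \<phi>s))" by (auto simp: prefix_len_Suc)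
    then have "\<phi> = Bot" by (cases \<phi>) auto
    with * show "\<exists>k'. k = Suc k' \<and> prefix_len n ys k'" by (auto simp: prefix_len_def)
  next
    assume "\<exists>k'. k = Suc k' \<and> prefix_len n ys k'"
    then obtain \<phi>s zs where "length \<phi>s = n" "set \<phi>s \<subseteq> PrL0" "ys = concat (map enc_fm \<phi>s) @ zs"
      "k = Suc (length (concat (map enc_fm \<phi>s)))" by (auto simp: prefix_len_def)
    then show "prefix_len (Suc n) (SBot # ys) k"
      unfolding prefix_len_Suc by (intro exI[of _ Bot] exI[of _ \<phi>s] exI[of _ zs]) auto
  qed
  show "prefix_len (Suc n) (SBox # ys) k \<longleftrightarrow> (\<exists>k'. k = Suc k' \<and> prefix_len (Suc n) ys k')"
  proof
    assume "prefix_len (Suc n) (SBox # ys) k"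
    then obtain \<phi> \<phi>s zs where *: "length \<phi>s = n" "\<phi> \<in> PrL0" "set \<phi>s \<subseteq> PrL0"
      "SBox # ys = enc_fm \<phi> @ concat (map enc_fm \<phi>s) @ zs"
      "k = length (enc_fm \<phi>) + length (concat (map enc_fm \<phi>s))" by (auto simp: prefix_len_Suc)
    then obtain \<psi> where "\<phi> = Box \<psi>" by (cases \<phi>) auto
    with * show "\<exists>k'. k = Suc k' \<and> prefix_len (Suc n) ys k'" by (auto simp: prefix_len_Suc)
  next
    assume "\<exists>k'. k = Suc k' \<and> prefix_len (Suc n) ys k'"
    then obtain \<phi> \<phi>s zs where "length \<phi>s = n" "\<phi> \<in> PrL0" "set \<phi>s \<subseteq> PrL0"
      "ys = enc_fm \<phi> @ concat (map enc_fm \<phi>s) @ zs"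
      "k = Suc (length (enc_fm \<phi>) + length (concat (map enc_fm \<phi>s)))" by (auto simp: prefix_len_Suc)
    then show "prefix_len (Suc n) (SBox # ys) k"
      unfolding prefix_len_Suc by (intro exI[of _ "Box \<phi>"] exI[of _ \<phi>s] exI[of _ zs]) auto
  qed
  show "prefix_len (Suc n) (SImp # ys) k \<longleftrightarrow> (\<exists>k'. k = Suc k' \<and> prefix_len (Suc (Suc n)) ys k')"
  proof
    assume "prefix_len (Suc n) (SImp # ys) k"
    then obtain \<phi> \<phi>s zs where *: "length \<phi>s = n" "\<phi> \<in> PrL0" "set \<phi>s \<subseteq> PrL0"
      "SImp # ys = enc_fm \<phi> @ concat (map enc_fm \<phi>s) @ zs"
      "k = length (enc_fm \<phi>) + length (concat (map enc_fm \<phi>s))" by (auto simp: prefix_len_Suc)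
    then obtain \<psi> \<chi> where "\<phi> = Imp \<psi> \<chi>" by (cases \<phi>) auto
    with * have "prefix_len (Suc (Suc n)) ys (k - 1)" "k = Suc (k - 1)"
      unfolding prefix_len_def by (auto intro!: exI[of _ "\<psi> # \<chi> # \<phi>s"])
    then show "\<exists>k'. k = Suc k' \<and> prefix_len (Suc (Suc n)) ys k'" by blast
  next
    assume "\<exists>k'. k = Suc k' \<and> prefix_len (Suc (Suc n)) ys k'"
    then obtain \<phi>s' zs where *: "length \<phi>s' = Suc (Suc n)" "set \<phi>s' \<subseteq> PrL0"
      "ys = concat (map enc_fm \<phi>s') @ zs" "k = Suc (length (concat (map enc_fm \<phi>s')))"
      by (auto simp: prefix_len_def)
    then obtain \<psi> \<chi> \<phi>s where "\<phi>s' = \<psi> # \<chi> # \<phi>s" by (cases \<phi>s'; cases "tl \<phi>s'") auto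
    with * show "prefix_len (Suc n) (SImp # ys) k"
      unfolding prefix_len_Suc by (intro exI[of _ "Imp \<psi> \<chi>"] exI[of _ \<phi>s] exI[of _ zs]) auto
  qed
qed

lemma length_enc_fm: "\<phi> \<in> PrL0 \<Longrightarrow> length (enc_fm \<phi>) = fsize \<phi>"
  by (induction \<phi>) simp_all

text \<open>This allows positions to serve as names of nodes: in Polish notation every symbol is the
  first symbol of a subformula.\<close>

lemma enc_fm_nodes:
  "\<phi> \<in> PrL0 \<Longrightarrow> k < length (enc_fm \<phi>) \<Longrightarrow> \<exists>\<psi>\<in>PrL0. \<exists>zs. drop k (enc_fm \<phi>) = enc_fm \<psi> @ zs"
proof (induction \<phi> arbitrary: k)
  case Bot
  then show ?case by (intro bexI[of _ Bot]) auto
next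
  case (Var p)
  then show ?case by simp
next
  case (Imp \<phi> \<psi>)
  show ?case
  proof (cases k)
    case 0
    with Imp.prems show ?thesis by (intro bexI[of _ "Imp \<phi> \<psi>"]) auto
  next
    case (Suc l)
    show ?thesis
    proof (cases "l < length (enc_fm \<phi>)")
      case True
      have "\<phi> \<in> PrL0" using Imp.prems(1) by simp
      from Imp.IH(1)[OF this True] obtain \<chi> zs where "\<chi> \<in> PrL0" "drop l (enc_fm \<phi>) = enc_fm \<chi> @ zs" by blast
      with Suc True show ?thesis by auto
    next
      case False
      with Imp.IH(2)[of "l - length (enc_fm \<phi>)"] Imp.prems Suc show ?thesis by auto
    qed
  qed
next
  case (Box \<phi>)
  show ?case
  proof (cases k)
    case 0
    with Box.prems show ?thesis by (intro bexI[of _ "Box \<phi>"]) auto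
  next
    case (Suc l)
    with Box show ?thesis by auto
  qed
qed

abbreviation (input) "r_pos \<equiv> 30 :: nat"
abbreviation (input) "r_cnt \<equiv> 31 :: nat"

definition parse :: com where
  "parse = Do (Zero_op r_cnt) ;; Do (Inc r_cnt) ;; While (TOp (NZ r_cnt))
     (If_at r_pos [Sym SBot] (Do (Dec r_cnt) ;; Do (Inc r_pos))
       (If_at r_pos [Sym SImp] (Do (Inc r_cnt) ;; Do (Inc r_pos))
         (If_at r_pos [Sym SBox] (Do (Inc r_pos)) Fail)))"

context program_run
begin

text \<open>The hypothesis \<open>\<rho> r_cnt \<le> \<rho> r_pos\<close> keeps the counter within a
  register: each symbol read raises it by at most one, so it cannot overtake the position.\<close>

lemma run_parse_loop:
  assumes "0 < \<rho> r_pos" "\<rho> r_pos \<le> length x + 1" "\<rho> r_cnt \<le> \<rho> r_pos"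
  shows "run m (While (TOp (NZ r_cnt))
     (If_at r_pos [Sym SBot] (Do (Dec r_cnt) ;; Do (Inc r_pos))
       (If_at r_pos [Sym SImp] (Do (Inc r_cnt) ;; Do (Inc r_pos))
         (If_at r_pos [Sym SBox] (Do (Inc r_pos)) Fail))) # K) i \<rho> \<longleftrightarrow>
    (\<exists>k. prefix_len (\<rho> r_cnt) (suf (\<rho> r_pos)) k \<and> run m K i (\<rho>(r_pos := \<rho> r_pos + k, r_cnt := 0)))"
    (is "run m (?w # K) i \<rho> \<longleftrightarrow> _")
  using assms
proof (induction "length x + 1 - \<rho> r_pos" arbitrary: \<rho> rule: less_induct)
  case less
  have B: "\<rho> r_cnt < 2 ^ W" "\<rho> r_pos < 2 ^ W" using less.prems W by auto
  show ?case
  proof (cases "\<rho> r_cnt")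
    case 0
    have "run m (?w # K) i \<rho> = run m K i \<rho>" using B 0 by (subst run_While_NZ) auto
    moreover have "\<rho>(r_pos := \<rho> r_pos + 0, r_cnt := 0) = \<rho>" using 0 by (auto simp: fun_eq_iff)
    ultimately show ?thesis using 0 by simp
  next
    case (Suc n)
    show ?thesis
    proof (cases "suf (\<rho> r_pos)")
      case Nil
      then have "\<not> run m (?w # K) i \<rho>"
        using B Suc less.prems(1) scan_suf[of "\<rho> r_pos"] by (subst run_While_NZ) auto
      then show ?thesis by (simp add: Suc Nil prefix_len_Suc_simps)
    next
      case (Cons a ys)
      have sc: "scan x (\<rho> r_pos) = Sym a" using less.prems(1) scan_suf[of "\<rho> r_pos"] Cons by simp
      have nx: "suf (Suc (\<rho> r_pos)) = ys" "\<rho> r_pos \<le> length x" using suf_Suc[OF less.prems(1) Cons] by auto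
      have IH: "run m (?w # K) i (\<rho>(r_cnt := n', r_pos := Suc (\<rho> r_pos))) \<longleftrightarrow>
          (\<exists>k. prefix_len n' ys k \<and> run m K i (\<rho>(r_pos := \<rho> r_pos + Suc k, r_cnt := 0)))"
        if "n' \<le> Suc (\<rho> r_cnt)" for n'
      proof -
        let ?\<rho> = "\<rho>(r_cnt := n', r_pos := Suc (\<rho> r_pos))"
        have e: "?\<rho>(r_pos := ?\<rho> r_pos + k, r_cnt := 0) = \<rho>(r_pos := \<rho> r_pos + Suc k, r_cnt := 0)" for k
          by (auto simp: fun_eq_iff)
        have "run m (?w # K) i ?\<rho> \<longleftrightarrow> (\<exists>k. prefix_len (?\<rho> r_cnt) (suf (?\<rho> r_pos)) k \<and>
            run m K i (?\<rho>(r_pos := ?\<rho> r_pos + k, r_cnt := 0)))"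
          using less.prems nx that by (intro less.hyps) auto
        then show ?thesis unfolding e using nx by simp
      qed
      consider "a = SBot" | "a = SImp" | "a = SBox" | "a \<notin> {SBot, SBox, SImp}" by blast
      then show ?thesis
      proof cases
        case 1
        have "run m (?w # K) i \<rho> = run m (?w # K) i (\<rho>(r_cnt := n, r_pos := Suc (\<rho> r_pos)))"
          using B Suc sc 1 by (subst run_While_NZ) auto
        then show ?thesis using IH[of n] Suc by (auto simp: Cons 1 prefix_len_Suc_simps)
      next
        case 2
        have "run m (?w # K) i \<rho> = run m (?w # K) i (\<rho>(r_cnt := Suc (Suc n), r_pos := Suc (\<rho> r_pos)))"
          using B Suc sc 2 by (subst run_While_NZ) auto
        then show ?thesis using IH[of "Suc (Suc n)"] Suc by (auto simp: Cons 2 prefix_len_Suc_simps)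
      next
        case 3
        have s: "run m (?w # K) i \<rho> = run m (?w # K) i (\<rho>(r_pos := Suc (\<rho> r_pos)))"
          using B Suc sc 3 by (subst run_While_NZ) auto
        have e: "\<rho>(r_pos := Suc (\<rho> r_pos)) = \<rho>(r_cnt := Suc n, r_pos := Suc (\<rho> r_pos))"
          using Suc by (auto simp: fun_eq_iff)
        show ?thesis unfolding s e using IH[of "Suc n"] Suc by (auto simp: Cons 3 prefix_len_Suc_simps)
      next
        case 4
        have "\<not> run m (?w # K) i \<rho>" using B Suc sc 4 by (subst run_While_NZ) auto
        then show ?thesis using 4 by (simp add: Suc Cons prefix_len_Suc_simps)
      qed
    qed
  qed
qed

lemma run_parse:
  assumes "0 < \<rho> r_pos" "\<rho> r_pos \<le> length x + 1"
  shows "run m (parse # K) i \<rho> \<longleftrightarrow>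
    (\<exists>\<phi>\<in>PrL0. \<exists>zs. suf (\<rho> r_pos) = enc_fm \<phi> @ zs \<and>
      run m K i (\<rho>(r_pos := \<rho> r_pos + length (enc_fm \<phi>), r_cnt := 0)))"
proof -
  let ?\<rho> = "\<rho>(r_cnt := Suc 0)"
  have e: "?\<rho>(r_pos := \<rho> r_pos + k, r_cnt := 0) = \<rho>(r_pos := \<rho> r_pos + k, r_cnt := 0)" for k
    by (auto simp: fun_eq_iff)
  have c: "?\<rho> r_pos = \<rho> r_pos" "?\<rho> r_cnt = Suc 0" by simp_all
  have "run m (parse # K) i \<rho> \<longleftrightarrow> (\<exists>k. prefix_len (Suc 0) (suf (\<rho> r_pos)) k \<and>
      run m K i (\<rho>(r_pos := \<rho> r_pos + k, r_cnt := 0)))"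
    using run_parse_loop[of ?\<rho> m K i] assms unfolding parse_def e c by simp
  then show ?thesis unfolding prefix_len_1 by blast
qed

end

subsection \<open>Playing the evaluation game\<close>

abbreviation (input) "r_end \<equiv> 26 :: nat"
abbreviation (input) "r_node \<equiv> 13 :: nat"
abbreviation (input) "r_point \<equiv> 14 :: nat"
abbreviation (input) "r_val \<equiv> 15 :: nat"
abbreviation (input) "r_fnode \<equiv> 16 :: nat"
abbreviation (input) "r_flo \<equiv> 17 :: nat"
abbreviation (input) "r_fhi \<equiv> 18 :: nat"
abbreviation (input) "r_fthr \<equiv> 19 :: nat"
abbreviation (input) "r_cnode \<equiv> 20 :: nat"
abbreviation (input) "r_clo \<equiv> 21 :: nat"
abbreviation (input) "r_chi \<equiv> 22 :: nat"
abbreviation (input) "r_cthr \<equiv> 23 :: nat"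
abbreviation (input) "r_aux \<equiv> 24 :: nat"
abbreviation (input) "r_coin \<equiv> 25 :: nat"

definition choice :: "com \<Rightarrow> com \<Rightarrow> com" where
  "choice c d = Do (Guess r_coin) ;; If (TOp (NZ r_coin)) c d"

definition use_fact :: com where
  "use_fact = If (TOp (Eq r_node r_fnode))
     (If (TOp (Less r_point r_flo)) Fail (If (TOp (Less r_fhi r_point)) Fail
       (If (TOp (Less r_point r_fthr)) (If (TOp (NZ r_val)) Succeed Fail) (If (TOp (NZ r_val)) Fail Succeed))))
     Fail"

text \<open>The mode changes before the choice exactly when the opponent owns it, at a true box or a
  false implication. Moving to the antecedent flips the claimed value. The right child is found by
  parsing across the left one, since the string holds no pointers.\<close>

definition unfold_node :: com where
  "unfold_node = If_at r_node [Sym SBot] (If (TOp (NZ r_val)) Fail Succeed)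
     (If_at r_node [Sym SBox]
       (If (TOp (NZ r_val))
         (Switch False ;; Do (Guess r_aux) ;;
           If (TOp (Less r_aux r_point)) (Do (Copy r_point r_aux) ;; Do (Inc r_node)) Succeed)
         (Do (Guess r_aux) ;;
           If (TOp (Less r_aux r_point)) (Do (Copy r_point r_aux) ;; Do (Inc r_node)) Fail))
       (If (TOp (NZ r_val)) Skip (Switch False) ;; Do (Inc r_node) ;;
        choice (If (TOp (NZ r_val)) (Do (Zero_op r_val)) (Do (Inc r_val)))
          (Do (Copy r_pos r_node) ;; parse ;; Do (Copy r_node r_pos))))"

definition take_fact :: com where
  "take_fact = Do (Copy r_fnode r_cnode) ;; Do (Copy r_flo r_clo) ;; Do (Copy r_fhi r_chi) ;; Do (Copy r_fthr r_cthr)"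

definition challenge_fact :: com where
  "challenge_fact = Do (Guess r_point) ;;
     If (TOp (Less r_point r_clo)) Succeed Skip ;; If (TOp (Less r_chi r_point)) Succeed Skip ;;
     Do (Copy r_node r_cnode) ;; Do (Zero_op r_val) ;; If (TOp (Less r_point r_cthr)) (Do (Inc r_val)) Skip"

definition cut_check :: com where
  "cut_check = If (TOp (NZ r_cnode)) Skip Fail ;; If (TOp (Less r_cnode r_end)) Skip Fail ;; Switch False ;;
     choice take_fact challenge_fact"

definition cut :: com where
  "cut = Do (Guess r_cnode) ;; Do (Guess r_clo) ;; Do (Guess r_chi) ;; Do (Guess r_cthr) ;;
     cut_check"

definition game_round :: com where
  "game_round = choice (choice use_fact unfold_node) cut ;; Switch True"

primrec iter :: "nat \<Rightarrow> com \<Rightarrow> com" where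
  "iter 0 c = Skip"
| "iter (Suc n) c = c ;; iter n c"

text \<open>Eight rounds per token match the factor 8 in \<open>win_iff_lsat\<close>, where the
  number of tokens takes the place of the logarithm of the formula size. Running out of tokens is a
  loss, as in \<open>win 0\<close>.\<close>

definition play :: com where
  "play = While (TOp Pop) (iter 8 game_round) ;; Fail"

lemma quant_cong: "(\<And>v. v \<in> X \<Longrightarrow> P v = Q v) \<Longrightarrow> quant m X P = quant m X Q"
  by (simp add: quant_def)

context program_run
begin

lemma W_pos: "Suc 0 < 2 ^ W"
  using W by linarith

text \<open>Both branches can be reached because 0 and 1 are register contents. The coin keeps an
  arbitrary guessed value, so the outcome of each branch is required not to depend on it.\<close>

lemma run_choice:
  assumes "\<And>v. run m (c # K) i (\<rho>(r_coin := v)) = P" "\<And>v. run m (d # K) i (\<rho>(r_coin := v)) = Q"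
  shows "run m (choice c d # K) i \<rho> = (if m then P \<or> Q else P \<and> Q)"
proof -
  have *: "run m (If (TOp (NZ r_coin)) c d # K) i (\<rho>(r_coin := v)) = (if v \<noteq> 0 then P else Q)"
    if "v < 2 ^ W" for v
    using that assms by simp
  have "run m (choice c d # K) i \<rho> =
      quant m {..<2 ^ W} (\<lambda>v. run m (If (TOp (NZ r_coin)) c d # K) i (\<rho>(r_coin := v)))"
    by (simp add: choice_def del: run_If)
  also have "\<dots> = quant m {..<2 ^ W} (\<lambda>v :: nat. if v \<noteq> 0 then P else Q)"
    by (rule quant_cong) (use * in simp)
  also have "\<dots> = (if m then P \<or> Q else P \<and> Q)"
  proof -
    have "0 \<in> {..<2 ^ W :: nat}" "Suc 0 \<in> {..<2 ^ W :: nat}" using W_pos by auto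
    then show ?thesis unfolding quant_def by (smt (verit) nat.distinct(1))
  qed
  finally show ?thesis .
qed

end

locale checker_run = program_run +
  fixes \<phi>\<^sub>0 :: fm and rest :: "sym list" and top :: nat
  assumes \<phi>\<^sub>0: "\<phi>\<^sub>0 \<in> PrL0" and x_eq: "x = enc_fm \<phi>\<^sub>0 @ rest" and top_bound: "Suc top < 2 ^ W"
begin

text \<open>The description is definite by unique readability, \<open>enc_fm_inject\<close>,
  whatever follows the subformula in the input.\<close>

definition form :: "nat \<Rightarrow> fm" where
  "form q = (THE \<phi>. \<phi> \<in> PrL0 \<and> (\<exists>zs. suf q = enc_fm \<phi> @ zs))"

definition nodes :: "nat set" where
  "nodes = {0<..length (enc_fm \<phi>\<^sub>0)}"

definition rt :: "nat \<Rightarrow> nat" where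
  "rt q = Suc q + length (enc_fm (form (Suc q)))"

lemma suf_eq: "suf q = drop (q - 1) (enc_fm \<phi>\<^sub>0 @ rest)"
  unfolding suf_def by (subst x_eq) (rule refl)

lemma form_eq:
  assumes "\<phi> \<in> PrL0" "suf q = enc_fm \<phi> @ zs"
  shows "form q = \<phi>"
  unfolding form_def
proof (rule the_equality)
  show "\<psi> = \<phi>" if "\<psi> \<in> PrL0 \<and> (\<exists>zs. suf q = enc_fm \<psi> @ zs)" for \<psi>
    using that assms enc_fm_inject by metis
qed (use assms in blast)

lemma node_form:
  assumes "q \<in> nodes"
  obtains zs where "form q \<in> PrL0" "drop (q - 1) (enc_fm \<phi>\<^sub>0) = enc_fm (form q) @ zs"
    "suf q = enc_fm (form q) @ zs @ rest"
proof -
  have q: "q - 1 < length (enc_fm \<phi>\<^sub>0)" using assms by (auto simp: nodes_def)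
  then obtain \<psi> zs where *: "\<psi> \<in> PrL0" "drop (q - 1) (enc_fm \<phi>\<^sub>0) = enc_fm \<psi> @ zs"
    using enc_fm_nodes[OF \<phi>\<^sub>0] by blast
  have s: "suf q = enc_fm \<psi> @ zs @ rest" using q *(2) by (simp add: suf_eq)
  have "form q = \<psi>" using *(1) s by (rule form_eq)
  with * s that show ?thesis by blast
qed

lemma node_end:
  assumes "drop (q - 1) (enc_fm \<phi>\<^sub>0) = ys @ zs" "q \<in> nodes" "zs \<noteq> [] \<or> ys = []"
  shows "q + length ys \<in> nodes \<and> suf (q + length ys) = zs @ rest"
proof -
  have "length ys + length zs = length (enc_fm \<phi>\<^sub>0) - (q - 1)"
    using arg_cong[OF assms(1), of length] by simp
  then have l: "q + length ys \<in> nodes"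
    using assms(2,3) by (cases zs) (auto simp: nodes_def)
  have "drop (q + length ys - 1) (enc_fm \<phi>\<^sub>0) = drop (length ys) (drop (q - 1) (enc_fm \<phi>\<^sub>0))"
    using assms(2) by (simp add: nodes_def add.commute)
  also have "\<dots> = zs" using assms(1) by simp
  finally have "drop (q + length ys - 1) (enc_fm \<phi>\<^sub>0) = zs" .
  moreover have "q + length ys - 1 \<le> length (enc_fm \<phi>\<^sub>0)" using l by (auto simp: nodes_def)
  ultimately show ?thesis using l by (simp add: suf_eq)
qed

lemma enc_fm_ne: "\<phi> \<in> PrL0 \<Longrightarrow> enc_fm \<phi> \<noteq> []"
  by (cases \<phi>) simp_all

lemma nodes_length: "q \<in> nodes \<Longrightarrow> 0 < q \<and> q \<le> length x"
  by (auto simp: nodes_def x_eq)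

sublocale formula_tree form nodes rt "2 ^ W" top
proof
  show "nodes \<subseteq> {0<..<2 ^ W}" using W nodes_length by fastforce
  show "Suc top < 2 ^ W" by (rule top_bound)
  show "form q \<noteq> Var k" if "q \<in> nodes" for q k
    using node_form[OF that] by (metis PrL0_simps(2))
  show "Suc q \<in> nodes \<and> form (Suc q) = \<phi>" if q: "q \<in> nodes" "form q = Box \<phi>" for q \<phi>
  proof -
    obtain zs where zs: "form q \<in> PrL0" "drop (q - 1) (enc_fm \<phi>\<^sub>0) = enc_fm (form q) @ zs"
      using node_form[OF q(1)] by blast
    have \<phi>: "\<phi> \<in> PrL0" using zs(1) q(2) by simp
    have "q + length [SBox] \<in> nodes \<and> suf (q + length [SBox]) = (enc_fm \<phi> @ zs) @ rest"
      using zs q(2) enc_fm_ne[OF \<phi>] by (intro node_end[OF _ q(1)]) auto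
    then show ?thesis using form_eq[OF \<phi>, of "Suc q" "zs @ rest"] by simp
  qed
  show "Suc q \<in> nodes \<and> form (Suc q) = \<phi> \<and> rt q \<in> nodes \<and> form (rt q) = \<psi>"
    if q: "q \<in> nodes" "form q = Imp \<phi> \<psi>" for q \<phi> \<psi>
  proof -
    obtain zs where zs: "form q \<in> PrL0" "drop (q - 1) (enc_fm \<phi>\<^sub>0) = enc_fm (form q) @ zs"
      using node_form[OF q(1)] by blast
    have \<phi>: "\<phi> \<in> PrL0" "\<psi> \<in> PrL0" using zs(1) q(2) by simp_all
    have "q + length [SImp] \<in> nodes \<and> suf (q + length [SImp]) = (enc_fm \<phi> @ enc_fm \<psi> @ zs) @ rest"
      using zs q(2) enc_fm_ne[OF \<phi>(1)] by (intro node_end[OF _ q(1)]) auto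
    then have 1: "Suc q \<in> nodes" "form (Suc q) = \<phi>"
      using form_eq[OF \<phi>(1), of "Suc q" "enc_fm \<psi> @ zs @ rest"] by simp_all
    have "q + length (SImp # enc_fm \<phi>) \<in> nodes \<and> suf (q + length (SImp # enc_fm \<phi>)) = (enc_fm \<psi> @ zs) @ rest"
      using zs q(2) enc_fm_ne[OF \<phi>(2)] by (intro node_end[OF _ q(1)]) auto
    moreover have "rt q = q + length (SImp # enc_fm \<phi>)" using 1 by (simp add: rt_def)
    ultimately have "rt q \<in> nodes" "form (rt q) = \<psi>"
      using form_eq[OF \<phi>(2), of "rt q" "zs @ rest"] by simp_all
    with 1 show ?thesis by simp
  qed
qed

text \<open>The claim must concern a node, whereas the fact may name any register content; this
  admits the initial fact about the nonexistent node 0.\<close>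

definition good :: "(nat \<Rightarrow> nat) \<Rightarrow> bool" where
  "good \<rho> \<longleftrightarrow> \<rho> r_node \<in> nodes \<and> \<rho> r_end = Suc (length (enc_fm \<phi>\<^sub>0)) \<and> \<rho> r_point < 2 ^ W \<and> \<rho> r_val < 2 \<and>
     \<rho> r_fnode < 2 ^ W \<and> \<rho> r_flo < 2 ^ W \<and> \<rho> r_fhi < 2 ^ W \<and> \<rho> r_fthr < 2 ^ W"

definition claim :: "nat \<Rightarrow> (nat \<Rightarrow> nat) \<Rightarrow> bool" where
  "claim t \<rho> = win t (\<rho> r_node) (\<rho> r_point) (\<rho> r_val \<noteq> 0) (\<rho> r_fnode) (\<rho> r_flo) (\<rho> r_fhi) (\<rho> r_fthr)"

lemma good_bounds:
  assumes "good \<rho>"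
  shows "\<rho> r_node < 2 ^ W" "0 < \<rho> r_node" "\<rho> r_node \<le> length x" "\<rho> r_val < 2 ^ W" "\<rho> r_end < 2 ^ W"
proof -
  show n: "0 < \<rho> r_node" "\<rho> r_node \<le> length x" using assms nodes_length by (auto simp: good_def)
  with W show "\<rho> r_node < 2 ^ W" by simp
  show "\<rho> r_val < 2 ^ W" using assms W_pos by (simp add: good_def)
  show "\<rho> r_end < 2 ^ W" using assms W by (simp add: good_def x_eq)
qed

lemma run_use_fact:
  assumes "good \<rho>"
  shows "run m (use_fact # K) i \<rho> \<longleftrightarrow> \<rho> r_node = \<rho> r_fnode \<and> \<rho> r_flo \<le> \<rho> r_point \<and> \<rho> r_point \<le> \<rho> r_fhi \<and>
    (\<rho> r_val \<noteq> 0) = (\<rho> r_point < \<rho> r_fthr)"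
  using assms good_bounds[OF assms] unfolding use_fact_def good_def
  by (cases "\<rho> r_node = \<rho> r_fnode"; cases "\<rho> r_point < \<rho> r_flo"; cases "\<rho> r_fhi < \<rho> r_point";
      cases "\<rho> r_point < \<rho> r_fthr"; cases "\<rho> r_val = 0") simp_all

section \<open>Correctness of one round\<close>

context
  fixes K i t
  assumes K: "\<And>m \<rho>. good \<rho> \<Longrightarrow> run m K i \<rho> = claim t \<rho>"
begin

text \<open>The continuation is entered in the mode of the player who has just moved, so its
  correctness is assumed for both modes.\<close>

lemma run_unfold_node:
  assumes "good \<rho>"
  shows "run True (unfold_node # K) i \<rho> \<longleftrightarrow>
    unfolds (\<lambda>r j b. win t r j b (\<rho> r_fnode) (\<rho> r_flo) (\<rho> r_fhi) (\<rho> r_fthr)) (\<rho> r_node) (\<rho> r_point) (\<rho> r_val \<noteq> 0)"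
proof -
  note B = good_bounds[OF assms]
  have node: "\<rho> r_node \<in> nodes" and pt: "\<rho> r_point < 2 ^ W" and val: "\<rho> r_val = 0 \<or> \<rho> r_val = 1"
    using assms by (auto simp: good_def less_2_cases_iff)
  obtain zs where zs: "form (\<rho> r_node) \<in> PrL0" "suf (\<rho> r_node) = enc_fm (form (\<rho> r_node)) @ zs"
    using node_form[OF node] by blast
  note sc = scan_suf[OF B(2), unfolded zs(2)]
  show ?thesis
  proof (cases "form (\<rho> r_node)")
    case Bot
    then have "scan x (\<rho> r_node) = Sym SBot" using sc by simp
    then show ?thesis using B Bot by (simp add: unfold_node_def)
  next
    case (Var p)
    then show ?thesis using zs(1) by simp
  next
    case (Box \<phi>)
    then have s: "scan x (\<rho> r_node) = Sym SBox" using sc by simp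
    have g: "good (\<rho>(r_aux := v, r_point := v, r_node := Suc (\<rho> r_node)))" if "v < 2 ^ W" for v
      using assms Box_child[OF node Box] that by (simp add: good_def)
    have c: "run m K i (\<rho>(r_aux := v, r_point := v, r_node := Suc (\<rho> r_node))) =
        win t (Suc (\<rho> r_node)) v (\<rho> r_val \<noteq> 0) (\<rho> r_fnode) (\<rho> r_flo) (\<rho> r_fhi) (\<rho> r_fthr)" if "v < 2 ^ W" for m v
      using K[OF g[OF that]] by (simp add: claim_def)
    show ?thesis
    proof (cases "\<rho> r_val = 0")
      case True
      let ?c = "If (TOp (Less r_aux r_point)) (Do (Copy r_point r_aux) ;; Do (Inc r_node)) Fail"
      have "run True (unfold_node # K) i \<rho> = quant True {..<2 ^ W} (\<lambda>v. run True (?c # K) i (\<rho>(r_aux := v)))"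
        using B s True by (simp add: unfold_node_def del: run_If(3))
      also have "\<dots> = quant True {..<2 ^ W} (\<lambda>v. v < \<rho> r_point \<and>
          win t (Suc (\<rho> r_node)) v False (\<rho> r_fnode) (\<rho> r_flo) (\<rho> r_fhi) (\<rho> r_fthr))"
        by (rule quant_cong) (use c pt True in auto)
      finally show ?thesis using Box True pt by (auto simp: quant_def)
    next
      case False
      let ?c = "If (TOp (Less r_aux r_point)) (Do (Copy r_point r_aux) ;; Do (Inc r_node)) Succeed"
      have "run True (unfold_node # K) i \<rho> = quant False {..<2 ^ W} (\<lambda>v. run False (?c # K) i (\<rho>(r_aux := v)))"
        using B s False by (simp add: unfold_node_def del: run_If(3))
      also have "\<dots> = quant False {..<2 ^ W} (\<lambda>v. v < \<rho> r_point \<longrightarrow>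
          win t (Suc (\<rho> r_node)) v True (\<rho> r_fnode) (\<rho> r_flo) (\<rho> r_fhi) (\<rho> r_fthr))"
        by (rule quant_cong) (use c pt False in auto)
      finally show ?thesis using Box False pt by (auto simp: quant_def)
    qed
  next
    case (Imp \<phi> \<psi>)
    note ch = Imp_child[OF node Imp]
    have s: "scan x (\<rho> r_node) = Sym SImp" using sc Imp by simp
    let ?\<rho> = "\<rho>(r_node := Suc (\<rho> r_node))"
    let ?left = "If (TOp (NZ r_val)) (Do (Zero_op r_val)) (Do (Inc r_val))"
    let ?right = "Do (Copy r_pos r_node) ;; parse ;; Do (Copy r_node r_pos)"
    have L: "run m (?left # K) i (?\<rho>(r_coin := v)) =
        win t (Suc (\<rho> r_node)) (\<rho> r_point) (\<not> \<rho> r_val \<noteq> 0) (\<rho> r_fnode) (\<rho> r_flo) (\<rho> r_fhi) (\<rho> r_fthr)" for m v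
    proof (cases "\<rho> r_val = 0")
      case True
      have "good (\<rho>(r_node := Suc (\<rho> r_node), r_coin := v, r_val := Suc 0))"
        using assms ch by (simp add: good_def)
      from K[OF this] True show ?thesis by (simp add: claim_def)
    next
      case False
      have "good (\<rho>(r_node := Suc (\<rho> r_node), r_coin := v, r_val := 0))"
        using assms ch by (simp add: good_def)
      from K[OF this] False B show ?thesis by (simp add: claim_def)
    qed
    have R: "run m (?right # K) i (?\<rho>(r_coin := v)) =
        win t (rt (\<rho> r_node)) (\<rho> r_point) (\<rho> r_val \<noteq> 0) (\<rho> r_fnode) (\<rho> r_flo) (\<rho> r_fhi) (\<rho> r_fthr)" for m v
    proof -
      let ?\<rho>' = "?\<rho>(r_coin := v, r_pos := Suc (\<rho> r_node))"
      have "Suc (\<rho> r_node) \<in> nodes" using ch by simp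
      then obtain zs where z: "form (Suc (\<rho> r_node)) \<in> PrL0"
        "suf (Suc (\<rho> r_node)) = enc_fm (form (Suc (\<rho> r_node))) @ zs" "Suc (\<rho> r_node) \<le> length x"
        using node_form nodes_length by metis
      have u: "\<phi> = form (Suc (\<rho> r_node))" if "\<phi> \<in> PrL0" "suf (Suc (\<rho> r_node)) = enc_fm \<phi> @ zs" for \<phi> zs
        using form_eq[OF that] by simp
      have "run m (?right # K) i (?\<rho>(r_coin := v)) = run m (parse # Do (Copy r_node r_pos) # K) i ?\<rho>'"
        by simp
      also have "\<dots> = run m (Do (Copy r_node r_pos) # K) i
          (?\<rho>'(r_pos := rt (\<rho> r_node), r_cnt := 0))"
        using z u by (subst run_parse) (auto simp: rt_def)
      also have "\<dots> = run m K i (?\<rho>'(r_pos := rt (\<rho> r_node), r_cnt := 0, r_node := rt (\<rho> r_node)))"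
        by simp
      also have "\<dots> = claim t (?\<rho>'(r_pos := rt (\<rho> r_node), r_cnt := 0, r_node := rt (\<rho> r_node)))"
        using assms ch by (intro K) (simp add: good_def)
      finally show ?thesis by (simp add: claim_def)
    qed
    have "run True (unfold_node # K) i \<rho> = run (\<rho> r_val \<noteq> 0) (choice ?left ?right # K) i ?\<rho>"
      using B s by (cases "\<rho> r_val = 0") (simp_all add: unfold_node_def)
    also note run_choice[where m = "\<rho> r_val \<noteq> 0", OF L R]
    finally show ?thesis using Imp by auto
  qed
qed

lemma run_cut_check:
  assumes "good \<rho>" and b: "\<rho> r_cnode < 2 ^ W" "\<rho> r_clo < 2 ^ W" "\<rho> r_chi < 2 ^ W" "\<rho> r_cthr < 2 ^ W"
  shows "run True (cut_check # K) i \<rho> \<longleftrightarrow> \<rho> r_cnode \<in> nodes \<and>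
    win t (\<rho> r_node) (\<rho> r_point) (\<rho> r_val \<noteq> 0) (\<rho> r_cnode) (\<rho> r_clo) (\<rho> r_chi) (\<rho> r_cthr) \<and>
    (\<forall>j<2 ^ W. \<rho> r_clo \<le> j \<and> j \<le> \<rho> r_chi \<longrightarrow>
      win t (\<rho> r_cnode) j (j < \<rho> r_cthr) (\<rho> r_fnode) (\<rho> r_flo) (\<rho> r_fhi) (\<rho> r_fthr))"
proof -
  note B = good_bounds[OF assms(1)]
  have e: "\<rho> r_end = Suc (length (enc_fm \<phi>\<^sub>0))" using assms(1) by (simp add: good_def)
  show ?thesis
  proof (cases "\<rho> r_cnode \<in> nodes")
    case False
    then have "\<rho> r_cnode = 0 \<or> \<not> \<rho> r_cnode < \<rho> r_end" by (auto simp: nodes_def e)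
    then show ?thesis using b B False by (auto simp: cut_check_def)
  next
    case True
    then have n: "\<rho> r_cnode \<noteq> 0" "\<rho> r_cnode < \<rho> r_end" by (auto simp: nodes_def e)
    have L: "run m (take_fact # K) i (\<rho>(r_coin := v)) =
        win t (\<rho> r_node) (\<rho> r_point) (\<rho> r_val \<noteq> 0) (\<rho> r_cnode) (\<rho> r_clo) (\<rho> r_chi) (\<rho> r_cthr)" for m v
    proof -
      have "good (\<rho>(r_coin := v, r_fnode := \<rho> r_cnode, r_flo := \<rho> r_clo, r_fhi := \<rho> r_chi, r_fthr := \<rho> r_cthr))"
        using assms by (simp add: good_def)
      from K[OF this] show ?thesis by (simp add: take_fact_def claim_def)
    qed
    have R: "run False (challenge_fact # K) i (\<rho>(r_coin := v)) = (\<forall>j<2 ^ W. \<rho> r_clo \<le> j \<and> j \<le> \<rho> r_chi \<longrightarrow>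
        win t (\<rho> r_cnode) j (j < \<rho> r_cthr) (\<rho> r_fnode) (\<rho> r_flo) (\<rho> r_fhi) (\<rho> r_fthr))" for v
    proof -
      have g: "good (\<rho>(r_coin := v, r_point := j, r_node := \<rho> r_cnode, r_val := 0))"
        "good (\<rho>(r_coin := v, r_point := j, r_node := \<rho> r_cnode, r_val := Suc 0))" if "j < 2 ^ W" for j
        using assms True that by (simp_all add: good_def)
      let ?K = "(If (TOp (Less r_chi r_point)) Succeed Skip ;; Do (Copy r_node r_cnode) ;;
        Do (Zero_op r_val) ;; If (TOp (Less r_point r_cthr)) (Do (Inc r_val)) Skip) # K"
      have "run False (challenge_fact # K) i (\<rho>(r_coin := v)) = quant False {..<2 ^ W} (\<lambda>j.
          run False (If (TOp (Less r_point r_clo)) Succeed Skip # ?K) i (\<rho>(r_coin := v, r_point := j)))"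
        by (simp add: challenge_fact_def del: run_If)
      also have "\<dots> = quant False {..<2 ^ W} (\<lambda>j. \<rho> r_clo \<le> j \<and> j \<le> \<rho> r_chi \<longrightarrow>
          win t (\<rho> r_cnode) j (j < \<rho> r_cthr) (\<rho> r_fnode) (\<rho> r_flo) (\<rho> r_fhi) (\<rho> r_fthr))"
      proof (rule quant_cong)
        fix j :: nat assume "j \<in> {..<2 ^ W}"
        then have j: "j < 2 ^ W" by simp
        from K[OF g(1)[OF j]] K[OF g(2)[OF j]] j b
        show "run False (If (TOp (Less r_point r_clo)) Succeed Skip # ?K) i (\<rho>(r_coin := v, r_point := j)) =
          (\<rho> r_clo \<le> j \<and> j \<le> \<rho> r_chi \<longrightarrow>
          win t (\<rho> r_cnode) j (j < \<rho> r_cthr) (\<rho> r_fnode) (\<rho> r_flo) (\<rho> r_fhi) (\<rho> r_fthr))"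
          by (cases "j < \<rho> r_clo"; cases "\<rho> r_chi < j"; cases "j < \<rho> r_cthr") (simp_all add: claim_def)
      qed
      finally show ?thesis by (simp add: quant_def Ball_def)
    qed
    have "run True (cut_check # K) i \<rho> = run False (choice take_fact challenge_fact # K) i \<rho>"
      using b B n by (simp add: cut_check_def)
    also note run_choice[where m = False, OF L R]
    finally show ?thesis using True by simp
  qed
qed

lemma run_cut:
  assumes "good \<rho>"
  shows "run True (cut # K) i \<rho> \<longleftrightarrow> (\<exists>c\<in>nodes. \<exists>lo<2 ^ W. \<exists>hi<2 ^ W. \<exists>v<2 ^ W.
     win t (\<rho> r_node) (\<rho> r_point) (\<rho> r_val \<noteq> 0) c lo hi v \<and>
     (\<forall>j<2 ^ W. lo \<le> j \<and> j \<le> hi \<longrightarrow> win t c j (j < v) (\<rho> r_fnode) (\<rho> r_flo) (\<rho> r_fhi) (\<rho> r_fthr)))"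
proof -
  let ?P = "\<lambda>c lo hi v. win t (\<rho> r_node) (\<rho> r_point) (\<rho> r_val \<noteq> 0) c lo hi v \<and>
     (\<forall>j<2 ^ W. lo \<le> j \<and> j \<le> hi \<longrightarrow> win t c j (j < v) (\<rho> r_fnode) (\<rho> r_flo) (\<rho> r_fhi) (\<rho> r_fthr))"
  let ?\<rho> = "\<lambda>c lo hi v. \<rho>(r_cnode := c, r_clo := lo, r_chi := hi, r_cthr := v)"
  have *: "run True (cut_check # K) i (?\<rho> c lo hi v) = (c \<in> nodes \<and> ?P c lo hi v)"
    if "c < 2 ^ W" "lo < 2 ^ W" "hi < 2 ^ W" "v < 2 ^ W" for c lo hi v
  proof -
    have "good (?\<rho> c lo hi v)" using assms by (simp add: good_def)
    from run_cut_check[OF this] that show ?thesis by simp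
  qed
  have "run True (cut # K) i \<rho> = quant True {..<2 ^ W} (\<lambda>c. quant True {..<2 ^ W} (\<lambda>lo.
      quant True {..<2 ^ W} (\<lambda>hi. quant True {..<2 ^ W} (\<lambda>v. run True (cut_check # K) i (?\<rho> c lo hi v)))))"
    by (simp add: cut_def)
  also have "\<dots> = quant True {..<2 ^ W} (\<lambda>c. quant True {..<2 ^ W} (\<lambda>lo.
      quant True {..<2 ^ W} (\<lambda>hi. quant True {..<2 ^ W} (\<lambda>v. c \<in> nodes \<and> ?P c lo hi v))))"
    by (intro quant_cong *) auto
  also have "\<dots> \<longleftrightarrow> (\<exists>c\<in>nodes. \<exists>lo<2 ^ W. \<exists>hi<2 ^ W. \<exists>v<2 ^ W. ?P c lo hi v)"
    using V_bound by (simp add: quant_def Bex_def) (meson greaterThanLessThan_iff subsetD)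
  finally show ?thesis .
qed

end

lemma good_coin: "good (\<rho>(r_coin := v)) = good \<rho>"
  by (simp add: good_def)

lemma run_round:
  assumes K: "\<And>\<rho>. good \<rho> \<Longrightarrow> run True K i \<rho> = claim t \<rho>" and g: "good \<rho>"
  shows "run True (game_round # K) i \<rho> = claim (Suc t) \<rho>"
proof -
  let ?K = "Switch True # K"
  \<comment> \<open>The \<open>Switch True\<close> that closes a round absorbs the mode in which the
    round ended.\<close>
  have K': "run m ?K i \<rho> = claim t \<rho>" if "good \<rho>" for m \<rho>
    using K[OF that] by simp
  have g': "good (\<rho>(r_coin := v))" "good (\<rho>(r_coin := v, r_coin := w))" for v w
    using g by (simp_all only: good_coin)
  let ?F = "\<rho> r_node = \<rho> r_fnode \<and> \<rho> r_flo \<le> \<rho> r_point \<and> \<rho> r_point \<le> \<rho> r_fhi \<and>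
    (\<rho> r_val \<noteq> 0) = (\<rho> r_point < \<rho> r_fthr)"
  let ?U = "unfolds (\<lambda>r j b. win t r j b (\<rho> r_fnode) (\<rho> r_flo) (\<rho> r_fhi) (\<rho> r_fthr))
    (\<rho> r_node) (\<rho> r_point) (\<rho> r_val \<noteq> 0)"
  let ?C = "\<exists>c\<in>nodes. \<exists>lo<2 ^ W. \<exists>hi<2 ^ W. \<exists>v<2 ^ W.
     win t (\<rho> r_node) (\<rho> r_point) (\<rho> r_val \<noteq> 0) c lo hi v \<and>
     (\<forall>j<2 ^ W. lo \<le> j \<and> j \<le> hi \<longrightarrow> win t c j (j < v) (\<rho> r_fnode) (\<rho> r_flo) (\<rho> r_fhi) (\<rho> r_fthr))"
  have f: "run True (use_fact # ?K) i (\<rho>(r_coin := v, r_coin := w)) = ?F" for v w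
    using run_use_fact[OF g'(2)[of v w], of True ?K i] by simp
  have u: "run True (unfold_node # ?K) i (\<rho>(r_coin := v, r_coin := w)) = ?U" for v w
    using run_unfold_node[OF K' g'(2)[of v w]] by simp
  have inner: "run True (choice use_fact unfold_node # ?K) i (\<rho>(r_coin := v)) = (?F \<or> ?U)" for v
    using run_choice[where m = True and \<rho> = "\<rho>(r_coin := v)", OF f u] by simp
  have c: "run True (cut # ?K) i (\<rho>(r_coin := v)) = ?C" for v
    using run_cut[OF K' g'(1)[of v]] by simp
  have outer: "run True (choice (choice use_fact unfold_node) cut # ?K) i \<rho> = ((?F \<or> ?U) \<or> ?C)"
    using run_choice[where m = True, OF inner c] by simp
  have "run True (game_round # K) i \<rho> = run True (choice (choice use_fact unfold_node) cut # ?K) i \<rho>"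
    by (simp add: game_round_def)
  then show ?thesis unfolding outer claim_def win.simps(2) by simp
qed

lemma run_iter:
  assumes "\<And>\<rho>. good \<rho> \<Longrightarrow> run True K i \<rho> = claim t \<rho>" "good \<rho>"
  shows "run True (iter n game_round # K) i \<rho> = claim (n + t) \<rho>"
  using assms(2)
proof (induction n arbitrary: \<rho>)
  case 0
  then show ?case using assms(1) by simp
next
  case (Suc n)
  have "run True (game_round # iter n game_round # K) i \<rho> = claim (Suc (n + t)) \<rho>"
    using Suc by (intro run_round) auto
  then show ?case by simp
qed

lemma run_play_loop:
  assumes "i \<le> W" "good \<rho>"
  shows "run True (While (TOp Pop) (iter 8 game_round) # Fail # K) i \<rho> = claim (8 * i) \<rho>"
  using assms
proof (induction i arbitrary: \<rho>)
  case 0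
  then show ?case by (simp add: run_While_Pop claim_def)
next
  case (Suc i)
  have "run True (While (TOp Pop) (iter 8 game_round) # Fail # K) (Suc i) \<rho> =
      run True (iter 8 game_round # While (TOp Pop) (iter 8 game_round) # Fail # K) i \<rho>"
    using Suc.prems(1) by (rule run_While_Pop)
  also have "\<dots> = claim (8 + 8 * i) \<rho>"
    using Suc by (intro run_iter) auto
  finally show ?case by simp
qed

lemma run_play:
  assumes "good \<rho>" "\<rho> r_point \<le> top" "\<rho> r_fnode = 0"
  shows "run True (play # K) W \<rho> \<longleftrightarrow> lsat (\<rho> r_point) (form (\<rho> r_node)) = (\<rho> r_val \<noteq> 0)"
proof -
  have n: "\<rho> r_node \<in> nodes" using assms(1) by (simp add: good_def)
  then obtain zs where z: "form (\<rho> r_node) \<in> PrL0" "drop (\<rho> r_node - 1) (enc_fm \<phi>\<^sub>0) = enc_fm (form (\<rho> r_node)) @ zs"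
    using node_form by metis
  have "length (enc_fm (form (\<rho> r_node))) \<le> length (enc_fm \<phi>\<^sub>0)"
    using arg_cong[OF z(2), of length] by simp
  also have "\<dots> < 2 ^ W" using W by (simp add: x_eq)
  finally have "fsize (form (\<rho> r_node)) < 2 ^ W" using length_enc_fm z(1) by simp
  moreover have "\<rho> r_fnode \<notin> nodes" using assms(3) by (simp add: nodes_def)
  ultimately show ?thesis
    using run_play_loop[OF order_refl assms(1), of K] win_iff_lsat[OF n assms(2)]
    by (simp add: play_def claim_def)
qed

end

subsection \<open>Reading the input\<close>

abbreviation (input) "r_size \<equiv> 3 :: nat"
abbreviation (input) "r_cur \<equiv> 4 :: nat"
abbreviation (input) "r_t1 \<equiv> 5 :: nat"
abbreviation (input) "r_t2 \<equiv> 6 :: nat"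
abbreviation (input) "r_world \<equiv> 7 :: nat"
abbreviation (input) "r_rank \<equiv> 8 :: nat"
abbreviation (input) "r_ctr \<equiv> 9 :: nat"
abbreviation (input) "r_a \<equiv> 10 :: nat"
abbreviation (input) "r_b \<equiv> 11 :: nat"
abbreviation (input) "r_c \<equiv> 12 :: nat"

definition read_row :: com where
  "read_row = expect r_pos (map Sym [Sep]) ;; Do (Copy r_t2 r_size) ;;
     Repeat r_t2 (expect r_pos (map Sym [Zero, One]))"

definition read_world :: com where
  "read_world = expect r_pos (map Sym [Sep]) ;; Do (Guess r_world) ;; Do (Copy r_t1 r_world) ;;
     Repeat r_t1 (expect r_pos (map Sym [One])) ;; If_at r_pos [RightEnd] Skip Fail ;;
     If (TOp (Less r_world r_size)) Skip Fail"

text \<open>The size is guessed and confirmed by reading that many rows of that length, which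
  replaces any counting of rows and columns. All these guesses are existential and add no
  alternation.\<close>

definition read_input :: com where
  "read_input = Do (Zero_op r_pos) ;; Do (Inc r_pos) ;; parse ;; Do (Copy r_end r_pos) ;;
     Do (Guess r_size) ;; Do (Zero_op r_t2) ;; Do (Copy r_t1 r_size) ;; Repeat r_t1 read_row ;; read_world"

text \<open>The syntactic part of being an instance; whether the matrix is transitive and
  irreflexive is left to a separate check.\<close>

definition is_input :: "sym list \<Rightarrow> fm \<Rightarrow> sym list list \<Rightarrow> nat \<Rightarrow> bool" where
  "is_input x \<phi> rows s \<longleftrightarrow> \<phi> \<in> PrL0 \<and> s < length rows \<and>
     (\<forall>ys\<in>set rows. length ys = length rows \<and> set ys \<subseteq> {Zero, One}) \<and>
     x = enc_fm \<phi> @ concat (map ((#) Sep) rows) @ Sep # replicate s One"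

context program_run
begin

lemma suf_append:
  assumes "suf q = ys @ zs" "0 < q" "q \<le> length x + 1"
  shows "suf (q + length ys) = zs" "q + length ys \<le> length x + 1"
proof -
  have "q + length ys - 1 = length ys + (q - 1)" using assms(2) by simp
  then have "suf (q + length ys) = drop (length ys) (suf q)"
    unfolding suf_def drop_drop by (simp only: add.commute)
  then show "suf (q + length ys) = zs" unfolding assms(1) by simp
  have "length x - (q - 1) = length ys + length zs"
    using arg_cong[OF assms(1), of length] unfolding suf_def by simp
  then show "q + length ys \<le> length x + 1" using assms(2,3) by linarith
qed

lemma run_read_rows:
  assumes "0 < \<rho> r_pos" "\<rho> r_pos \<le> length x + 1" "\<rho> r_t1 < 2 ^ W" "\<rho> r_size < 2 ^ W" "\<rho> r_t2 = 0"
  shows "run m (Repeat r_t1 read_row # K) i \<rho> \<longleftrightarrow> (\<exists>rows zs.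
    suf (\<rho> r_pos) = concat (map ((#) Sep) rows) @ zs \<and> length rows = \<rho> r_t1 \<and>
    (\<forall>ys\<in>set rows. length ys = \<rho> r_size \<and> set ys \<subseteq> {Zero, One}) \<and>
    run m K i (\<rho>(r_pos := \<rho> r_pos + \<rho> r_t1 * Suc (\<rho> r_size), r_t1 := 0)))"
  using assms
proof (induction "\<rho> r_t1" arbitrary: \<rho>)
  case 0
  then show ?case by (simp add: run_Repeat fun_upd_idem)
next
  case (Suc n)
  let ?S = "\<rho> r_size"
  let ?q = "\<rho> r_pos"
  let ?\<rho>1 = "\<rho>(r_t1 := n)"
  let ?\<rho>2 = "\<rho>(r_t1 := n, r_pos := Suc ?q, r_t2 := ?S)"
  let ?\<rho>3 = "\<rho>(r_t1 := n, r_pos := Suc ?q + ?S)"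
  let ?final = "run m K i (\<rho>(r_pos := ?q + \<rho> r_t1 * Suc ?S, r_t1 := 0))"
  have t1: "\<rho> r_t1 = Suc n" using Suc.hyps(2) by simp
  have tail: "run m (Repeat r_t1 read_row # K) i ?\<rho>3 \<longleftrightarrow> (\<exists>rows us. zs = concat (map ((#) Sep) rows) @ us \<and>
      length rows = n \<and> (\<forall>ys\<in>set rows. length ys = ?S \<and> set ys \<subseteq> {Zero, One}) \<and> ?final)"
    if s: "suf ?q = Sep # ys @ zs" and l: "length ys = ?S" for ys zs
  proof -
    have q: "suf (Suc ?q + ?S) = zs" "Suc ?q + ?S \<le> length x + 1"
      using suf_append[of ?q "Sep # ys" zs] s l Suc.prems by auto
    have e: "?\<rho>3(r_pos := ?\<rho>3 r_pos + ?\<rho>3 r_t1 * Suc (?\<rho>3 r_size), r_t1 := 0) =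
        \<rho>(r_pos := ?q + \<rho> r_t1 * Suc ?S, r_t1 := 0)"
      by (auto simp: fun_eq_iff t1)
    have "run m (Repeat r_t1 read_row # K) i ?\<rho>3 \<longleftrightarrow> (\<exists>rows us.
      suf (?\<rho>3 r_pos) = concat (map ((#) Sep) rows) @ us \<and> length rows = ?\<rho>3 r_t1 \<and>
      (\<forall>ys\<in>set rows. length ys = ?\<rho>3 r_size \<and> set ys \<subseteq> {Zero, One}) \<and>
      run m K i (?\<rho>3(r_pos := ?\<rho>3 r_pos + ?\<rho>3 r_t1 * Suc (?\<rho>3 r_size), r_t1 := 0)))"
      using Suc.prems Suc.hyps(2) q by (intro Suc.hyps(1)) auto
    then show ?thesis unfolding e using q by simp
  qed
  have "run m (Repeat r_t1 read_row # K) i \<rho> =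
      run m (expect r_pos (map Sym [Sep]) # (Do (Copy r_t2 r_size) ;;
        Repeat r_t2 (expect r_pos (map Sym [Zero, One]))) # Repeat r_t1 read_row # K) i ?\<rho>1"
    using Suc.prems t1 by (subst run_Repeat) (simp_all add: read_row_def del: list.map)
  also have "\<dots> \<longleftrightarrow> (\<exists>ws. suf ?q = Sep # ws \<and>
      run m (Repeat r_t2 (expect r_pos (map Sym [Zero, One])) # Repeat r_t1 read_row # K) i ?\<rho>2)"
    using Suc.prems by (subst run_expect) (auto simp del: list.map)
  also have "\<dots> \<longleftrightarrow> (\<exists>ys zs. suf ?q = Sep # ys @ zs \<and> length ys = ?S \<and> set ys \<subseteq> {Zero, One} \<and>
      run m (Repeat r_t1 read_row # K) i ?\<rho>3)"
  proof -
    have *: "run m (Repeat r_t2 (expect r_pos (map Sym [Zero, One])) # Repeat r_t1 read_row # K) i ?\<rho>2 \<longleftrightarrow>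
      (\<exists>ys zs. ws = ys @ zs \<and> length ys = ?S \<and> set ys \<subseteq> {Zero, One} \<and> run m (Repeat r_t1 read_row # K) i ?\<rho>3)"
      if s: "suf ?q = Sep # ws" for ws
    proof -
      have q: "suf (Suc ?q) = ws" "?q \<le> length x" using suf_Suc[OF Suc.prems(1) s] by auto
      have e: "?\<rho>2(r_pos := ?\<rho>2 r_pos + ?\<rho>2 r_t2, r_t2 := 0) = ?\<rho>3"
        using Suc.prems(5) by (auto simp: fun_eq_iff)
      have "run m (Repeat r_t2 (expect r_pos (map Sym [Zero, One])) # Repeat r_t1 read_row # K) i ?\<rho>2 \<longleftrightarrow>
        (\<exists>ys zs. suf (?\<rho>2 r_pos) = ys @ zs \<and> length ys = ?\<rho>2 r_t2 \<and> set ys \<subseteq> set [Zero, One] \<and>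
          run m (Repeat r_t1 read_row # K) i (?\<rho>2(r_pos := ?\<rho>2 r_pos + ?\<rho>2 r_t2, r_t2 := 0)))"
        using Suc.prems q by (intro run_Repeat_expect) auto
      then show ?thesis unfolding e using q by simp
    qed
    show ?thesis
    proof (intro iffI; elim exE conjE)
      fix ws assume ws: "suf ?q = Sep # ws"
        "run m (Repeat r_t2 (expect r_pos (map Sym [Zero, One])) # Repeat r_t1 read_row # K) i ?\<rho>2"
      then obtain ys zs where "ws = ys @ zs" "length ys = ?S" "set ys \<subseteq> {Zero, One}"
        "run m (Repeat r_t1 read_row # K) i ?\<rho>3"
        using *[OF ws(1)] by (elim iffE) (drule mp, assumption, elim exE conjE, rule that)
      with ws(1) show "\<exists>ys zs. suf ?q = Sep # ys @ zs \<and> length ys = ?S \<and> set ys \<subseteq> {Zero, One} \<and>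
          run m (Repeat r_t1 read_row # K) i ?\<rho>3"
        by (intro exI[of _ ys] exI[of _ zs]) simp
    next
      fix ys zs assume ys: "suf ?q = Sep # ys @ zs" "length ys = ?S" "set ys \<subseteq> {Zero, One}"
        "run m (Repeat r_t1 read_row # K) i ?\<rho>3"
      show "\<exists>ws. suf ?q = Sep # ws \<and>
          run m (Repeat r_t2 (expect r_pos (map Sym [Zero, One])) # Repeat r_t1 read_row # K) i ?\<rho>2"
        using ys(1) *[OF ys(1)] ys by (intro exI[of _ "ys @ zs"] conjI; simp only:) blast
    qed
  qed
  also have "\<dots> \<longleftrightarrow> (\<exists>rows zs. suf ?q = concat (map ((#) Sep) rows) @ zs \<and> length rows = \<rho> r_t1 \<and>
    (\<forall>ys\<in>set rows. length ys = ?S \<and> set ys \<subseteq> {Zero, One}) \<and> ?final)" (is "?L \<longleftrightarrow> ?R")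
  proof
    assume ?L
    then obtain ys zs where 1: "suf ?q = Sep # ys @ zs" "length ys = ?S" "set ys \<subseteq> {Zero, One}"
      "run m (Repeat r_t1 read_row # K) i ?\<rho>3" by blast
    with tail[OF 1(1,2)] obtain rows us where "zs = concat (map ((#) Sep) rows) @ us"
      "length rows = n" "\<forall>ys\<in>set rows. length ys = ?S \<and> set ys \<subseteq> {Zero, One}" ?final by blast
    with 1 t1 show ?R by (intro exI[of _ "ys # rows"] exI[of _ us]) simp
  next
    assume ?R
    then obtain rows zs where 1: "suf ?q = concat (map ((#) Sep) rows) @ zs" "length rows = \<rho> r_t1"
      "\<forall>ys\<in>set rows. length ys = ?S \<and> set ys \<subseteq> {Zero, One}" ?final by blast
    then obtain ys rows' where rows: "rows = ys # rows'" using t1 by (cases rows) auto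
    have s: "suf ?q = Sep # ys @ (concat (map ((#) Sep) rows') @ zs)" "length ys = ?S" "set ys \<subseteq> {Zero, One}"
      using 1 rows by auto
    have "run m (Repeat r_t1 read_row # K) i ?\<rho>3"
      unfolding tail[OF s(1,2)] using 1 rows t1 by (intro exI[of _ rows'] exI[of _ zs]) simp
    with s show ?L by blast
  qed
  finally show ?case .
qed

lemma run_read_world:
  assumes "0 < \<rho> r_pos" "\<rho> r_pos \<le> length x + 1" "\<rho> r_size < 2 ^ W"
    and K: "\<And>s \<rho>'. \<rho>' r_end = \<rho> r_end \<Longrightarrow> \<rho>' r_size = \<rho> r_size \<Longrightarrow> \<rho>' r_world = s \<Longrightarrow> s < \<rho> r_size \<Longrightarrow>
      suf (\<rho> r_pos) = Sep # replicate s One \<Longrightarrow> run True K i \<rho>' = Q s"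
  shows "run True (read_world # K) i \<rho> \<longleftrightarrow> (\<exists>s<\<rho> r_size. suf (\<rho> r_pos) = Sep # replicate s One \<and> Q s)"
proof (cases "\<exists>ws. suf (\<rho> r_pos) = Sep # ws")
  case False
  then have "\<not> run True (read_world # K) i \<rho>"
    using assms(1,2) by (simp add: read_world_def run_expect del: list.map)
  with False show ?thesis by auto
next
  case True
  then obtain ws where ws: "suf (\<rho> r_pos) = Sep # ws" by blast
  have q: "suf (Suc (\<rho> r_pos)) = ws" "\<rho> r_pos \<le> length x" using suf_Suc[OF assms(1) ws] by auto
  let ?\<rho> = "\<lambda>s. \<rho>(r_pos := Suc (\<rho> r_pos), r_world := s, r_t1 := s)"
  let ?K = "(If_at r_pos [RightEnd] Skip Fail ;; If (TOp (Less r_world r_size)) Skip Fail) # K"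
  have *: "run True (Repeat r_t1 (expect r_pos (map Sym [One])) # ?K) i (?\<rho> s) \<longleftrightarrow>
      ws = replicate s One \<and> s < \<rho> r_size \<and> Q s" if s: "s < 2 ^ W" for s
  proof -
    let ?\<rho>' = "(?\<rho> s)(r_pos := ?\<rho> s r_pos + ?\<rho> s r_t1, r_t1 := 0)"
    have "run True (Repeat r_t1 (expect r_pos (map Sym [One])) # ?K) i (?\<rho> s) \<longleftrightarrow>
      (\<exists>ys zs. suf (?\<rho> s r_pos) = ys @ zs \<and> length ys = ?\<rho> s r_t1 \<and> set ys \<subseteq> set [One] \<and> run True ?K i ?\<rho>')"
      using s q assms(1) by (intro run_Repeat_expect) auto
    also have "\<dots> \<longleftrightarrow> (\<exists>zs. ws = replicate s One @ zs \<and> run True ?K i ?\<rho>')"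
    proof (intro iffI; elim exE conjE)
      fix ys zs
      assume *: "suf (?\<rho> s r_pos) = ys @ zs" "length ys = ?\<rho> s r_t1" "set ys \<subseteq> set [One]" "run True ?K i ?\<rho>'"
      then have "ys = replicate s One" by (intro replicate_eqI) auto
      with *(1) q have "ws = replicate s One @ zs" by simp
      with *(4) show "\<exists>zs. ws = replicate s One @ zs \<and> run True ?K i ?\<rho>'" by (intro exI[of _ zs] conjI)
    next
      fix zs assume *: "ws = replicate s One @ zs" "run True ?K i ?\<rho>'"
      show "\<exists>ys zs. suf (?\<rho> s r_pos) = ys @ zs \<and> length ys = ?\<rho> s r_t1 \<and> set ys \<subseteq> set [One] \<and> run True ?K i ?\<rho>'"
        by (rule exI[of _ "replicate s One"], rule exI[of _ zs]) (use * q in \<open>simp add: set_replicate_conv_if\<close>)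
    qed
    also have "\<dots> \<longleftrightarrow> ws = replicate s One \<and> s < \<rho> r_size \<and> Q s"
    proof -
      have "run True ?K i ?\<rho>' \<longleftrightarrow> zs = [] \<and> s < \<rho> r_size \<and> Q s" if zs: "ws = replicate s One @ zs" for zs
      proof -
        have 1: "suf (Suc (\<rho> r_pos) + s) = zs" "Suc (\<rho> r_pos) + s \<le> length x + 1"
          using suf_append[of "Suc (\<rho> r_pos)" "replicate s One" zs] q zs by auto
        then have b: "Suc (\<rho> r_pos) + s < 2 ^ W" using W by simp
        have "scan x (Suc (\<rho> r_pos) + s) = RightEnd \<longleftrightarrow> zs = []"
          using scan_suf[of "Suc (\<rho> r_pos) + s"] 1 by (cases zs) auto
        moreover have "run True K i ?\<rho>' = Q s" if "zs = []" "s < \<rho> r_size"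
          using that zs ws by (intro K) auto
        ultimately show ?thesis using b s assms(3)
          by (cases "zs = []"; cases "s < \<rho> r_size") simp_all
      qed
      then show ?thesis by auto
    qed
    finally show ?thesis .
  qed
  have "run True (read_world # K) i \<rho> = quant True {..<2 ^ W} (\<lambda>s.
      run True (Repeat r_t1 (expect r_pos (map Sym [One])) # ?K) i (?\<rho> s))"
    using assms(1,2) ws by (simp add: read_world_def run_expect del: list.map run_If run_If_at)
  also have "\<dots> = quant True {..<2 ^ W} (\<lambda>s. ws = replicate s One \<and> s < \<rho> r_size \<and> Q s)"
    by (rule quant_cong) (use * in auto)
  finally show ?thesis using assms(3) ws by (auto simp: quant_def)
qed

lemma run_read_input:
  assumes K: "\<And>\<phi> rows s \<rho>. is_input x \<phi> rows s \<Longrightarrow> \<rho> r_end = Suc (length (enc_fm \<phi>)) \<Longrightarrow>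
    \<rho> r_size = length rows \<Longrightarrow> \<rho> r_world = s \<Longrightarrow> run True K i \<rho> = Q \<phi> rows s"
  shows "run True (read_input # K) i \<rho> \<longleftrightarrow> (\<exists>\<phi> rows s. is_input x \<phi> rows s \<and> Q \<phi> rows s)"
proof -
  let ?l = "\<lambda>\<phi>. Suc (length (enc_fm \<phi>))"
  let ?\<rho>1 = "\<lambda>\<phi>. \<rho>(r_pos := ?l \<phi>, r_cnt := 0, r_end := ?l \<phi>)"
  let ?\<rho>2 = "\<lambda>\<phi> n. (?\<rho>1 \<phi>)(r_size := n, r_t2 := 0, r_t1 := n)"
  have s1: "suf (Suc 0) = x" by (simp add: suf_def)
  have "run True (read_input # K) i \<rho> \<longleftrightarrow> (\<exists>\<phi>\<in>PrL0. \<exists>zs. x = enc_fm \<phi> @ zs \<and>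
      quant True {..<2 ^ W} (\<lambda>n. run True (Repeat r_t1 read_row # read_world # K) i (?\<rho>2 \<phi> n)))"
    by (simp add: read_input_def run_parse s1)
  also have "\<dots> \<longleftrightarrow> (\<exists>\<phi>\<in>PrL0. \<exists>zs. x = enc_fm \<phi> @ zs \<and> quant True {..<2 ^ W} (\<lambda>n. \<exists>rows us.
      zs = concat (map ((#) Sep) rows) @ us \<and> length rows = n \<and>
      (\<forall>ys\<in>set rows. length ys = n \<and> set ys \<subseteq> {Zero, One}) \<and>
      (\<exists>s<n. us = Sep # replicate s One \<and> Q \<phi> rows s)))"
  proof (intro bex_cong ex_cong1 conj_cong refl quant_cong)
    fix \<phi> zs n assume \<phi>: "\<phi> \<in> PrL0" and x: "x = enc_fm \<phi> @ zs" and n: "n \<in> {..<2 ^ W :: nat}"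
    let ?r = "?\<rho>2 \<phi> n"
    have l: "?l \<phi> \<le> length x + 1" by (subst x) simp
    have sl: "suf (?l \<phi>) = zs" using suf_append(1)[of "Suc 0" "enc_fm \<phi>" zs] s1 x by simp
    let ?r' = "?r(r_pos := ?r r_pos + ?r r_t1 * Suc (?r r_size), r_t1 := 0)"
    have "run True (Repeat r_t1 read_row # read_world # K) i ?r \<longleftrightarrow> (\<exists>rows us.
      suf (?r r_pos) = concat (map ((#) Sep) rows) @ us \<and> length rows = ?r r_t1 \<and>
      (\<forall>ys\<in>set rows. length ys = ?r r_size \<and> set ys \<subseteq> {Zero, One}) \<and> run True (read_world # K) i ?r')"
      using l n by (intro run_read_rows) auto
    also have "\<dots> \<longleftrightarrow> (\<exists>rows us. zs = concat (map ((#) Sep) rows) @ us \<and> length rows = n \<and>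
      (\<forall>ys\<in>set rows. length ys = n \<and> set ys \<subseteq> {Zero, One}) \<and> run True (read_world # K) i ?r')"
      using sl by simp
    also have "\<dots> \<longleftrightarrow> (\<exists>rows us. zs = concat (map ((#) Sep) rows) @ us \<and> length rows = n \<and>
      (\<forall>ys\<in>set rows. length ys = n \<and> set ys \<subseteq> {Zero, One}) \<and>
      (\<exists>s<n. us = Sep # replicate s One \<and> Q \<phi> rows s))"
    proof (intro ex_cong1 conj_cong refl)
      fix rows us
      assume z: "zs = concat (map ((#) Sep) rows) @ us" and lr: "length rows = n"
        and rows: "\<forall>ys\<in>set rows. length ys = n \<and> set ys \<subseteq> {Zero, One}"
      have len: "length (concat (map ((#) Sep) rows)) = n * Suc n"
      proof -
        have "length (concat (map ((#) Sep) rows')) = length rows' * Suc n"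
          if "\<forall>ys\<in>set rows'. length ys = n" for rows'
          using that by (induction rows') auto
        then show ?thesis using rows lr by blast
      qed
      have q: "suf (?l \<phi> + n * Suc n) = us" "?l \<phi> + n * Suc n \<le> length x + 1"
        using suf_append[of "?l \<phi>" "concat (map ((#) Sep) rows)" us] sl z l unfolding len by auto
      have "run True (read_world # K) i ?r' \<longleftrightarrow>
          (\<exists>s<?r' r_size. suf (?r' r_pos) = Sep # replicate s One \<and> Q \<phi> rows s)"
      proof (rule run_read_world)
        fix s \<rho>' assume "\<rho>' r_end = ?r' r_end" "\<rho>' r_size = ?r' r_size" "\<rho>' r_world = s" "s < ?r' r_size"
          "suf (?r' r_pos) = Sep # replicate s One"
        moreover from this have "is_input x \<phi> rows s"
          unfolding is_input_def using \<phi> x z lr rows q by simp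
        ultimately show "run True K i \<rho>' = Q \<phi> rows s" using lr by (intro K) auto
      qed (use n q in auto)
      then show "run True (read_world # K) i ?r' \<longleftrightarrow> (\<exists>s<n. us = Sep # replicate s One \<and> Q \<phi> rows s)"
        using q by simp
    qed
    finally show "run True (Repeat r_t1 read_row # read_world # K) i ?r \<longleftrightarrow> (\<exists>rows us.
      zs = concat (map ((#) Sep) rows) @ us \<and> length rows = n \<and>
      (\<forall>ys\<in>set rows. length ys = n \<and> set ys \<subseteq> {Zero, One}) \<and>
      (\<exists>s<n. us = Sep # replicate s One \<and> Q \<phi> rows s))" .
  qed
  also have "\<dots> \<longleftrightarrow> (\<exists>\<phi> rows s. is_input x \<phi> rows s \<and> Q \<phi> rows s)" (is "?L \<longleftrightarrow> ?R")
  proof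
    assume ?L
    then obtain \<phi> zs n rows us s where "\<phi> \<in> PrL0" "x = enc_fm \<phi> @ zs" "zs = concat (map ((#) Sep) rows) @ us"
      "length rows = n" "\<forall>ys\<in>set rows. length ys = n \<and> set ys \<subseteq> {Zero, One}" "s < n"
      "us = Sep # replicate s One" "Q \<phi> rows s"
      unfolding quant_def if_True by (elim bexE exE conjE) (rule that)
    then show ?R by (intro exI[of _ \<phi>] exI[of _ rows] exI[of _ s]) (simp add: is_input_def)
  next
    assume ?R
    then obtain \<phi> rows s where i: "is_input x \<phi> rows s" and Q: "Q \<phi> rows s" by blast
    \<comment> \<open>Every row contributes at least its separator, so the correct size is within
      the range of the guess.\<close>
    have "length rows \<le> length (concat (map ((#) Sep) rows))" by (induction rows) auto
    then have "length rows \<le> length x" using i by (simp add: is_input_def)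
    then have "length rows \<in> {..<2 ^ W}" using W by simp
    moreover have "\<exists>rows' us. concat (map ((#) Sep) rows) @ Sep # replicate s One = concat (map ((#) Sep) rows') @ us \<and>
        length rows' = length rows \<and> (\<forall>ys\<in>set rows'. length ys = length rows \<and> set ys \<subseteq> {Zero, One}) \<and>
        (\<exists>s<length rows. us = Sep # replicate s One \<and> Q \<phi> rows' s)"
      using i Q unfolding is_input_def
      by (intro exI[of _ rows] exI[of _ "Sep # replicate s One"] conjI exI[of _ s]) simp_all
    ultimately have "quant True {..<2 ^ W} (\<lambda>n. \<exists>rows' us.
        concat (map ((#) Sep) rows) @ Sep # replicate s One = concat (map ((#) Sep) rows') @ us \<and>
        length rows' = n \<and> (\<forall>ys\<in>set rows'. length ys = n \<and> set ys \<subseteq> {Zero, One}) \<and>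
        (\<exists>s<n. us = Sep # replicate s One \<and> Q \<phi> rows' s))"
      unfolding quant_def if_True by (rule bexI[rotated])
    then show ?L using i unfolding is_input_def
      by (intro bexI[of _ \<phi>] exI[of _ "concat (map ((#) Sep) rows) @ Sep # replicate s One"] conjI) simp_all
  qed
  finally show ?thesis .
qed

end

subsection \<open>Checking the model\<close>

text \<open>Entry \<open>(a, b)\<close> of a matrix of size \<open>n\<close> stands at
  \<open>r_end + a * (n + 1) + 1 + b\<close>: a row takes \<open>n + 1\<close> symbols including its
  separator, and \<open>r_end\<close> is the position of the first separator. The product is formed
  by repeated increments.\<close>

definition lookup :: "nat \<Rightarrow> nat \<Rightarrow> com" where
  "lookup a b = Do (Copy r_cur r_end) ;; Do (Zero_op r_t2) ;; Do (Copy r_t1 a) ;;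
     Repeat r_t1 (Do (Copy r_t2 r_size) ;; Repeat r_t2 (Do (Inc r_cur)) ;; Do (Inc r_cur)) ;;
     Do (Inc r_cur) ;; Do (Copy r_t1 b) ;; Repeat r_t1 (Do (Inc r_cur))"

definition If_edge :: "nat \<Rightarrow> nat \<Rightarrow> com \<Rightarrow> com \<Rightarrow> com" where
  "If_edge a b c d = lookup a b ;; If_at r_cur [Sym One] c d"

definition check_order :: com where
  "check_order = Do (Guess r_a) ;; If (TOp (Less r_a r_size)) Skip Succeed ;;
     Do (Guess r_b) ;; If (TOp (Less r_b r_size)) Skip Succeed ;;
     Do (Guess r_c) ;; If (TOp (Less r_c r_size)) Skip Succeed ;;
     If_edge r_a r_b (If_edge r_b r_c (If (TOp (Eq r_a r_c)) Fail (If_edge r_a r_c Succeed Fail)) Succeed) Succeed"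

text \<open>Made for both modes: a guess that is not a successor is discarded by \<open>Fail\<close>
  in existential mode and by \<open>Succeed\<close> in universal mode.\<close>

definition walk :: "com \<Rightarrow> com" where
  "walk stop = Repeat r_ctr (Do (Guess r_b) ;; If (TOp (Less r_b r_size)) Skip stop ;;
     If_edge r_a r_b (Do (Copy r_a r_b)) stop)"

text \<open>In universal mode a completed walk of one step more than the rank refutes the guess;
  hence the \<open>Fail\<close> at the end.\<close>

definition check_no_chain :: com where
  "check_no_chain = Do (Copy r_a r_world) ;; Do (Copy r_ctr r_rank) ;; Do (Inc r_ctr) ;; walk Succeed ;; Fail"

definition check_chain :: com where
  "check_chain = Switch True ;; Do (Copy r_a r_world) ;; Do (Copy r_ctr r_rank) ;; walk Fail ;; Succeed"

text \<open>The root of the formula is at position 1. Position 0 is no node, so the initial fact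
  asserts nothing.\<close>

definition check_formula :: com where
  "check_formula = Switch True ;; Do (Zero_op r_node) ;; Do (Inc r_node) ;; Do (Copy r_point r_rank) ;;
     Do (Zero_op r_val) ;; Do (Inc r_val) ;;
     Do (Zero_op r_fnode) ;; Do (Zero_op r_flo) ;; Do (Zero_op r_fhi) ;; Do (Zero_op r_fthr) ;; play"

text \<open>After the guess of the rank the opponent selects one of the four conditions to be
  demonstrated. Of these only the formula takes more than boundedly many alternations.\<close>

definition check_instance :: com where
  "check_instance = Do (Guess r_rank) ;; If (TOp (Less r_rank r_size)) Skip Fail ;; Switch False ;;
     choice check_order (choice check_no_chain (choice check_chain check_formula))"

definition model_checker :: com where
  "model_checker = rewind ;; Do (Zero_op 0) ;; read_input ;; check_instance"

lemma (in program_run) A_start: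
  "A m [rewind ;; Do (Zero_op 0) ;; c ;; d] (length x + 1) W \<rho> = run m [c, d] W \<rho>"
proof -
  have "A m [rewind ;; Do (Zero_op 0) ;; c ;; d] (length x + 1) W \<rho> =
      A m [Do (Zero_op 0) ;; c ;; d] 0 W \<rho>"
    by (subst A_Seq) (simp_all only: A_rewind order_refl)
  also have "\<dots> = A m [c ;; d] 0 W (\<rho>(0 := 0))"
    by (subst A_Seq, simp) (rule A_Zero, simp_all)
  also have "\<dots> = A m [c, d] 0 W (\<rho>(0 := 0))"
    by (rule A_Seq) simp
  finally show ?thesis by (simp only: run_def min.idem)
qed

lemma concat_blocks_nth:
  assumes "\<forall>ys\<in>set rows. length ys = m" "a < length rows" "b < m"
  shows "a * m + b < length (concat rows) \<and> concat rows ! (a * m + b) = rows ! a ! b"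
  using assms
proof (induction rows arbitrary: a)
  case (Cons ys rows)
  show ?case
  proof (cases a)
    case 0
    with Cons.prems show ?thesis by (simp add: nth_append)
  next
    case (Suc a')
    with Cons show ?thesis by (auto simp: nth_append add.assoc)
  qed
qed simp

definition matrix_rel :: "sym list list \<Rightarrow> (nat \<times> nat) set" where
  "matrix_rel rows = {(a, b). a < length rows \<and> b < length rows \<and> rows ! a ! b = One}"

lemma matrix_rel_subset: "matrix_rel rows \<subseteq> {..<length rows} \<times> {..<length rows}"
  by (auto simp: matrix_rel_def)

definition strict_below :: "nat \<Rightarrow> (nat \<times> nat) set \<Rightarrow> bool" where
  "strict_below n R \<longleftrightarrow> (\<forall>a<n. \<forall>b<n. \<forall>c<n. (a, b) \<in> R \<and> (b, c) \<in> R \<longrightarrow> a \<noteq> c \<and> (a, c) \<in> R)"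

text \<open>One condition on consecutive edges holds both laws: a loop is such a pair of edges with
  equal ends, and conversely equal ends would by transitivity yield a loop.\<close>

lemma strict_below_iff:
  assumes "R \<subseteq> {..<n} \<times> {..<n}"
  shows "strict_below n R \<longleftrightarrow> trans R \<and> irrefl R"
proof
  assume L: "strict_below n R"
  have *: "a \<noteq> c \<and> (a, c) \<in> R" if "(a, b) \<in> R" "(b, c) \<in> R" for a b c
  proof -
    have "a < n" "b < n" "c < n" using that assms by auto
    with L that show ?thesis unfolding strict_below_def by blast
  qed
  have "trans R" by (rule transI) (use * in blast)
  moreover have "irrefl R" by (rule irreflI) (use * in blast)
  ultimately show "trans R \<and> irrefl R" ..
next
  assume "trans R \<and> irrefl R"
  then show "strict_below n R" unfolding strict_below_def trans_def irrefl_def by metis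
qed

locale input_run = program_run +
  fixes \<phi> :: fm and rows :: "sym list list" and s :: nat
  assumes input: "is_input x \<phi> rows s"
begin

abbreviation "n \<equiv> length rows"
abbreviation "R \<equiv> matrix_rel rows"
abbreviation "fend \<equiv> Suc (length (enc_fm \<phi>))"

definition std :: "(nat \<Rightarrow> nat) \<Rightarrow> bool" where
  "std \<rho> \<longleftrightarrow> \<rho> r_end = fend \<and> \<rho> r_size = n \<and> \<rho> r_world = s"

lemma cell_pos:
  assumes "a < n" "b < n"
  shows "scan x (fend + a * Suc n + 1 + b) = Sym (rows ! a ! b)" "fend + a * Suc n + 1 + b < 2 ^ W"
proof -
  have "\<forall>ys\<in>set (map ((#) Sep) rows). length ys = Suc n" using input by (auto simp: is_input_def)
  from concat_blocks_nth[OF this, of a "Suc b"] assms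
  have *: "a * Suc n + Suc b < length (concat (map ((#) Sep) rows))"
    "concat (map ((#) Sep) rows) ! (a * Suc n + Suc b) = rows ! a ! b" by simp_all
  have x: "x = enc_fm \<phi> @ concat (map ((#) Sep) rows) @ Sep # replicate s One"
    using input by (simp add: is_input_def)
  have i: "fend + a * Suc n + 1 + b - 1 = length (enc_fm \<phi>) + (a * Suc n + Suc b)" by simp
  have l: "length (enc_fm \<phi>) + (a * Suc n + Suc b) < length x"
    using *(1) unfolding x by simp
  have "x ! (length (enc_fm \<phi>) + (a * Suc n + Suc b)) = rows ! a ! b"
    unfolding x nth_append_length_plus using * by (simp only: nth_append if_True)
  then show "scan x (fend + a * Suc n + 1 + b) = Sym (rows ! a ! b)"
    unfolding scan_def i using l by simp
  show "fend + a * Suc n + 1 + b < 2 ^ W" using l W by simp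
qed

lemma size_bounds: "n < 2 ^ W" "Suc n < 2 ^ W" "s < n"
proof -
  have "length rows' \<le> length (concat (map ((#) Sep) rows'))" for rows'
    by (induction rows') auto
  then have "n < length x" using input by (simp add: is_input_def less_Suc_eq_le trans_le_add1 trans_le_add2)
  with W show "n < 2 ^ W" "Suc n < 2 ^ W" by simp_all
  show "s < n" using input by (simp add: is_input_def)
qed

lemma run_skip_rows:
  assumes "\<rho> r_t1 < 2 ^ W" "\<rho> r_size < 2 ^ W" "\<rho> r_t2 = 0"
  shows "run m (Repeat r_t1 (Do (Copy r_t2 r_size) ;; Repeat r_t2 (Do (Inc r_cur)) ;; Do (Inc r_cur)) # K) i \<rho> =
    run m K i (\<rho>(r_cur := \<rho> r_cur + \<rho> r_t1 * Suc (\<rho> r_size), r_t1 := 0))"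
  using assms
proof (induction "\<rho> r_t1" arbitrary: \<rho>)
  case 0
  then show ?case by (simp add: run_Repeat fun_upd_idem)
next
  case (Suc k)
  let ?c = "Do (Copy r_t2 r_size) ;; Repeat r_t2 (Do (Inc r_cur)) ;; Do (Inc r_cur)"
  let ?\<rho> = "\<rho>(r_t1 := k, r_cur := \<rho> r_cur + Suc (\<rho> r_size))"
  have t1: "\<rho> r_t1 = Suc k" using Suc.hyps(2) by simp
  have e: "\<rho>(r_t1 := k, r_t2 := \<rho> r_size, r_cur := \<rho> r_cur + \<rho> r_size, r_t2 := 0, r_cur := Suc (\<rho> r_cur + \<rho> r_size)) = ?\<rho>"
    using Suc.prems(3) by (auto simp: fun_eq_iff)
  have "run m (Repeat r_t1 ?c # K) i \<rho> = run m (?c # Repeat r_t1 ?c # K) i (\<rho>(r_t1 := k))"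
    using Suc.prems t1 by (subst run_Repeat) simp_all
  also have "\<dots> = run m (Repeat r_t1 ?c # K) i
      (\<rho>(r_t1 := k, r_t2 := \<rho> r_size, r_cur := \<rho> r_cur + \<rho> r_size, r_t2 := 0, r_cur := Suc (\<rho> r_cur + \<rho> r_size)))"
    using Suc.prems by (simp add: run_Repeat_Inc)
  also have "\<dots> = run m (Repeat r_t1 ?c # K) i ?\<rho>" by (simp only: e)
  also have "\<dots> = run m K i (?\<rho>(r_cur := ?\<rho> r_cur + ?\<rho> r_t1 * Suc (?\<rho> r_size), r_t1 := 0))"
    using Suc.prems t1 by (intro Suc.hyps(1)) simp_all
  also have "?\<rho>(r_cur := ?\<rho> r_cur + ?\<rho> r_t1 * Suc (?\<rho> r_size), r_t1 := 0) =
      \<rho>(r_cur := \<rho> r_cur + \<rho> r_t1 * Suc (\<rho> r_size), r_t1 := 0)"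
    by (auto simp: fun_eq_iff t1)
  finally show ?case .
qed

lemma run_If_edge:
  assumes "std \<rho>" "\<rho> a < n" "\<rho> b < n" "a \<notin> {0, r_cur, r_t1, r_t2}" "b \<notin> {0, r_cur, r_t1, r_t2}"
    "a < numregs" "b < numregs"
  shows "run m (If_edge a b c d # K) i \<rho> = run m ((if (\<rho> a, \<rho> b) \<in> R then c else d) # K) i
    (\<rho>(r_cur := fend + \<rho> a * Suc n + 1 + \<rho> b, r_t2 := 0, r_t1 := 0))"
proof -
  have B: "\<rho> a < 2 ^ W" "\<rho> b < 2 ^ W" using assms(2,3) size_bounds by auto
  let ?\<rho>1 = "\<rho>(r_cur := fend, r_t2 := 0, r_t1 := \<rho> a)"
  let ?\<rho>2 = "\<rho>(r_cur := fend + \<rho> a * Suc n + 1, r_t2 := 0, r_t1 := \<rho> b)"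
  let ?\<rho>3 = "\<rho>(r_cur := fend + \<rho> a * Suc n + 1 + \<rho> b, r_t2 := 0, r_t1 := 0)"
  let ?K1 = "(Do (Inc r_cur) ;; Do (Copy r_t1 b) ;; Repeat r_t1 (Do (Inc r_cur))) # If_at r_cur [Sym One] c d # K"
  let ?\<sigma> = "?\<rho>1(r_cur := ?\<rho>1 r_cur + ?\<rho>1 r_t1 * Suc (?\<rho>1 r_size), r_t1 := 0)"
  have e2: "?\<rho>2(r_cur := ?\<rho>2 r_cur + ?\<rho>2 r_t1, r_t1 := 0) = ?\<rho>3" by (auto simp: fun_eq_iff)
  have S: "\<rho> r_end = fend" "\<rho> r_size = n" using assms(1) by (simp_all add: std_def)
  have e1: "?\<sigma>(r_cur := ?\<sigma> r_cur + 1, r_t1 := ?\<sigma> b) = ?\<rho>2"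
    using assms(5) S by (simp add: fun_eq_iff)
  have "run m (If_edge a b c d # K) i \<rho> =
    run m (Repeat r_t1 (Do (Copy r_t2 r_size) ;; Repeat r_t2 (Do (Inc r_cur)) ;; Do (Inc r_cur)) # ?K1) i ?\<rho>1"
    using assms(4-7) S by (simp add: If_edge_def lookup_def)
  also have "\<dots> = run m ?K1 i ?\<sigma>"
    using B S size_bounds by (intro run_skip_rows) simp_all
  also have "\<dots> = run m (Repeat r_t1 (Do (Inc r_cur)) # If_at r_cur [Sym One] c d # K) i ?\<rho>2"
  proof -
    have b: "0 < b" "(?\<sigma>(r_cur := ?\<sigma> r_cur + 1)) b = ?\<sigma> b" using assms(5) by simp_all
    have "run m ?K1 i ?\<sigma> = run m (Repeat r_t1 (Do (Inc r_cur)) # If_at r_cur [Sym One] c d # K) i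
        (?\<sigma>(r_cur := ?\<sigma> r_cur + 1, r_t1 := ?\<sigma> b))"
      using b assms(7) by (simp only: run_basic run_opn zero_less_numeral numeral_less_iff less_num_simps)
    then show ?thesis by (simp only: e1)
  qed
  also have "\<dots> = run m (If_at r_cur [Sym One] c d # K) i (?\<rho>2(r_cur := ?\<rho>2 r_cur + ?\<rho>2 r_t1, r_t1 := 0))"
    using B by (intro run_Repeat_Inc) simp_all
  also have "\<dots> = run m (If_at r_cur [Sym One] c d # K) i ?\<rho>3" by (simp only: e2)
  also have "\<dots> = run m ((if (\<rho> a, \<rho> b) \<in> R then c else d) # K) i ?\<rho>3"
  proof -
    have "?\<rho>3 r_cur = fend + \<rho> a * Suc n + 1 + \<rho> b" by simp
    then show ?thesis
      using cell_pos[OF assms(2,3)] assms(2,3) by (subst run_If_at) (simp_all add: matrix_rel_def)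
  qed
  finally show ?thesis .
qed

lemma std_upd [simp]:
  "r \<notin> {r_end, r_size, r_world} \<Longrightarrow> std (\<rho>(r := v)) = std \<rho>"
  by (simp add: std_def)

lemma run_all_worlds:
  assumes "std \<rho>" "0 < r" "r < numregs" "r \<noteq> r_size" "\<And>v. v < n \<Longrightarrow> run False (c # K) i (\<rho>(r := v)) = P v"
  shows "run False ((Do (Guess r) ;; If (TOp (Less r r_size)) Skip Succeed ;; c) # K) i \<rho> = (\<forall>v<n. P v)"
proof -
  have S: "\<rho> r_size = n" using assms(1) by (simp add: std_def)
  have step: "run False ((If (TOp (Less r r_size)) Skip Succeed ;; c) # K) i (\<rho>(r := v)) = (v < n \<longrightarrow> P v)"
    if "v < 2 ^ W" for v
  proof -
    have "run False ((If (TOp (Less r r_size)) Skip Succeed ;; c) # K) i (\<rho>(r := v)) =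
        run False ((if v < n then Skip else Succeed) # c # K) i (\<rho>(r := v))"
      using assms(2-4) S that size_bounds by (simp only: run_basic) (subst run_If(3); simp)
    then show ?thesis using assms(5)[of v] by (cases "v < n") (simp_all only: if_True if_False run_basic simp_thms)
  qed
  have "run False ((Do (Guess r) ;; If (TOp (Less r r_size)) Skip Succeed ;; c) # K) i \<rho> =
      quant False {..<2 ^ W} (\<lambda>v. run False ((If (TOp (Less r r_size)) Skip Succeed ;; c) # K) i (\<rho>(r := v)))"
    by (simp only: run_basic(2)[of _ "Do (Guess r)"] run_opn(5)[OF assms(2,3)])
  also have "\<dots> = quant False {..<2 ^ W} (\<lambda>v. v < n \<longrightarrow> P v)"
    by (rule quant_cong) (use step in simp)
  finally show ?thesis using size_bounds by (auto simp: quant_def)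
qed

lemma run_check_order:
  assumes "std \<rho>"
  shows "run False (check_order # K) i \<rho> \<longleftrightarrow> strict_below n R"
  unfolding check_order_def strict_below_def
proof (intro run_all_worlds)
  fix a b c assume n: "a < n" "b < n" "c < n"
  let ?\<rho> = "\<rho>(r_a := a, r_b := b, r_c := c)"
  have B: "a < 2 ^ W" "c < 2 ^ W" using n size_bounds by auto
  show "run False (If_edge r_a r_b (If_edge r_b r_c (If (TOp (Eq r_a r_c)) Fail (If_edge r_a r_c Succeed Fail)) Succeed)
      Succeed # K) i ?\<rho> \<longleftrightarrow> ((a, b) \<in> R \<and> (b, c) \<in> R \<longrightarrow> a \<noteq> c \<and> (a, c) \<in> R)"
    using n B assms
    by (cases "(a, b) \<in> R"; cases "(b, c) \<in> R"; cases "a = c"; cases "(a, c) \<in> R") (simp_all add: run_If_edge)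
qed (simp_all add: assms)

lemma run_walk:
  assumes "std \<rho>" "\<rho> r_a < n" "\<rho> r_ctr < 2 ^ W"
  shows "run True (walk Fail # Succeed # K) i \<rho> \<longleftrightarrow> chain R (\<rho> r_ctr) (\<rho> r_a)"
    and "run False (walk Succeed # Fail # K) i \<rho> \<longleftrightarrow> \<not> chain R (\<rho> r_ctr) (\<rho> r_a)"
proof -
  define stop where "stop m = (if m then Fail else Succeed)" for m
  define finish where "finish m = (if m then Succeed else Fail)" for m
  \<comment> \<open>Exchanging the two final commands along with the mode makes the runs dual, so
    one induction on the length of the walk proves both claims.\<close>
  have "run m (walk (stop m) # finish m # K) i \<rho> = (m \<longleftrightarrow> chain R (\<rho> r_ctr) (\<rho> r_a))" for m
    using assms
  proof (induction "\<rho> r_ctr" arbitrary: \<rho>)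
    case 0
    then show ?case by (simp add: walk_def run_Repeat finish_def)
  next
    case (Suc k)
    have S: "\<rho> r_size = n" using Suc.prems(1) by (simp add: std_def)
    let ?c = "If (TOp (Less r_b r_size)) Skip (stop m) ;; If_edge r_a r_b (Do (Copy r_a r_b)) (stop m)"
    let ?K = "walk (stop m) # finish m # K"
    have step: "run m (?c # ?K) i (\<rho>(r_ctr := k, r_b := v)) =
        (if m then (\<rho> r_a, v) \<in> R \<and> chain R k v else \<not> ((\<rho> r_a, v) \<in> R \<and> chain R k v))" if "v < 2 ^ W" for v
    proof (cases "v < n")
      case False
      then have "(\<rho> r_a, v) \<notin> R" by (simp add: matrix_rel_def)
      then show ?thesis using False that S size_bounds by (cases m) (simp_all add: stop_def)
    next
      case True
      let ?\<rho> = "\<rho>(r_ctr := k, r_b := v, r_cur := fend + \<rho> r_a * Suc n + 1 + v, r_t2 := 0, r_t1 := 0)"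
      have "run m (?c # ?K) i (\<rho>(r_ctr := k, r_b := v)) =
          run m ((if (\<rho> r_a, v) \<in> R then Do (Copy r_a r_b) else stop m) # ?K) i ?\<rho>"
        using True that S size_bounds Suc.prems(1,2) by (simp add: run_If_edge)
      also have "\<dots> = (if m then (\<rho> r_a, v) \<in> R \<and> chain R k v else \<not> ((\<rho> r_a, v) \<in> R \<and> chain R k v))"
      proof (cases "(\<rho> r_a, v) \<in> R")
        case False
        then show ?thesis by (cases m) (simp_all add: stop_def)
      next
        case e: True
        have "run m ?K i (?\<rho>(r_a := v)) = (m \<longleftrightarrow> chain R ((?\<rho>(r_a := v)) r_ctr) ((?\<rho>(r_a := v)) r_a))"
          using Suc.prems Suc.hyps(2) True by (intro Suc.hyps(1)) simp_all
        then show ?thesis using e by auto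
      qed
      finally show ?thesis .
    qed
    have "run m (walk (stop m) # finish m # K) i \<rho> = quant m {..<2 ^ W} (\<lambda>v. run m (?c # ?K) i (\<rho>(r_ctr := k, r_b := v)))"
      using Suc.prems(3) Suc.hyps(2)[symmetric] unfolding walk_def by (subst run_Repeat) (simp_all del: run_If)
    also have "\<dots> = quant m {..<2 ^ W} (\<lambda>v. if m then (\<rho> r_a, v) \<in> R \<and> chain R k v else \<not> ((\<rho> r_a, v) \<in> R \<and> chain R k v))"
      by (rule quant_cong) (use step in simp)
    also have "\<dots> = (m \<longleftrightarrow> (\<exists>v<2 ^ W. (\<rho> r_a, v) \<in> R \<and> chain R k v))"
      by (cases m) (auto simp: quant_def)
    also have "(\<exists>v<2 ^ W. (\<rho> r_a, v) \<in> R \<and> chain R k v) \<longleftrightarrow> chain R (Suc k) (\<rho> r_a)"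
      using size_bounds unfolding chain_Suc matrix_rel_def by (auto intro: order_less_trans)
    finally show ?case using Suc.hyps(2) by simp
  qed
  from this[of True] this[of False]
  show "run True (walk Fail # Succeed # K) i \<rho> \<longleftrightarrow> chain R (\<rho> r_ctr) (\<rho> r_a)"
    "run False (walk Succeed # Fail # K) i \<rho> \<longleftrightarrow> \<not> chain R (\<rho> r_ctr) (\<rho> r_a)"
    by (simp_all add: stop_def finish_def)
qed

lemma run_check_formula:
  assumes "std \<rho>" "\<rho> r_rank < n"
  shows "run m (check_formula # K) W \<rho> \<longleftrightarrow> lsat (\<rho> r_rank) \<phi>"
proof -
  have x: "x = enc_fm \<phi> @ (concat (map ((#) Sep) rows) @ Sep # replicate s One)" and \<phi>: "\<phi> \<in> PrL0"
    using input by (simp_all add: is_input_def)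
  interpret checker_run p x W \<phi> "concat (map ((#) Sep) rows) @ Sep # replicate s One" "\<rho> r_rank"
  proof unfold_locales
    show "Suc (\<rho> r_rank) < 2 ^ W" using assms(2) size_bounds by simp
  qed (fact \<phi>, fact x)
  have ne: "0 < length (enc_fm \<phi>)" using \<phi> by (cases \<phi>) simp_all
  have "suf (Suc 0) = enc_fm \<phi> @ (concat (map ((#) Sep) rows) @ Sep # replicate s One)"
    unfolding suf_eq by simp
  then have f: "form (Suc 0) = \<phi>" by (rule form_eq[OF \<phi>])
  let ?\<rho> = "\<rho>(r_node := Suc 0, r_point := \<rho> r_rank, r_val := Suc 0, r_fnode := 0, r_flo := 0, r_fhi := 0, r_fthr := 0)"
  have "good ?\<rho>" using assms size_bounds ne by (simp add: good_def nodes_def std_def Suc_le_eq)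
  moreover have "run m (check_formula # K) W \<rho> = run True (play # K) W ?\<rho>"
    by (simp add: check_formula_def)
  ultimately show ?thesis using run_play[of ?\<rho> K] f by simp
qed

lemma run_check_instance:
  assumes "std \<rho>"
  shows "run True (check_instance # K) W \<rho> \<longleftrightarrow> strict_below n R \<and> (\<exists>k<n. rank_of R s k \<and> lsat k \<phi>)"
proof -
  have S: "\<rho> r_size = n" using assms by (simp add: std_def)
  let ?O = "strict_below n R"
  let ?c = "choice check_order (choice check_no_chain (choice check_chain check_formula))"
  have *: "run False (?c # K) W (\<rho>(r_rank := k)) \<longleftrightarrow> ?O \<and> rank_of R s k \<and> lsat k \<phi>" if k: "k < n" for k
  proof -
    let ?\<rho> = "\<rho>(r_rank := k)"
    have std: "std ?\<rho>" "std (?\<rho>(r_coin := v))" "std (?\<rho>(r_coin := v, r_coin := v'))"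
      "std (?\<rho>(r_coin := v, r_coin := v', r_coin := v''))" for v v' v'' using assms by simp_all
    have b: "Suc k < 2 ^ W" "s < n" using k size_bounds by auto
    have 1: "run False (check_order # K) W (?\<rho>(r_coin := v)) = ?O" for v
      by (rule run_check_order[OF std(2)])
    have w: "\<rho> r_world = s" using assms by (simp add: std_def)
    have 2: "run False (check_no_chain # K) W (?\<rho>(r_coin := v, r_coin := v')) = (\<not> chain R (Suc k) s)" for v v'
    proof -
      let ?r = "?\<rho>(r_coin := v, r_coin := v', r_a := s, r_ctr := Suc k)"
      have "std ?r" "?r r_a = s" "?r r_ctr = Suc k" using assms by simp_all
      then have "run False (walk Succeed # Fail # K) W ?r = (\<not> chain R (Suc k) s)"
        using b run_walk(2)[of ?r K W] by (simp only:)
      moreover have "run False (check_no_chain # K) W (?\<rho>(r_coin := v, r_coin := v')) =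
          run False (walk Succeed # Fail # K) W ?r"
        by (simp add: check_no_chain_def w)
      ultimately show ?thesis by (simp only:)
    qed
    have 3: "run False (check_chain # K) W (?\<rho>(r_coin := v, r_coin := v', r_coin := v'')) = chain R k s" for v v' v''
    proof -
      let ?r = "?\<rho>(r_coin := v, r_coin := v', r_coin := v'', r_a := s, r_ctr := k)"
      have "std ?r" "?r r_a = s" "?r r_ctr = k" "k < 2 ^ W" using assms b by simp_all
      then have "run True (walk Fail # Succeed # K) W ?r = chain R k s"
        using b(2) run_walk(1)[of ?r K W] by (simp only:)
      moreover have "run False (check_chain # K) W (?\<rho>(r_coin := v, r_coin := v', r_coin := v'')) =
          run True (walk Fail # Succeed # K) W ?r"
        by (simp add: check_chain_def w)
      ultimately show ?thesis by (simp only:)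
    qed
    have 4: "run False (check_formula # K) W (?\<rho>(r_coin := v, r_coin := v', r_coin := v'')) = lsat k \<phi>" for v v' v''
      using run_check_formula[OF std(4)[of v v' v'']] k by simp
    have c34: "run False (choice check_chain check_formula # K) W (?\<rho>(r_coin := v, r_coin := v')) =
        (chain R k s \<and> lsat k \<phi>)" for v v'
      using run_choice[where m = False and \<rho> = "?\<rho>(r_coin := v, r_coin := v')", OF 3 4]
      by (simp only: if_False)
    have c234: "run False (choice check_no_chain (choice check_chain check_formula) # K) W (?\<rho>(r_coin := v)) =
        (\<not> chain R (Suc k) s \<and> chain R k s \<and> lsat k \<phi>)" for v
      using run_choice[where m = False and \<rho> = "?\<rho>(r_coin := v)", OF 2 c34] by (simp only: if_False)
    have "run False (?c # K) W ?\<rho> = (?O \<and> \<not> chain R (Suc k) s \<and> chain R k s \<and> lsat k \<phi>)"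
      using run_choice[where m = False and \<rho> = ?\<rho>, OF 1 c234] by (simp only: if_False)
    then show ?thesis unfolding rank_of_def by (simp only: conj_ac)
  qed
  have "run True (check_instance # K) W \<rho> = quant True {..<2 ^ W} (\<lambda>k.
      run True (If (TOp (Less r_rank r_size)) Skip Fail # (Switch False ;; ?c) # K) W (\<rho>(r_rank := k)))"
    by (simp add: check_instance_def del: run_If)
  also have "\<dots> = quant True {..<2 ^ W} (\<lambda>k. k < n \<and> ?O \<and> rank_of R s k \<and> lsat k \<phi>)"
  proof (rule quant_cong)
    fix k :: nat assume "k \<in> {..<2 ^ W}"
    then show "run True (If (TOp (Less r_rank r_size)) Skip Fail # (Switch False ;; ?c) # K) W (\<rho>(r_rank := k)) =
        (k < n \<and> ?O \<and> rank_of R s k \<and> lsat k \<phi>)"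
      using *[of k] S size_bounds by (cases "k < n") simp_all
  qed
  also have "\<dots> \<longleftrightarrow> ?O \<and> (\<exists>k<n. rank_of R s k \<and> lsat k \<phi>)"
    using size_bounds by (auto simp: quant_def)
  finally show ?thesis .
qed

end

subsection \<open>The language of the model checker\<close>

lemma is_input_enc_inst:
  assumes "PrL0_inst \<phi> M s"
  shows "\<exists>rows. is_input (enc_inst \<phi> M s) \<phi> rows s \<and> length rows = card (worlds M) \<and> matrix_rel rows = rel M"
proof -
  let ?n = "card (worlds M)"
  let ?rows = "map (\<lambda>i. map (\<lambda>j. if (i, j) \<in> rel M then One else Zero) [0..<?n]) [0..<?n]"
  have w: "worlds M = {..<?n}" "\<phi> \<in> PrL0" "s \<in> worlds M" "rel M \<subseteq> worlds M \<times> worlds M"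
    using assms by (auto simp: PrL0_inst_def PrL_model_def)
  have "map (enc_row M) [0..<?n] = map ((#) Sep) ?rows" by (simp add: enc_row_def)
  then have "enc_inst \<phi> M s = enc_fm \<phi> @ concat (map ((#) Sep) ?rows) @ Sep # replicate s One"
    by (simp only: enc_inst_def)
  moreover have "s < ?n" using w(1,3) by auto
  ultimately have "is_input (enc_inst \<phi> M s) \<phi> ?rows s"
    using w(2) by (auto simp: is_input_def)
  moreover have "(a, b) \<in> rel M \<Longrightarrow> a < ?n \<and> b < ?n" for a b using w(1,4) by auto
  then have "matrix_rel ?rows = rel M"
    by (auto simp: matrix_rel_def split: if_splits)
  ultimately show ?thesis by (intro exI[of _ ?rows]) simp
qed

lemma enc_inst_is_input:
  assumes "is_input x \<phi> rows s" "trans (matrix_rel rows)" "irrefl (matrix_rel rows)"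
  defines "M \<equiv> \<lparr>worlds = {..<length rows}, rel = matrix_rel rows, val = \<lambda>_. {}\<rparr>"
  shows "PrL0_inst \<phi> M s" "x = enc_inst \<phi> M s"
proof -
  let ?n = "length rows"
  have I: "\<phi> \<in> PrL0" "s < ?n" "\<And>ys. ys \<in> set rows \<Longrightarrow> length ys = ?n \<and> set ys \<subseteq> {Zero, One}"
    "x = enc_fm \<phi> @ concat (map ((#) Sep) rows) @ Sep # replicate s One"
    using assms(1) by (simp_all add: is_input_def)
  have "{..<?n} \<noteq> {}" using I(2) by auto
  then have "PrL_model M"
    using assms(2,3) matrix_rel_subset[of rows] by (simp add: PrL_model_def M_def)
  then show "PrL0_inst \<phi> M s" using I(1,2) by (simp add: PrL0_inst_def M_def)
  have "map (enc_row M) [0..<?n] = map ((#) Sep) rows"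
  proof (rule nth_equalityI)
    fix i assume "i < length (map (enc_row M) [0..<?n])"
    then have i: "i < ?n" by simp
    have l: "length (rows ! i) = ?n" "set (rows ! i) \<subseteq> {Zero, One}" using I(3)[of "rows ! i"] i by auto
    have "map (\<lambda>j. if (i, j) \<in> matrix_rel rows then One else Zero) [0..<?n] = rows ! i"
    proof (rule nth_equalityI)
      fix j assume "j < length (map (\<lambda>j. if (i, j) \<in> matrix_rel rows then One else Zero) [0..<?n])"
      then have j: "j < ?n" by simp
      then have "rows ! i ! j \<in> {Zero, One}" using subsetD[OF l(2) nth_mem[of j "rows ! i"]] l(1) by simp
      then show "map (\<lambda>j. if (i, j) \<in> matrix_rel rows then One else Zero) [0..<?n] ! j = rows ! i ! j"
        using i j by (auto simp: matrix_rel_def)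
    qed (simp add: l)
    then show "map (enc_row M) [0..<?n] ! i = map ((#) Sep) rows ! i"
      using i by (simp add: enc_row_def M_def)
  qed simp
  moreover have "card (worlds M) = ?n" by (simp add: M_def)
  ultimately show "x = enc_inst \<phi> M s" unfolding enc_inst_def using I(4) by (simp only:)
qed

lemma wf_model_checker: "wf_com model_checker"
  by (simp add: model_checker_def rewind_def read_input_def parse_def If_at_def seek_def Repeat_def read_row_def
      read_world_def expect_def check_instance_def choice_def check_order_def If_edge_def lookup_def walk_def
      check_no_chain_def check_chain_def check_formula_def play_def game_round_def use_fact_def unfold_node_def
      cut_def cut_check_def take_fact_def challenge_fact_def eval_nat_numeral)

text \<open>For an instance, \<open>rank_exists\<close> and \<open>rank_less_card\<close> supply the
  number to be guessed. For an accepted string, a model is rebuilt from the matrix with the empty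
  valuation.\<close>

lemma is_input_model_checking:
  "(\<exists>\<phi> rows s. is_input x \<phi> rows s \<and> strict_below (length rows) (matrix_rel rows) \<and>
      (\<exists>k<length rows. rank_of (matrix_rel rows) s k \<and> lsat k \<phi>)) \<longleftrightarrow> x \<in> PrL0_model_checking"
proof
  assume "\<exists>\<phi> rows s. is_input x \<phi> rows s \<and> strict_below (length rows) (matrix_rel rows) \<and>
      (\<exists>k<length rows. rank_of (matrix_rel rows) s k \<and> lsat k \<phi>)"
  then obtain \<phi> rows s k where *: "is_input x \<phi> rows s" "strict_below (length rows) (matrix_rel rows)"
    "rank_of (matrix_rel rows) s k" "lsat k \<phi>"
    by blast
  define M :: "nat kripke" where "M = \<lparr>worlds = {..<length rows}, rel = matrix_rel rows, val = \<lambda>_. {}\<rparr>"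
  have "trans (matrix_rel rows)" "irrefl (matrix_rel rows)"
    using *(2) strict_below_iff[OF matrix_rel_subset] by simp_all
  note I = enc_inst_is_input[OF *(1) this, folded M_def]
  have "PrL_model M" "vars \<phi> = {}" using I(1) by (simp_all add: PrL0_inst_def PrL0_def)
  moreover have "rank_of (rel M) s k" using *(3) by (simp add: M_def)
  ultimately have "sat M s \<phi>" using sat_iff_lsat[of M s k \<phi>] *(4) by (simp only:)
  with I show "x \<in> PrL0_model_checking" unfolding PrL0_model_checking_def
    by (intro CollectI exI[of _ \<phi>] exI[of _ M] exI[of _ s] conjI)
next
  assume "x \<in> PrL0_model_checking"
  then obtain \<phi> M s where *: "x = enc_inst \<phi> M s" "PrL0_inst \<phi> M s" "sat M s \<phi>"
    unfolding PrL0_model_checking_def by blast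
  from *(2) have M: "PrL_model M" "s \<in> worlds M" "vars \<phi> = {}" by (simp_all add: PrL0_inst_def PrL0_def)
  obtain rows where rows: "is_input x \<phi> rows s" "length rows = card (worlds M)" "matrix_rel rows = rel M"
    using is_input_enc_inst[OF *(2)] unfolding *(1)[symmetric] by (elim exE conjE) (rule that)
  obtain k where k: "rank_of (rel M) s k" using rank_exists[OF PrL_model_rel(2,3)[OF M(1)], of s] by (elim exE) (rule that)
  have "k < length rows" using rank_less_card[OF M(1) k M(2)] rows(2) by simp
  moreover have "lsat k \<phi>" using sat_iff_lsat[OF M(1) k M(3)] *(3) by simp
  moreover have "strict_below (length rows) (matrix_rel rows)"
    using M(1) rows(3) strict_below_iff[OF matrix_rel_subset, of rows] by (simp add: PrL_model_def)
  moreover have "rank_of (matrix_rel rows) s k" using k by (simp only: rows(3))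
  ultimately show "\<exists>\<phi> rows s. is_input x \<phi> rows s \<and> strict_below (length rows) (matrix_rel rows) \<and>
      (\<exists>k<length rows. rank_of (matrix_rel rows) s k \<and> lsat k \<phi>)"
    using rows(1) by (intro exI[of _ \<phi>] exI[of _ rows] exI[of _ s] exI[of _ k] conjI)
qed

theorem language_model_checker: "language (machine model_checker) = PrL0_model_checking"
proof (intro set_eqI)
  fix x :: "sym list"
  interpret program_run model_checker x "width (length x + 1)"
    by unfold_locales (rule less_width)
  let ?W = "width (length x + 1)"
  let ?ok = "\<lambda>rows. strict_below (length rows) (matrix_rel rows)"
  let ?\<rho> = "(\<lambda>_. 0)(0 := length x + 1) :: nat \<Rightarrow> nat"
  have "[model_checker] = [rewind ;; Do (Zero_op 0) ;; read_input ;; check_instance]"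
    by (simp only: model_checker_def)
  then have "A True [model_checker] (length x + 1) ?W ?\<rho> \<longleftrightarrow> run True [read_input, check_instance] ?W ?\<rho>"
    using A_start by (simp only:)
  then have "x \<in> language (machine model_checker) \<longleftrightarrow> run True [read_input, check_instance] ?W ?\<rho>"
    by (simp only: in_language_machine)
  also have "\<dots> \<longleftrightarrow> (\<exists>\<phi> rows s. is_input x \<phi> rows s \<and>
      ?ok rows \<and> (\<exists>k<length rows. rank_of (matrix_rel rows) s k \<and> lsat k \<phi>))"
  proof (rule run_read_input)
    fix \<phi> rows s \<rho>
    assume i: "is_input x \<phi> rows s" and \<rho>: "\<rho> r_end = Suc (length (enc_fm \<phi>))" "\<rho> r_size = length rows" "\<rho> r_world = s"
    interpret input_run model_checker x ?W \<phi> rows s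
      by unfold_locales (rule i)
    show "run True [check_instance] ?W \<rho> \<longleftrightarrow>
        ?ok rows \<and> (\<exists>k<length rows. rank_of (matrix_rel rows) s k \<and> lsat k \<phi>)"
      by (rule run_check_instance) (simp add: std_def \<rho>)
  qed
  also have "\<dots> \<longleftrightarrow> x \<in> PrL0_model_checking"
    by (rule is_input_model_checking)
  finally show "x \<in> language (machine model_checker) \<longleftrightarrow> x \<in> PrL0_model_checking" .
qed

theorem theorem4p5: "PrL0_model_checking \<in> AC1"
  using machine_in_AC1[OF wf_model_checker] language_model_checker by simp

end
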